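(* Let $p\in\{2,\infty\}$. There exist constants $\lambda_A,\lambda_B\ge 0$, $\varepsilon>0$ and an intermediate dimension $m=m(n)=O(n)$ such that the randomized communication complexity of the Composition Brouwer problem satisfies $\mathsf{CC}(\mathsf{Comp}_{p,n,\varepsilon,\lambda_A,\lambda_B})=2^{\Omega(n)}$.
   Context: For $p\in\mathbb{R}_{\ge1}$ the normalized $p$-norm of $x\in\mathbb{R}^k$ is $\|x\|_p=\left(\frac1k\sum_{i\in[k]}|x_i|^p\right)^{1/p}$, and $\|x\|_\infty=\max_i|x_i|$. A function is $\lambda$-Lipschitz if $\|f(x)-f(y)\|_p\le\lambda\|x-y\|_p$ for all $x,y$ in its domain. Composition Brouwer problem $\mathsf{Comp}_{p,n,\varepsilon,\lambda_A,\lambda_B}$ (with public dimension $m$): player $A$ gets a $\lambda_A$-Lipschitz $f_A:[0,1]^n\to[0,1]^m$, player $B$ gets a $\lambda_B$-Lipschitz $f_B:[0,1]^m\to[0,1]^n$; they must output $x\in[0,1]^n$ with $\|f_B(f_A(x))-x\|_p\le\varepsilon$. $\mathsf{CC}$ denotes randomized communication complexity. *)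

theory Defs
  imports "HOL-Probability.Probability" "HOL-Library.Landau_Symbols"
begin

text \<open>Vectors of \<open>\<real>\<^sup>k\<close> are functions \<open>nat \<Rightarrow> real\<close> of which only the coordinates below \<open>k\<close> matter;
  the dimension has to be a term because it varies with \<open>n\<close>.\<close>

definition cube :: "nat \<Rightarrow> (nat \<Rightarrow> real) set" where
  "cube k = ({..<k} \<rightarrow>\<^sub>E {0..1})"

text \<open>Normalized \<open>p\<close>-norm, meant for \<open>k \<ge> 1\<close> and \<open>1 \<le> p \<le> \<infinity>\<close>.\<close>

definition pnorm :: "ereal \<Rightarrow> nat \<Rightarrow> (nat \<Rightarrow> real) \<Rightarrow> real" where
  "pnorm p k x =
     (if p = \<infinity> then Max ((\<lambda>i. \<bar>x i\<bar>) ` {..<k})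
      else (1 / real k * (\<Sum>i<k. \<bar>x i\<bar> powr real_of_ereal p)) powr (1 / real_of_ereal p))"

definition lipschitz_maps ::
    "ereal \<Rightarrow> nat \<Rightarrow> nat \<Rightarrow> real \<Rightarrow> ((nat \<Rightarrow> real) \<Rightarrow> nat \<Rightarrow> real) set" where
  "lipschitz_maps p n m L =
     {f \<in> cube n \<rightarrow>\<^sub>E cube m.
        \<forall>x\<in>cube n. \<forall>y\<in>cube n.
          pnorm p m (\<lambda>i. f x i - f y i) \<le> L * pnorm p n (\<lambda>i. x i - y i)}"

text \<open>Deterministic two-party protocol trees: at an inner node one player sends the bit that the
  node's predicate yields on that player's input, and the protocol continues in the first subtree
  if the bit is \<open>True\<close>, in the second otherwise. The output is determined by the transcript.\<close>

datatype ('a, 'b, 'z) protocol =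
    Output 'z
  | Alice "'a \<Rightarrow> bool" "('a, 'b, 'z) protocol" "('a, 'b, 'z) protocol"
  | Bob "'b \<Rightarrow> bool" "('a, 'b, 'z) protocol" "('a, 'b, 'z) protocol"

primrec run :: "('a, 'b, 'z) protocol \<Rightarrow> 'a \<Rightarrow> 'b \<Rightarrow> 'z" where
  "run (Output z) a b = z"
| "run (Alice g P Q) a b = (if g a then run P a b else run Q a b)"
| "run (Bob g P Q) a b = (if g b then run P a b else run Q a b)"

primrec cost :: "('a, 'b, 'z) protocol \<Rightarrow> nat" where
  "cost (Output z) = 0"
| "cost (Alice g P Q) = Suc (max (cost P) (cost Q))"
| "cost (Bob g P Q) = Suc (max (cost P) (cost Q))"

text \<open>A public-coin randomized protocol is a probability distribution over deterministic protocols.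
  It solves the search problem \<open>R\<close> on inputs from \<open>X \<times> Y\<close> if on every input pair it errs with
  probability at most \<open>1/3\<close>. Since \<^const>\<open>measure\<close> is \<open>0\<close> on non-measurable sets, the bound
  includes measurability of the success event. The distribution is not required to be discrete.\<close>

definition randomized_protocol ::
    "'a set \<Rightarrow> 'b set \<Rightarrow> ('a \<Rightarrow> 'b \<Rightarrow> 'z \<Rightarrow> bool) \<Rightarrow> nat \<Rightarrow> ('a, 'b, 'z) protocol measure \<Rightarrow> bool" where
  "randomized_protocol X Y R c M \<longleftrightarrow>
     prob_space M \<and>
     (\<forall>P\<in>space M. cost P \<le> c) \<and>
     (\<forall>a\<in>X. \<forall>b\<in>Y. measure M {P \<in> space M. R a b (run P a b)} \<ge> 2 / 3)"

text \<open>The value is \<open>\<infinity>\<close> if no protocol of bounded cost exists.\<close>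

definition randomized_CC :: "'a set \<Rightarrow> 'b set \<Rightarrow> ('a \<Rightarrow> 'b \<Rightarrow> 'z \<Rightarrow> bool) \<Rightarrow> enat" where
  "randomized_CC X Y R = Inf {enat c | c. \<exists>M. randomized_protocol X Y R c M}"

definition comp_solution ::
    "ereal \<Rightarrow> nat \<Rightarrow> real \<Rightarrow> ((nat \<Rightarrow> real) \<Rightarrow> nat \<Rightarrow> real) \<Rightarrow> ((nat \<Rightarrow> real) \<Rightarrow> nat \<Rightarrow> real)
       \<Rightarrow> (nat \<Rightarrow> real) \<Rightarrow> bool" where
  "comp_solution p n \<epsilon> fA fB x \<longleftrightarrow>
     x \<in> cube n \<and> pnorm p n (\<lambda>i. fB (fA x) i - x i) \<le> \<epsilon>"

definition comp_CC :: "ereal \<Rightarrow> nat \<Rightarrow> nat \<Rightarrow> real \<Rightarrow> real \<Rightarrow> real \<Rightarrow> enat" where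
  "comp_CC p n m \<epsilon> L\<^sub>A L\<^sub>B =
     randomized_CC (lipschitz_maps p n m L\<^sub>A) (lipschitz_maps p m n L\<^sub>B) (comp_solution p n \<epsilon>)"

end

theory Submission imports Defs begin

text \<open>A line, given by the successor and predecessor pointers of a partial matching between \<open>N\<close> left
  and \<open>N\<close> right vertices, is hidden by a two-party hash gadget at every pointer. A point of the cube
  consists of two approximate codewords \<open>P1\<close>, \<open>P2\<close> that name the current edge, a phase \<open>(C, S)\<close> and a
  height \<open>y\<close>. The first player appends the codewords of her gadget shares at \<open>P1\<close> and \<open>P2\<close>; the second
  player recovers the pointers and moves the point: at small height the phase rotates forwards, at
  large height backwards, and during one turn of the phase first \<open>P2\<close> and then \<open>P1\<close> advances along the
  line. The height decreases only inside a tube around the line. With the tail of the line blocked,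
  all approximate fixed points of the composition lie at the end of the line. Only codewords and
  averages of coordinates are written, so one estimate in the normalized \<open>2\<close>-norm serves both values
  of \<open>p\<close>.

  To see that the end is hard to find, cut every edge of a random line with probability \<open>r\<close>. By symmetry
  a protocol finds the original end with probability at most \<open>1 / (N r)\<close>. Since the gadget has small
  discrepancy, this probability is, up to a small error, a polynomial in \<open>r\<close> of degree less than
  \<open>D \<approx> \<surd>N\<close> unless the protocol costs at least \<open>D\<close>. Alternating binomial weights at the nodes
  \<open>(i / D)\<^sup>2\<close> annihilate such polynomials, which contradicts success probability \<open>2 / 3\<close> at \<open>r = 0\<close>.\<close>

section \<open>Alternating binomial sums\<close>

text \<open>The protocol is correct only on uncut lines: a cut line has many ends, and the
  composition may have approximate fixed points at each of them. After cutting, the argument may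
  therefore use only that one output is close to at most one left vertex and that exchanging two cut
  ends leaves the instance unchanged.

  The square root in the degree bound comes from the squares in the nodes. They make 0 the central
  node, where the binomial weight is largest, and the reciprocals of the other nodes sum to at most
  \<open>4 * D^2\<close>, which is N / 4. The gadget enters through operator norms because these
  multiply over the 2 N positions.

  On the geometric side the obstacle is the start of the line, which is as much an endpoint as the
  end is. Fixed points exist by Brouwer's theorem, and none may be left at the start. The height
  removes them: outside the tube points rise to the top, the top is pulled to the start, and there
  they are inside the tube again. What remains to be excluded is a balance on the boundary of the
  tube, at a height where the rotation changes its sense.\<close>

lemma alternating_binomial_power_sum:
  fixes x :: real
  assumes "m < n"
  shows "(\<Sum>i\<le>n. (-1) ^ i * real (n choose i) * (x + real i) ^ m) = 0"
  using assms
proof (induction n arbitrary: m x)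
  case 0
  then show ?case by simp
next
  case (Suc n)
  let ?b = "\<lambda>i. (-1) ^ i * real (n choose i)"
  let ?f = "\<lambda>x i. (x + real i) ^ m :: real"
  have "(\<Sum>i\<le>Suc n. (-1) ^ i * real (Suc n choose i) * ?f x i)
      = ?f x 0 + (\<Sum>i\<le>n. (-1) ^ Suc i * real (Suc n choose Suc i) * ?f x (Suc i))"
    by (subst sum.atMost_Suc_shift) simp
  \<comment> \<open>Pascal's rule. What remains is minus the sum of order \<open>n\<close> over the
    forward difference of \<open>?f x\<close>, whose degree is below \<open>m\<close>.\<close>
  also have "(\<Sum>i\<le>n. (-1) ^ Suc i * real (Suc n choose Suc i) * ?f x (Suc i))
     = (\<Sum>i\<le>n. (-1) ^ Suc i * real (n choose Suc i) * ?f x (Suc i))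
       - (\<Sum>i\<le>n. ?b i * ?f x (Suc i))"
    by (subst sum_subtractf[symmetric], intro sum.cong refl) (simp add: algebra_simps)
  also have "?f x 0 + ((\<Sum>i\<le>n. (-1) ^ Suc i * real (n choose Suc i) * ?f x (Suc i))
       - (\<Sum>i\<le>n. ?b i * ?f x (Suc i)))
     = (\<Sum>i\<le>Suc n. ?b i * ?f x i)
       - (\<Sum>i\<le>n. ?b i * ?f x (Suc i))"
    by (simp only: sum.atMost_Suc_shift) simp
  also have "(\<Sum>i\<le>Suc n. ?b i * ?f x i)
      = (\<Sum>i\<le>n. ?b i * ?f x i)"
    by simp
  also have "\<dots> - (\<Sum>i\<le>n. ?b i * ?f x (Suc i))
      = - (\<Sum>i\<le>n. ?b i * (?f x (Suc i) - ?f x i))"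
    by (simp add: algebra_simps sum_subtractf)
  also have "(\<Sum>i\<le>n. ?b i * (?f x (Suc i) - ?f x i))
      = (\<Sum>i\<le>n. ?b i * (\<Sum>l<m. real (m choose l) * (x + real i) ^ l))"
  proof (rule sum.cong[OF refl])
    fix i
    have "?f x (Suc i) = ((x + real i) + 1) ^ m" by (simp add: algebra_simps)
    also have "\<dots> = (\<Sum>l\<le>m. real (m choose l) * (x + real i) ^ l)"
      by (subst binomial_ring) simp
    also have "\<dots> = (\<Sum>l<m. real (m choose l) * (x + real i) ^ l) + ?f x i"
      by (simp add: lessThan_Suc_atMost[symmetric])
    finally show "?b i * (?f x (Suc i) - ?f x i)
      = ?b i * (\<Sum>l<m. real (m choose l) * (x + real i) ^ l)"
      by simp
  qed
  also have "\<dots> = (\<Sum>l<m. real (m choose l) *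
       (\<Sum>i\<le>n. ?b i * (x + real i) ^ l))"
    by (subst sum_distrib_left, subst sum.swap) (simp add: sum_distrib_left mult_ac)
  also have "\<dots> = 0"
    using Suc.IH Suc.prems by (intro sum.neutral) auto
  finally show ?case by simp
qed

text \<open>Row 2 D of Pascal's triangle, with the sign chosen so that the central weight is
  positive. A polynomial of degree below D in \<open>node D i\<close> has degree below 2 D in i, so
  these weights annihilate it.\<close>

definition leaf_weight :: "nat \<Rightarrow> nat \<Rightarrow> real" where
  "leaf_weight D i = (-1) ^ (i + D) * real ((2 * D) choose i)"

definition node :: "nat \<Rightarrow> nat \<Rightarrow> real" where
  "node D i = ((real i - real D) / real D)\<^sup>2"

lemma leaf_weight_orthogonal:
  assumes "d < D"
  shows "(\<Sum>i\<le>2 * D. leaf_weight D i * node D i ^ d) = 0"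
proof -
  have "(\<Sum>i\<le>2 * D. leaf_weight D i * node D i ^ d)
     = (-1) ^ D / real D ^ (2 * d) *
       (\<Sum>i\<le>2 * D. (-1) ^ i * real ((2 * D) choose i) * (- real D + real i) ^ (2 * d))"
    by (simp add: leaf_weight_def node_def sum_distrib_left power_divide power_mult[symmetric]
        power_add mult_ac)
  also have "\<dots> = 0" using alternating_binomial_power_sum[of "2 * d" "2 * D" "- real D"] assms by simp
  finally show ?thesis .
qed

lemma sum_abs_leaf_weight: "(\<Sum>i\<le>2 * D. \<bar>leaf_weight D i\<bar>) = 4 ^ D"
proof -
  have "(\<Sum>i\<le>2 * D. \<bar>leaf_weight D i\<bar>) = (\<Sum>i\<le>2 * D. real ((2 * D) choose i))"
    by (simp add: leaf_weight_def abs_mult)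
  also have "\<dots> = real (\<Sum>i\<le>2 * D. (2 * D) choose i)" by simp
  also have "\<dots> = 4 ^ D" by (subst choose_row_sum) (simp add: power_mult)
  finally show ?thesis .
qed

lemma sum_inverse_squares_le: "(\<Sum>i=1..n. 1 / (real i)\<^sup>2) \<le> 2"
proof -
  have *: "(\<Sum>i=1..Suc n. 1 / (real i)\<^sup>2) \<le> 2 - 1 / real (Suc n)" for n
  proof (induction n)
    case (Suc n)
    have "1 / (real (Suc (Suc n)))\<^sup>2 \<le> 1 / (real (Suc n) * real (Suc (Suc n)))"
      by (intro divide_left_mono) (auto simp: power2_eq_square)
    also have "\<dots> = 1 / real (Suc n) - 1 / real (Suc (Suc n))"
      by (simp add: field_simps)
    finally have "1 / (real (Suc (Suc n)))\<^sup>2 \<le> 1 / real (Suc n) - 1 / real (Suc (Suc n))" .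
    moreover have "(\<Sum>i=1..Suc (Suc n). 1 / (real i)\<^sup>2)
        = (\<Sum>i=1..Suc n. 1 / (real i)\<^sup>2) + 1 / (real (Suc (Suc n)))\<^sup>2"
      by simp
    ultimately show ?case using Suc.IH by linarith
  qed simp
  show ?thesis
  proof (cases n)
    case (Suc k)
    have "0 \<le> 1 / real (Suc k)" by simp
    then show ?thesis using *[of k] unfolding Suc by linarith
  qed simp
qed

section \<open>Kernels of small norm\<close>

text \<open>The operator norm of the matrix \<open>k\<close> between Euclidean spaces. It bounds the
  sum over every rectangle, as discrepancy does, but unlike discrepancy it is multiplicative on
  tensor products.\<close>

definition kernel_bound :: "'x set \<Rightarrow> 'y set \<Rightarrow> ('x \<Rightarrow> 'y \<Rightarrow> real) \<Rightarrow> real \<Rightarrow> bool" where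
  "kernel_bound X Y k \<nu> \<longleftrightarrow> \<nu> \<ge> 0 \<and>
     (\<forall>g. (\<Sum>x\<in>X. (\<Sum>y\<in>Y. k x y * g y)\<^sup>2) \<le> \<nu>\<^sup>2 * (\<Sum>y\<in>Y. (g y)\<^sup>2))"

lemma kernel_boundD:
  assumes "kernel_bound X Y k \<nu>"
  shows "\<nu> \<ge> 0" "(\<Sum>x\<in>X. (\<Sum>y\<in>Y. k x y * g y)\<^sup>2) \<le> \<nu>\<^sup>2 * (\<Sum>y\<in>Y. (g y)\<^sup>2)"
  using assms unfolding kernel_bound_def by auto

lemma kernel_bound_L2:
  "kernel_bound X Y k \<nu> \<longleftrightarrow> \<nu> \<ge> 0 \<and>
     (\<forall>g. L2_set (\<lambda>x. \<Sum>y\<in>Y. k x y * g y) X \<le> \<nu> * L2_set g Y)"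
proof -
  have "((\<Sum>x\<in>X. (\<Sum>y\<in>Y. k x y * g y)\<^sup>2) \<le> \<nu>\<^sup>2 * (\<Sum>y\<in>Y. (g y)\<^sup>2))
      \<longleftrightarrow> L2_set (\<lambda>x. \<Sum>y\<in>Y. k x y * g y) X \<le> \<nu> * L2_set g Y" if "\<nu> \<ge> 0" for g
  proof -
    have "\<nu> * L2_set g Y = sqrt (\<nu>\<^sup>2 * (\<Sum>y\<in>Y. (g y)\<^sup>2))"
      using that by (simp add: L2_set_def real_sqrt_mult)
    then show ?thesis unfolding L2_set_def by simp
  qed
  then show ?thesis unfolding kernel_bound_def by auto
qed

lemma kernel_bound_add:
  assumes "kernel_bound X Y k \<nu>" "kernel_bound X Y k' \<nu>'"
  shows "kernel_bound X Y (\<lambda>x y. k x y + k' x y) (\<nu> + \<nu>')"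
  unfolding kernel_bound_L2
proof (intro conjI allI)
  show "0 \<le> \<nu> + \<nu>'" using assms unfolding kernel_bound_L2 by auto
  fix g
  have "L2_set (\<lambda>x. \<Sum>y\<in>Y. (k x y + k' x y) * g y) X
      = L2_set (\<lambda>x. (\<Sum>y\<in>Y. k x y * g y) + (\<Sum>y\<in>Y. k' x y * g y)) X"
    by (simp add: algebra_simps sum.distrib)
  also have "\<dots> \<le> L2_set (\<lambda>x. \<Sum>y\<in>Y. k x y * g y) X + L2_set (\<lambda>x. \<Sum>y\<in>Y. k' x y * g y) X"
    by (rule L2_set_triangle_ineq)
  also have "\<dots> \<le> \<nu> * L2_set g Y + \<nu>' * L2_set g Y"
    using assms unfolding kernel_bound_L2 by (intro add_mono) auto
  finally show "L2_set (\<lambda>x. \<Sum>y\<in>Y. (k x y + k' x y) * g y) X \<le> (\<nu> + \<nu>') * L2_set g Y"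
    by (simp add: algebra_simps)
qed

lemma kernel_bound_scale:
  assumes "kernel_bound X Y k \<nu>"
  shows "kernel_bound X Y (\<lambda>x y. a * k x y) (\<bar>a\<bar> * \<nu>)"
proof -
  have "(\<Sum>x\<in>X. (\<Sum>y\<in>Y. a * k x y * g y)\<^sup>2) = a\<^sup>2 * (\<Sum>x\<in>X. (\<Sum>y\<in>Y. k x y * g y)\<^sup>2)" for g
    by (simp only: mult.assoc sum_distrib_left[symmetric] power_mult_distrib)
  then show ?thesis using assms unfolding kernel_bound_def
    by (auto simp: power_mult_distrib mult.assoc intro!: mult_left_mono)
qed

lemma kernel_bound_diff:
  assumes "kernel_bound X Y k \<nu>" "kernel_bound X Y k' \<nu>'"
  shows "kernel_bound X Y (\<lambda>x y. k x y - k' x y) (\<nu> + \<nu>')"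
  using kernel_bound_add[OF assms(1) kernel_bound_scale[OF assms(2), of "-1"]] by simp

lemma kernel_bound_const:
  assumes "finite X" "finite Y"
  shows "kernel_bound X Y (\<lambda>_ _. 1) (sqrt (real (card X) * real (card Y)))"
proof -
  have "(\<Sum>y\<in>Y. g y)\<^sup>2 \<le> card Y * (\<Sum>y\<in>Y. (g y)\<^sup>2)" for g :: "'b \<Rightarrow> real"
  proof -
    have "\<bar>\<Sum>y\<in>Y. g y\<bar> \<le> (\<Sum>y\<in>Y. \<bar>1\<bar> * \<bar>g y\<bar>)" by simp
    also have "\<dots> \<le> L2_set (\<lambda>_. 1) Y * L2_set g Y" by (rule L2_set_mult_ineq)
    finally have "\<bar>\<Sum>y\<in>Y. g y\<bar>\<^sup>2 \<le> (L2_set (\<lambda>_. 1) Y * L2_set g Y)\<^sup>2"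
      by (intro power_mono) auto
    also have "\<dots> = card Y * (\<Sum>y\<in>Y. (g y)\<^sup>2)"
      by (simp add: L2_set_def power_mult_distrib sum_nonneg)
    finally show ?thesis by simp
  qed
  then show ?thesis unfolding kernel_bound_def
    by (auto simp: real_sqrt_mult power_mult_distrib mult.assoc intro!: mult_left_mono)
qed

lemma sum_PiE_insert:
  assumes "i \<notin> I"
  shows "(\<Sum>x\<in>Pi\<^sub>E (insert i I) A. F x) = (\<Sum>u\<in>Pi\<^sub>E I A. \<Sum>a\<in>A i. F (u(i := a)))"
proof -
  have "(\<Sum>x\<in>Pi\<^sub>E (insert i I) A. F x) = (\<Sum>(a, u)\<in>A i \<times> Pi\<^sub>E I A. F (u(i := a)))"
    unfolding PiE_insert_eq
    by (subst sum.reindex[OF inj_combinator[OF assms]]) (simp add: case_prod_unfold comp_def)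
  then show ?thesis by (simp add: sum.cartesian_product[symmetric] sum.swap[of _ "A i"])
qed

text \<open>Split off one coordinate: for every fixed value \<open>a\<close> of it, apply the bound
  for the remaining coordinates to the vector \<open>?h a\<close>, and then the bound for
  \<open>k i\<close> to the sum over \<open>a\<close>.\<close>

lemma kernel_bound_prod:
  assumes "finite I" "\<And>i. i \<in> I \<Longrightarrow> kernel_bound (A i) (B i) (k i) (\<nu> i)"
  shows "kernel_bound (Pi\<^sub>E I A) (Pi\<^sub>E I B) (\<lambda>x y. \<Prod>i\<in>I. k i (x i) (y i)) (\<Prod>i\<in>I. \<nu> i)"
  using assms
proof (induction I)
  case empty
  then show ?case by (simp add: kernel_bound_def)
next
  case (insert i I)
  have IH: "kernel_bound (Pi\<^sub>E I A) (Pi\<^sub>E I B) (\<lambda>x y. \<Prod>i\<in>I. k i (x i) (y i)) (\<Prod>i\<in>I. \<nu> i)"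
    using insert by auto
  have ki: "kernel_bound (A i) (B i) (k i) (\<nu> i)" using insert by auto
  let ?K = "\<lambda>x y. \<Prod>i\<in>I. k i (x i) (y i)"
  have K_upd: "(\<Prod>j\<in>insert i I. k j ((x(i := a)) j) ((y(i := b)) j)) = k i a b * ?K x y" for x y a b
  proof -
    have "(\<Prod>j\<in>I. k j ((x(i := a)) j) ((y(i := b)) j)) = ?K x y"
      using insert.hyps by (intro prod.cong) auto
    then show ?thesis using insert.hyps by simp
  qed
  have nu: "0 \<le> \<nu> i" "0 \<le> (\<Prod>i\<in>I. \<nu> i)" using IH ki by (auto simp: kernel_bound_def)
  show ?case unfolding kernel_bound_def
  proof (intro conjI allI)
    show "0 \<le> prod \<nu> (insert i I)" using nu insert.hyps by simp
    fix g :: "('a \<Rightarrow> 'c) \<Rightarrow> real"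
    let ?h = "\<lambda>a v. \<Sum>b\<in>B i. k i a b * g (v(i := b))"
    have "(\<Sum>x\<in>Pi\<^sub>E (insert i I) A.
             (\<Sum>y\<in>Pi\<^sub>E (insert i I) B. (\<Prod>i\<in>insert i I. k i (x i) (y i)) * g y)\<^sup>2)
        = (\<Sum>u\<in>Pi\<^sub>E I A. \<Sum>a\<in>A i. (\<Sum>v\<in>Pi\<^sub>E I B. ?K u v * ?h a v)\<^sup>2)"
      using insert.hyps
      by (simp add: sum_PiE_insert K_upd sum_distrib_left mult_ac del: fun_upd_apply prod.insert)
    also have "\<dots> = (\<Sum>a\<in>A i. \<Sum>u\<in>Pi\<^sub>E I A. (\<Sum>v\<in>Pi\<^sub>E I B. ?K u v * ?h a v)\<^sup>2)"
      by (rule sum.swap)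
    also have "\<dots> \<le> (\<Sum>a\<in>A i. (\<Prod>i\<in>I. \<nu> i)\<^sup>2 * (\<Sum>v\<in>Pi\<^sub>E I B. (?h a v)\<^sup>2))"
      by (intro sum_mono kernel_boundD(2)[OF IH])
    also have "\<dots> = (\<Prod>i\<in>I. \<nu> i)\<^sup>2 * (\<Sum>v\<in>Pi\<^sub>E I B. \<Sum>a\<in>A i. (?h a v)\<^sup>2)"
      by (subst sum.swap) (simp add: sum_distrib_left)
    also have "\<dots> \<le> (\<Prod>i\<in>I. \<nu> i)\<^sup>2 * (\<Sum>v\<in>Pi\<^sub>E I B. (\<nu> i)\<^sup>2 * (\<Sum>b\<in>B i. (g (v(i := b)))\<^sup>2))"
      by (intro mult_left_mono sum_mono kernel_boundD(2)[OF ki]) auto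
    also have "\<dots> = (prod \<nu> (insert i I))\<^sup>2 * (\<Sum>y\<in>Pi\<^sub>E (insert i I) B. (g y)\<^sup>2)"
      using insert.hyps by (simp add: sum_PiE_insert sum_distrib_left power_mult_distrib mult_ac del: fun_upd_apply)
    finally show "(\<Sum>x\<in>Pi\<^sub>E (insert i I) A.
             (\<Sum>y\<in>Pi\<^sub>E (insert i I) B. (\<Prod>i\<in>insert i I. k i (x i) (y i)) * g y)\<^sup>2)
        \<le> (prod \<nu> (insert i I))\<^sup>2 * (\<Sum>y\<in>Pi\<^sub>E (insert i I) B. (g y)\<^sup>2)" .
  qed
qed

text \<open>Cauchy-Schwarz against the indicator vectors of the rows and of the columns.\<close>

lemma kernel_bound_rectangle:
  assumes k: "kernel_bound X Y k \<nu>" and fin: "finite X" "finite Y" and sub: "A \<subseteq> X" "B \<subseteq> Y"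
  shows "\<bar>\<Sum>x\<in>A. \<Sum>y\<in>B. k x y\<bar> \<le> \<nu> * sqrt (real (card X) * real (card Y))"
proof -
  let ?g = "\<lambda>y. of_bool (y \<in> B) :: real"
  let ?u = "\<lambda>x. \<Sum>y\<in>Y. k x y * ?g y"
  have u: "?u x = (\<Sum>y\<in>B. k x y)" for x
  proof -
    have "?u x = (\<Sum>y\<in>Y \<inter> B. k x y)" by (subst sum.inter_restrict[OF fin(2)]) (auto intro!: sum.cong)
    moreover have "Y \<inter> B = B" using sub by auto
    ultimately show ?thesis by simp
  qed
  have g: "L2_set ?g Y \<le> sqrt (card Y)"
  proof -
    have "(\<Sum>y\<in>Y. (?g y)\<^sup>2) \<le> (\<Sum>y\<in>Y. 1)" by (intro sum_mono) auto
    then show ?thesis by (simp add: L2_set_def)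
  qed
  have "\<bar>\<Sum>x\<in>A. ?u x\<bar> \<le> (\<Sum>x\<in>A. \<bar>1\<bar> * \<bar>?u x\<bar>)" by simp
  also have "\<dots> \<le> (\<Sum>x\<in>X. \<bar>1\<bar> * \<bar>?u x\<bar>)" by (intro sum_mono2 fin sub) auto
  also have "\<dots> \<le> L2_set (\<lambda>_. 1) X * L2_set ?u X" by (rule L2_set_mult_ineq)
  also have "\<dots> \<le> sqrt (card X) * (\<nu> * sqrt (card Y))"
  proof (intro mult_mono)
    show "L2_set ?u X \<le> \<nu> * sqrt (card Y)"
      using k g unfolding kernel_bound_L2
      by (meson mult_left_mono order_trans)
  qed (auto simp: L2_set_def intro!: sum_nonneg)
  finally show ?thesis by (simp add: u real_sqrt_mult mult_ac)
qed

section \<open>Protocols summed against a kernel\<close>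

lemma max_cost:
  assumes "0 \<le> \<beta>"
  shows "2 ^ a * \<beta> + 2 ^ b * \<beta> \<le> 2 ^ Suc (max a b) * (\<beta> :: real)"
proof -
  have "2 ^ a * \<beta> + 2 ^ b * \<beta> \<le> 2 ^ max a b * \<beta> + 2 ^ max a b * \<beta>"
    using assms by (intro add_mono mult_right_mono power_increasing) auto
  then show ?thesis by (simp add: mult_ac)
qed

text \<open>The leaves of a protocol partition the inputs into at most \<open>2 ^ cost P\<close>
  rectangles, and \<open>\<phi>\<close> selects those that count.\<close>

lemma run_sum_bound:
  fixes K :: "'x \<Rightarrow> 'y \<Rightarrow> real"
  assumes "finite A" "finite B" "\<beta> \<ge> 0"
    and "\<And>A' B'. A' \<subseteq> A \<Longrightarrow> B' \<subseteq> B \<Longrightarrow> \<bar>\<Sum>x\<in>A'. \<Sum>y\<in>B'. K x y\<bar> \<le> \<beta>"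
  shows "\<bar>\<Sum>x\<in>A. \<Sum>y\<in>B. K x y * of_bool (\<phi> (run P (fa x) (fb y)))\<bar> \<le> 2 ^ cost P * \<beta>"
  using assms
proof (induction P arbitrary: A B)
  case (Output z)
  show ?case using Output(4)[of A B] Output(3) by (cases "\<phi> z") auto
next
  case (Alice q P Q)
  let ?S = "\<lambda>A P. \<Sum>x\<in>A. \<Sum>y\<in>B. K x y * of_bool (\<phi> (run P (fa x) (fb y)))"
  let ?A1 = "{x \<in> A. q (fa x)}" and ?A2 = "{x \<in> A. \<not> q (fa x)}"
  have "?S A (Alice q P Q) = ?S ?A1 (Alice q P Q) + ?S ?A2 (Alice q P Q)"
    by (subst sum.union_disjoint[symmetric]) (auto simp: Alice.prems(1) intro!: sum.cong)
  also have "\<dots> = ?S ?A1 P + ?S ?A2 Q" by (auto intro!: arg_cong2[where f = "(+)"] sum.cong)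
  finally have "\<bar>?S A (Alice q P Q)\<bar> \<le> \<bar>?S ?A1 P\<bar> + \<bar>?S ?A2 Q\<bar>" by linarith
  also have "\<dots> \<le> 2 ^ cost P * \<beta> + 2 ^ cost Q * \<beta>"
    using Alice.prems by (intro add_mono Alice.IH) auto
  also have "\<dots> \<le> 2 ^ cost (Alice q P Q) * \<beta>" using max_cost[OF Alice.prems(3)] by simp
  finally show ?case .
next
  case (Bob q P Q)
  let ?S = "\<lambda>B P. \<Sum>x\<in>A. \<Sum>y\<in>B. K x y * of_bool (\<phi> (run P (fa x) (fb y)))"
  let ?B1 = "{y \<in> B. q (fb y)}" and ?B2 = "{y \<in> B. \<not> q (fb y)}"
  have "?S B (Bob q P Q) = ?S ?B1 (Bob q P Q) + ?S ?B2 (Bob q P Q)"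
    unfolding sum.distrib[symmetric]
    by (intro sum.cong refl, subst sum.union_disjoint[symmetric])
       (auto simp: Bob.prems(2) intro!: sum.cong)
  also have "\<dots> = ?S ?B1 P + ?S ?B2 Q" by (auto intro!: arg_cong2[where f = "(+)"] sum.cong)
  finally have "\<bar>?S B (Bob q P Q)\<bar> \<le> \<bar>?S ?B1 P\<bar> + \<bar>?S ?B2 Q\<bar>" by linarith
  also have "\<dots> \<le> 2 ^ cost P * \<beta> + 2 ^ cost Q * \<beta>"
    using Bob.prems by (intro add_mono Bob.IH) auto
  also have "\<dots> \<le> 2 ^ cost (Bob q P Q) * \<beta>" using max_cost[OF Bob.prems(3)] by simp
  finally show ?case .
qed

section \<open>The hash gadget and cut lines\<close>

text \<open>For uniform \<open>x\<close> the values \<open>G x y\<close> behave like a pairwise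
  independent family indexed by \<open>y\<close>. Collisions are counted at one value
  \<open>z\<close> at a time because each density \<open>\<rho> z\<close> is analysed
  separately.\<close>

locale hash_gadget =
  fixes G :: "nat \<Rightarrow> nat \<Rightarrow> nat" and cX cY cZ :: nat
  assumes pos: "0 < cX" "0 < cY" "0 < cZ"
    and uniform: "\<And>y z. y < cY \<Longrightarrow> z < cZ \<Longrightarrow> cZ * card {x\<in>{..<cX}. G x y = z} = cX"
    and pairwise: "\<And>y y' z. y < cY \<Longrightarrow> y' < cY \<Longrightarrow> y \<noteq> y' \<Longrightarrow> z < cZ \<Longrightarrow>
          cZ * cZ * card {x\<in>{..<cX}. G x y = z \<and> G x y' = z} = cX"
begin

definition \<rho> :: "nat \<Rightarrow> nat \<Rightarrow> nat \<Rightarrow> real" where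
  "\<rho> z x y = real cZ * of_bool (G x y = z) / (real cX * real cY)"

text \<open>\<open>unit_norm\<close> is the operator norm of the uniform distribution on all pairs
  of shares. Relative to it, \<open>\<eta>\<close> bounds the norm of the deviation of
  \<open>\<rho> z\<close> from uniform.\<close>

definition \<eta> :: real where "\<eta> = sqrt (real cZ / real cY)"

definition unit_norm :: real where "unit_norm = 1 / sqrt (real cX * real cY)"

lemma \<rho>_nonneg: "\<rho> z x y \<ge> 0"
  by (simp add: \<rho>_def)

lemma \<eta>_nonneg: "\<eta> \<ge> 0"
  by (simp add: \<eta>_def)

lemma sum_uniform:
  assumes "y < cY" "z < cZ"
  shows "real cZ * (\<Sum>x<cX. of_bool (G x y = z)) = real cX"
proof -
  have "(\<Sum>x<cX. of_bool (G x y = z)) = real (card {x\<in>{..<cX}. G x y = z})"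
    by (simp add: Int_def)
  moreover have "real (cZ * card {x\<in>{..<cX}. G x y = z}) = real cX"
    using uniform[OF assms] by (rule arg_cong)
  ultimately show ?thesis by simp
qed

lemma sum_pairwise:
  assumes "y < cY" "y' < cY" "y \<noteq> y'" "z < cZ"
  shows "real cZ * real cZ * (\<Sum>x<cX. of_bool (G x y = z) * of_bool (G x y' = z)) = real cX"
proof -
  have "(\<Sum>x<cX. of_bool (G x y = z) * of_bool (G x y' = z))
      = real (card {x\<in>{..<cX}. G x y = z \<and> G x y' = z})"
  proof -
    have "(\<Sum>x<cX. of_bool (G x y = z) * of_bool (G x y' = z) :: real)
        = (\<Sum>x\<in>{x\<in>{..<cX}. G x y = z \<and> G x y' = z}. 1)"
      by (intro sum.mono_neutral_cong_right) auto
    then show ?thesis by simp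
  qed
  moreover have "real (cZ * cZ * card {x\<in>{..<cX}. G x y = z \<and> G x y' = z}) = real cX"
    using pairwise[OF assms] by (rule arg_cong)
  ultimately show ?thesis by (simp only: of_nat_mult)
qed

lemma sum_\<rho>: "z < cZ \<Longrightarrow> (\<Sum>x<cX. \<Sum>y<cY. \<rho> z x y) = 1"
proof -
  assume z: "z < cZ"
  have "(\<Sum>x<cX. \<Sum>y<cY. \<rho> z x y) = (\<Sum>y<cY. real cZ * (\<Sum>x<cX. of_bool (G x y = z))) / (real cX * real cY)"
    unfolding \<rho>_def sum_divide_distrib[symmetric] sum_distrib_left by (subst sum.swap) simp
  also have "\<dots> = (\<Sum>y<cY. real cX) / (real cX * real cY)"
    using sum_uniform z by simp
  also have "\<dots> = 1" using pos by simp
  finally show ?thesis .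
qed

definition dev :: "nat \<Rightarrow> nat \<Rightarrow> nat \<Rightarrow> real" where
  "dev z x y = real cZ * of_bool (G x y = z) - 1"

lemma \<rho>_dev: "\<rho> z x y = unit_norm\<^sup>2 * (1 + dev z x y)"
  using pos by (simp add: \<rho>_def dev_def unit_norm_def power_divide)

text \<open>Pairwise independence makes distinct columns of \<open>dev z\<close> orthogonal. The
  Gram matrix is diagonal, so the operator norm is the common length of the columns.\<close>

lemma sum_dev_dev:
  assumes "y < cY" "y' < cY" "z < cZ"
  shows "(\<Sum>x<cX. dev z x y * dev z x y') = (if y = y' then real cX * (real cZ - 1) else 0)"
proof -
  let ?f = "\<lambda>y x. of_bool (G x y = z) :: real"
  have "(\<Sum>x<cX. dev z x y * dev z x y') =
     real cZ * real cZ * (\<Sum>x<cX. ?f y x * ?f y' x) - real cZ * (\<Sum>x<cX. ?f y x)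
      - real cZ * (\<Sum>x<cX. ?f y' x) + real cX"
  proof -
    have "dev z x y * dev z x y' = real cZ * real cZ * (?f y x * ?f y' x) - real cZ * ?f y x
        - real cZ * ?f y' x + 1" for x
      unfolding dev_def by (simp only: algebra_simps mult_1_left mult_1_right) 
    then show ?thesis
      by (simp only: sum.distrib sum_subtractf sum_distrib_left) simp
  qed
  also have "\<dots> = (if y = y' then real cX * (real cZ - 1) else 0)"
  proof (cases "y = y'")
    case True
    have "(\<Sum>x<cX. ?f y x * ?f y x) = (\<Sum>x<cX. ?f y x)" by (intro sum.cong) auto
    then have "real cZ * real cZ * (\<Sum>x<cX. ?f y x * ?f y x) = real cZ * real cX"
      using sum_uniform[OF assms(1,3)] by simp
    then show ?thesis using True sum_uniform[OF assms(1,3)] by (simp add: algebra_simps)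
  next
    case False
    then show ?thesis
      using sum_pairwise[OF assms(1,2) False assms(3)] sum_uniform assms by simp
  qed
  finally show ?thesis .
qed

lemma kernel_bound_dev:
  assumes "z < cZ"
  shows "kernel_bound {..<cX} {..<cY} (dev z) (sqrt (real cX * real cZ))"
  unfolding kernel_bound_def
proof (intro conjI allI)
  fix g :: "nat \<Rightarrow> real"
  have "(\<Sum>x<cX. (\<Sum>y<cY. dev z x y * g y)\<^sup>2)
      = (\<Sum>x<cX. \<Sum>y<cY. \<Sum>y'<cY. g y * g y' * (dev z x y * dev z x y'))"
    by (simp add: power2_eq_square sum_product mult_ac)
  also have "\<dots> = (\<Sum>y<cY. \<Sum>y'<cY. g y * g y' * (\<Sum>x<cX. dev z x y * dev z x y'))"
    unfolding sum_distrib_left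
    by (rule trans[OF sum.swap], rule sum.cong[OF refl], rule sum.swap)
  also have "\<dots> = (\<Sum>y<cY. \<Sum>y'<cY. if y = y' then g y * g y' * (real cX * (real cZ - 1)) else 0)"
    using sum_dev_dev[OF _ _ assms] by (intro sum.cong refl) auto
  also have "\<dots> = (\<Sum>y<cY. (g y)\<^sup>2 * (real cX * (real cZ - 1)))"
    by (simp add: power2_eq_square)
  also have "\<dots> = (real cX * (real cZ - 1)) * (\<Sum>y<cY. (g y)\<^sup>2)"
    by (simp add: sum_distrib_left mult_ac)
  also have "\<dots> \<le> (real cX * real cZ) * (\<Sum>y<cY. (g y)\<^sup>2)"
    by (intro mult_right_mono mult_left_mono sum_nonneg) auto
  finally show "(\<Sum>x<cX. (\<Sum>y<cY. dev z x y * g y)\<^sup>2)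
      \<le> (sqrt (real cX * real cZ))\<^sup>2 * (\<Sum>y<cY. (g y)\<^sup>2)" by simp
qed auto

lemma unit_norm_scaling:
  "unit_norm\<^sup>2 * sqrt (real cX * real cY) = unit_norm"
  "unit_norm\<^sup>2 * sqrt (real cX * real cZ) = unit_norm * \<eta>"
  using pos by (simp_all add: unit_norm_def \<eta>_def real_sqrt_mult real_sqrt_divide power2_eq_square)

lemma kernel_bound_\<rho>:
  assumes "z < cZ"
  shows "kernel_bound {..<cX} {..<cY} (\<rho> z) (unit_norm * (1 + \<eta>))"
proof -
  have "kernel_bound {..<cX} {..<cY} (\<lambda>x y. unit_norm\<^sup>2 * (1 + dev z x y))
     (\<bar>unit_norm\<^sup>2\<bar> * (sqrt (real (card {..<cX}) * real (card {..<cY})) + sqrt (real cX * real cZ)))"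
    by (intro kernel_bound_scale kernel_bound_add kernel_bound_const kernel_bound_dev assms) auto
  moreover have "\<bar>unit_norm\<^sup>2\<bar> * (sqrt (real (card {..<cX}) * real (card {..<cY})) + sqrt (real cX * real cZ))
      = unit_norm * (1 + \<eta>)"
    by (simp add: distrib_left unit_norm_scaling)
  ultimately show ?thesis by (simp only: \<rho>_dev[abs_def])
qed

lemma kernel_bound_\<rho>_diff:
  assumes "z < cZ" "z' < cZ"
  shows "kernel_bound {..<cX} {..<cY} (\<lambda>x y. \<rho> z x y - \<rho> z' x y) (unit_norm * (2 * \<eta>))"
proof -
  have "kernel_bound {..<cX} {..<cY} (\<lambda>x y. unit_norm\<^sup>2 * (dev z x y - dev z' x y))
     (\<bar>unit_norm\<^sup>2\<bar> * (sqrt (real cX * real cZ) + sqrt (real cX * real cZ)))"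
    by (intro kernel_bound_scale kernel_bound_diff kernel_bound_dev assms)
  moreover have "\<bar>unit_norm\<^sup>2\<bar> * (sqrt (real cX * real cZ) + sqrt (real cX * real cZ)) = unit_norm * (2 * \<eta>)"
    by (simp add: distrib_left unit_norm_scaling)
  moreover have "\<rho> z x y - \<rho> z' x y = unit_norm\<^sup>2 * (dev z x y - dev z' x y)" for x y
    by (simp add: \<rho>_dev algebra_simps)
  ultimately show ?thesis by (simp only:)
qed

end

text \<open>\<open>near i x\<close> stands for an output \<open>x\<close> close to the
  \<open>i\<close>-th left vertex. \<open>N\<close> is four times the bound on the sum of reciprocal
  nodes, so finding an uncut end with probability 2/3 outweighs all other nodes. The gadget has more
  than N values because a pointer is one of N vertices or null. The bound on \<open>\<eta>\<close>
  keeps the power \<open>(1 + 256 * \<eta>) ^ N\<close> below a constant.\<close>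

locale comm_instance = hash_gadget +
  fixes N D :: nat
    and P :: "('a, 'b, 'z) protocol"
    and fa :: "(nat \<Rightarrow> nat) \<Rightarrow> 'a" and fb :: "(nat \<Rightarrow> nat) \<Rightarrow> 'b"
    and near :: "nat \<Rightarrow> 'z \<Rightarrow> bool"
  assumes N: "N = 16 * D\<^sup>2" and D: "D \<ge> 2" and NZ: "N < cZ"
    and \<eta>_le: "\<eta> \<le> 1 / (256 * real N)"
    and near_unique: "\<And>i j x. near i x \<Longrightarrow> near j x \<Longrightarrow> i < N \<Longrightarrow> j < N \<Longrightarrow> i = j"
begin

text \<open>Position \<open>j < N\<close> carries the successor of the \<open>j\<close>-th left vertex and position \<open>N + l\<close> the
  predecessor of the \<open>l\<close>-th right vertex; \<open>0\<close> is the null pointer. The edges leaving \<open>J\<close> are cut.\<close>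

definition pointers :: "(nat \<Rightarrow> nat) \<Rightarrow> nat set \<Rightarrow> nat \<Rightarrow> nat" where
  "pointers \<sigma> J v =
     (let j = (if v < N then v else inv \<sigma> (v - N)) in
      if j \<in> J then 0 else Suc (if v < N then \<sigma> v else j))"

abbreviation "inputsA \<equiv> {..<2 * N} \<rightarrow>\<^sub>E {..<cX}"
abbreviation "inputsB \<equiv> {..<2 * N} \<rightarrow>\<^sub>E {..<cY}"

definition weight :: "(nat \<Rightarrow> nat) \<Rightarrow> nat set \<Rightarrow> (nat \<Rightarrow> nat) \<Rightarrow> (nat \<Rightarrow> nat) \<Rightarrow> real" where
  "weight \<sigma> J X Y = (\<Prod>v<2 * N. \<rho> (pointers \<sigma> J v) (X v) (Y v))"

definition hit :: "(nat \<Rightarrow> nat) \<Rightarrow> nat set \<Rightarrow> nat \<Rightarrow> real" where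
  "hit \<sigma> J i = (\<Sum>X\<in>inputsA. \<Sum>Y\<in>inputsB. weight \<sigma> J X Y * of_bool (near i (run P (fa X) (fb Y))))"

abbreviation "perms \<equiv> {\<sigma>. \<sigma> permutes {..<N}}"

text \<open>The probability of naming the original end when every other edge is cut independently
  with probability \<open>p\<close>. The edge that would close the line is always cut, so
  \<open>p = 0\<close> is the honest instance.\<close>

definition cut_hit :: "(nat \<Rightarrow> nat) \<Rightarrow> real \<Rightarrow> real" where
  "cut_hit \<sigma> p = (\<Sum>J\<in>Pow ({..<N} - {inv \<sigma> 0}).
      p ^ card J * (1 - p) ^ card ({..<N} - {inv \<sigma> 0} - J) * hit \<sigma> (insert (inv \<sigma> 0) J) (inv \<sigma> 0))"

lemma N_pos: "N > 0" "0 < real N"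
  using N D by auto

lemma finite_inputs: "finite inputsA" "finite inputsB"
  by (auto intro!: finite_PiE)

lemma inv_perm:
  assumes "\<sigma> \<in> perms" "l < N"
  shows "inv \<sigma> l < N" "\<sigma> (inv \<sigma> l) = l" "\<sigma> l < N" "inv \<sigma> (\<sigma> l) = l"
proof -
  have p: "\<sigma> permutes {..<N}" using assms by simp
  show "inv \<sigma> l < N" using permutes_in_image[OF permutes_inv[OF p], of l] assms by simp
  show "\<sigma> l < N" using permutes_in_image[OF p, of l] assms by simp
  show "\<sigma> (inv \<sigma> l) = l" "inv \<sigma> (\<sigma> l) = l" using permutes_inverses[OF p] by auto
qed

lemma pointers_less:
  assumes "\<sigma> \<in> perms" "v < 2 * N"
  shows "pointers \<sigma> J v < cZ"
proof -
  have "v < N \<Longrightarrow> \<sigma> v < N" "\<not> v < N \<Longrightarrow> inv \<sigma> (v - N) < N"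
    using inv_perm[OF assms(1)] assms(2) by (auto simp: less_diff_conv2)
  then show ?thesis using NZ N_pos(1) unfolding pointers_def Let_def by auto
qed

lemma weight_nonneg: "weight \<sigma> J X Y \<ge> 0"
  unfolding weight_def by (intro prod_nonneg) (auto simp: \<rho>_nonneg)

lemma hit_nonneg: "hit \<sigma> J i \<ge> 0"
  unfolding hit_def by (intro sum_nonneg mult_nonneg_nonneg weight_nonneg) auto

lemma sum_weight:
  assumes "\<sigma> \<in> perms"
  shows "(\<Sum>X\<in>inputsA. \<Sum>Y\<in>inputsB. weight \<sigma> J X Y) = 1"
proof -
  have "(\<Sum>X\<in>inputsA. \<Sum>Y\<in>inputsB. weight \<sigma> J X Y)
      = (\<Sum>X\<in>inputsA. \<Prod>v<2 * N. \<Sum>y<cY. \<rho> (pointers \<sigma> J v) (X v) y)"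
    unfolding weight_def by (subst prod_sum_PiE) auto
  also have "\<dots> = (\<Prod>v<2 * N. \<Sum>x<cX. \<Sum>y<cY. \<rho> (pointers \<sigma> J v) x y)"
    by (subst prod_sum_PiE) auto
  also have "\<dots> = 1" using sum_\<rho> pointers_less[OF assms] by simp
  finally show ?thesis .
qed

lemma sum_hit_le:
  assumes "\<sigma> \<in> perms" "J \<subseteq> {..<N}"
  shows "(\<Sum>i\<in>J. hit \<sigma> J i) \<le> 1"
proof -
  have fJ: "finite J" using assms(2) finite_subset by blast
  have one: "(\<Sum>i\<in>J. of_bool (near i x) :: real) \<le> 1" for x
  proof (cases "\<exists>i\<in>J. near i x")
    case True
    then obtain i where i: "i \<in> J" "near i x" by blast
    have "(\<Sum>i\<in>J. of_bool (near i x) :: real) = (\<Sum>j\<in>J. of_bool (j = i))"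
      using i near_unique assms(2) by (intro sum.cong refl) (auto simp: subset_iff)
    also have "\<dots> = (\<Sum>j\<in>J. if j = i then 1 else 0)" by (intro sum.cong) auto
    also have "\<dots> = 1" using i fJ by simp
    finally show ?thesis by simp
  qed auto
  have "(\<Sum>i\<in>J. hit \<sigma> J i) = (\<Sum>X\<in>inputsA. \<Sum>Y\<in>inputsB. weight \<sigma> J X Y *
      (\<Sum>i\<in>J. of_bool (near i (run P (fa X) (fb Y)))))"
    unfolding hit_def sum_distrib_left
    by (rule trans[OF sum.swap], rule sum.cong[OF refl], rule sum.swap)
  also have "\<dots> \<le> (\<Sum>X\<in>inputsA. \<Sum>Y\<in>inputsB. weight \<sigma> J X Y * 1)"
    by (intro sum_mono mult_left_mono one weight_nonneg)
  also have "\<dots> = 1" using sum_weight[OF assms(1)] by simp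
  finally show ?thesis .
qed

section \<open>Symmetry between the ends of a cut line\<close>

abbreviation swap :: "nat \<Rightarrow> nat \<Rightarrow> nat \<Rightarrow> nat" where
  "swap \<equiv> Transposition.transpose"

text \<open>Once the edges leaving \<open>J\<close> are cut, the instance does not show which element of \<open>J\<close> used to
  be the end of the line.\<close>

lemma pointers_transpose:
  assumes \<sigma>: "\<sigma> \<in> perms" and J: "i \<in> J" "j \<in> J" "J \<subseteq> {..<N}"
  shows "pointers (\<sigma> \<circ> swap i j) J = pointers \<sigma> J"
proof
  fix v
  let ?\<tau> = "swap i j"
  have p: "\<sigma> permutes {..<N}" using \<sigma> by simp
  have inv: "inv (\<sigma> \<circ> ?\<tau>) = ?\<tau> \<circ> inv \<sigma>"
    using p by (simp add: o_inv_distrib permutes_bij)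
  have \<tau>: "?\<tau> x \<in> J \<longleftrightarrow> x \<in> J" "x \<notin> J \<Longrightarrow> ?\<tau> x = x" for x
    using J by (auto simp: Transposition.transpose_def)
  show "pointers (\<sigma> \<circ> ?\<tau>) J v = pointers \<sigma> J v"
    unfolding pointers_def Let_def inv using \<tau> by auto
qed

lemma hit_transpose:
  assumes "\<sigma> \<in> perms" "i \<in> J" "j \<in> J" "J \<subseteq> {..<N}"
  shows "hit (\<sigma> \<circ> swap i j) J k = hit \<sigma> J k"
  unfolding hit_def weight_def pointers_transpose[OF assms] ..

abbreviation "ending i \<equiv> {\<sigma>\<in>perms. \<sigma> i = 0}"

lemma finite_perms: "finite perms"
  by (simp add: finite_permutations)

lemma bij_betw_ending:
  assumes "i < N" "j < N"
  shows "bij_betw (\<lambda>\<sigma>. \<sigma> \<circ> swap i j) (ending j) (ending i)"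
proof (intro bij_betwI[where g = "\<lambda>\<sigma>. \<sigma> \<circ> swap i j"] funcsetI)
  have t: "swap i j permutes {..<N}" using assms by (simp add: permutes_swap_id)
  fix \<sigma>
  show "\<sigma> \<in> ending j \<Longrightarrow> \<sigma> \<circ> swap i j \<in> ending i"
    using permutes_compose[OF t] by auto
  show "\<sigma> \<in> ending i \<Longrightarrow> \<sigma> \<circ> swap i j \<in> ending j"
    using permutes_compose[OF t] by auto
qed (auto simp: fun_eq_iff)

lemma card_ending: "i < N \<Longrightarrow> card (ending i) = card (ending 0)"
  using bij_betw_same_card[OF bij_betw_ending[of i 0]] N_pos by simp

lemma inv_eq_iff: "\<sigma> \<in> perms \<Longrightarrow> inv \<sigma> 0 = i \<longleftrightarrow> \<sigma> i = 0"
  using permutes_inv_eq by fastforce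

lemma card_perms: "card perms = N * card (ending 0)"
proof -
  have "perms = (\<Union>i<N. ending i)"
    using inv_perm(1)[of _ 0] inv_eq_iff N_pos by fastforce
  then have "card perms = card (\<Union>i<N. ending i)" by (rule arg_cong)
  also have "card (\<Union>i<N. ending i) = (\<Sum>i<N. card (ending i))"
  proof (intro card_UN_disjoint ballI impI)
    fix i j :: nat
    assume ij: "i \<noteq> j"
    show "ending i \<inter> ending j = {}"
    proof (rule equals0I)
      fix \<sigma> assume "\<sigma> \<in> ending i \<inter> ending j"
      then have "\<sigma> \<in> perms" "\<sigma> i = 0" "\<sigma> j = 0" by simp_all
      then have "inv \<sigma> 0 = i" "inv \<sigma> 0 = j" by (simp_all only: inv_eq_iff)
      then show False using ij by simp
    qed
  qed (use finite_perms in simp_all)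
  also have "(\<Sum>i<N. card (ending i)) = (\<Sum>i<N. card (ending 0))"
    by (rule sum.cong[OF refl], rule card_ending) simp
  finally show ?thesis by simp
qed

text \<open>For fixed \<open>J\<close>, composition with a transposition carries the permutations
  ending at \<open>i\<close> to those ending at \<open>j\<close> without changing the instance. So
  all classes can be replaced by one, and there the events for different \<open>i\<close> are
  disjoint.\<close>

lemma sum_hit_ending:
  assumes J: "J \<subseteq> {..<N}" "J \<noteq> {}"
  shows "(\<Sum>i\<in>J. \<Sum>\<sigma>\<in>ending i. hit \<sigma> J i) \<le> real (card (ending 0))"
proof -
  obtain j where j: "j \<in> J" using J by blast
  have "(\<Sum>\<sigma>\<in>ending i. hit \<sigma> J i) = (\<Sum>\<sigma>\<in>ending j. hit \<sigma> J i)" if "i \<in> J" for i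
  proof -
    have "(\<Sum>\<sigma>\<in>ending i. hit \<sigma> J i) = (\<Sum>\<sigma>\<in>ending j. hit (\<sigma> \<circ> swap i j) J i)"
      using that j J by (intro sum.reindex_bij_betw[symmetric] bij_betw_ending) auto
    also have "\<dots> = (\<Sum>\<sigma>\<in>ending j. hit \<sigma> J i)"
      using that j J by (intro sum.cong refl hit_transpose) auto
    finally show ?thesis .
  qed
  then have "(\<Sum>i\<in>J. \<Sum>\<sigma>\<in>ending i. hit \<sigma> J i) = (\<Sum>i\<in>J. \<Sum>\<sigma>\<in>ending j. hit \<sigma> J i)" by simp
  also have "\<dots> = (\<Sum>\<sigma>\<in>ending j. \<Sum>i\<in>J. hit \<sigma> J i)" by (rule sum.swap)
  also have "\<dots> \<le> (\<Sum>\<sigma>\<in>ending j. 1)" using J by (intro sum_mono sum_hit_le) auto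
  also have "\<dots> = real (card (ending 0))" using card_ending[of j] j J by auto
  finally show ?thesis .
qed

lemma cut_hit_nonneg: "0 \<le> p \<Longrightarrow> p \<le> 1 \<Longrightarrow> cut_hit \<sigma> p \<ge> 0"
  unfolding cut_hit_def by (intro sum_nonneg mult_nonneg_nonneg hit_nonneg) auto

lemma cut_hit_0: "cut_hit \<sigma> 0 = hit \<sigma> {inv \<sigma> 0} (inv \<sigma> 0)"
proof -
  have "cut_hit \<sigma> 0 = (\<Sum>J\<in>Pow ({..<N} - {inv \<sigma> 0}). if J = {} then hit \<sigma> {inv \<sigma> 0} (inv \<sigma> 0) else 0)"
    unfolding cut_hit_def
  proof (intro sum.cong refl)
    fix J assume "J \<in> Pow ({..<N} - {inv \<sigma> 0})"
    then have "finite J" using finite_subset by blast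
    then show "0 ^ card J * (1 - 0) ^ card ({..<N} - {inv \<sigma> 0} - J) * hit \<sigma> (insert (inv \<sigma> 0) J) (inv \<sigma> 0)
       = (if J = {} then hit \<sigma> {inv \<sigma> 0} (inv \<sigma> 0) else 0)"
      by (cases "J = {}") auto
  qed
  also have "\<dots> = hit \<sigma> {inv \<sigma> 0} (inv \<sigma> 0)" by simp
  finally show ?thesis .
qed

text \<open>Multiplying by \<open>p\<close> lets the end itself be cut with probability
  \<open>p\<close> too, so \<open>J\<close> becomes a random subset of all left vertices and can be
  fixed before \<open>\<sigma>\<close>. Since there are \<open>N\<close> times as many permutations
  as elements of \<open>ending 0\<close>, the average over \<open>\<sigma>\<close> is at most
  \<open>1 / (N * p)\<close>.\<close>

lemma sum_cut_hit_le:
  assumes p: "0 < p" "p \<le> 1"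
  shows "(\<Sum>\<sigma>\<in>perms. cut_hit \<sigma> p) \<le> real (card (ending 0)) / p"
proof -
  let ?w = "\<lambda>J. p ^ card J * (1 - p) ^ card ({..<N} - J)"
  let ?E = "\<lambda>J i. {\<sigma>\<in>{\<sigma>\<in>perms. inv \<sigma> 0 \<in> J}. inv \<sigma> 0 = i}"
  have cut: "p * cut_hit \<sigma> p = (\<Sum>J\<in>{J\<in>Pow {..<N}. inv \<sigma> 0 \<in> J}. ?w J * hit \<sigma> J (inv \<sigma> 0))"
    if \<sigma>: "\<sigma> \<in> perms" for \<sigma>
  proof -
    let ?t = "inv \<sigma> 0"
    have t: "?t < N" using inv_perm(1)[OF \<sigma>, of 0] N_pos by simp
    have "p * cut_hit \<sigma> p = (\<Sum>J\<in>Pow ({..<N} - {?t}). ?w (insert ?t J) * hit \<sigma> (insert ?t J) ?t)"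
      unfolding cut_hit_def sum_distrib_left
    proof (intro sum.cong refl)
      fix J assume "J \<in> Pow ({..<N} - {?t})"
      then have J: "finite J" "?t \<notin> J" "{..<N} - {?t} - J = {..<N} - insert ?t J"
        using finite_subset[of J "{..<N} - {?t}"] by auto
      show "p * (p ^ card J * (1 - p) ^ card ({..<N} - {?t} - J) * hit \<sigma> (insert ?t J) ?t)
          = ?w (insert ?t J) * hit \<sigma> (insert ?t J) ?t"
        unfolding J(3) card_insert_disjoint[OF J(1,2)] power_Suc by (simp only: mult_ac)
    qed
    also have "\<dots> = (\<Sum>J\<in>{J\<in>Pow {..<N}. ?t \<in> J}. ?w J * hit \<sigma> J ?t)"
      using t by (intro sum.reindex_bij_witness[where i = "\<lambda>J. J - {?t}" and j = "insert ?t"])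
        (auto simp: insert_absorb)
    finally show ?thesis .
  qed
  have "p * (\<Sum>\<sigma>\<in>perms. cut_hit \<sigma> p)
      = (\<Sum>\<sigma>\<in>perms. \<Sum>J\<in>{J\<in>Pow {..<N}. inv \<sigma> 0 \<in> J}. ?w J * hit \<sigma> J (inv \<sigma> 0))"
    unfolding sum_distrib_left by (rule sum.cong[OF refl], rule cut)
  also have "\<dots> = (\<Sum>J\<in>Pow {..<N}. \<Sum>\<sigma>\<in>{\<sigma>\<in>perms. inv \<sigma> 0 \<in> J}. ?w J * hit \<sigma> J (inv \<sigma> 0))"
    by (rule sum.swap_restrict) (use finite_perms in auto)
  also have "\<dots> \<le> (\<Sum>J\<in>Pow {..<N}. ?w J * real (card (ending 0)))"
  proof (rule sum_mono)
    fix J assume "J \<in> Pow {..<N}"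
    then have J: "J \<subseteq> {..<N}" and fJ: "finite J" using finite_subset by auto
    have "(\<Sum>\<sigma>\<in>{\<sigma>\<in>perms. inv \<sigma> 0 \<in> J}. ?w J * hit \<sigma> J (inv \<sigma> 0))
       = ?w J * (\<Sum>i\<in>J. \<Sum>\<sigma>\<in>?E J i. hit \<sigma> J (inv \<sigma> 0))"
      unfolding sum_distrib_left[symmetric]
      by (subst sum.group[OF _ fJ, where g = "\<lambda>\<sigma>. inv \<sigma> 0"]) (use finite_perms in auto)
    also have "(\<Sum>i\<in>J. \<Sum>\<sigma>\<in>?E J i. hit \<sigma> J (inv \<sigma> 0))
        = (\<Sum>i\<in>J. \<Sum>\<sigma>\<in>ending i. hit \<sigma> J i)"
    proof (rule sum.cong[OF refl])
      fix i assume i: "i \<in> J"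
      have "?E J i = ending i"
      proof (rule set_eqI)
        fix \<sigma>
        show "\<sigma> \<in> ?E J i \<longleftrightarrow> \<sigma> \<in> ending i"
        proof (cases "\<sigma> \<in> perms")
          case True
          then have "(inv \<sigma> 0 \<in> J \<and> inv \<sigma> 0 = i) = (\<sigma> i = 0)" using inv_eq_iff[OF True, of i] i by metis
          then show ?thesis using True by simp
        qed simp
      qed
      moreover have "inv \<sigma> 0 = i" if "\<sigma> \<in> ending i" for \<sigma>
        using that by (subst inv_eq_iff) simp_all
      ultimately show "(\<Sum>\<sigma>\<in>?E J i. hit \<sigma> J (inv \<sigma> 0))
        = (\<Sum>\<sigma>\<in>ending i. hit \<sigma> J i)" by (intro sum.cong) auto
    qed
    also have "?w J * \<dots> \<le> ?w J * real (card (ending 0))"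
    proof (cases "J = {}")
      case False
      then show ?thesis using p by (intro mult_left_mono sum_hit_ending J) auto
    qed (use p in auto)
    finally show "(\<Sum>\<sigma>\<in>{\<sigma>\<in>perms. inv \<sigma> 0 \<in> J}. ?w J * hit \<sigma> J (inv \<sigma> 0))
       \<le> ?w J * real (card (ending 0))" .
  qed
  also have "\<dots> = (\<Prod>j<N. p + (1 - p)) * real (card (ending 0))"
    unfolding sum_distrib_right[symmetric] by (subst prod_add) auto
  finally have "p * (\<Sum>\<sigma>\<in>perms. cut_hit \<sigma> p) \<le> real (card (ending 0))" by simp
  then show ?thesis using p by (simp add: field_simps)
qed

text \<open>Cutting an edge changes two pointers, with densities r0, s0 before and r1, s1 after. The
  mixture \<open>p * r1 * s1 + (1 - p) * r0 * s0\<close> equals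
  \<open>r0 * s0 + p * ((r1 - r0) * s1 + r0 * (s1 - s0))\<close>. The label \<open>b j\<close> in
  {0, 1, 2} selects one of these three products, so each nonzero label brings one power of
  \<open>p\<close> and exactly one difference of densities, whose norm is small.\<close>

definition mixed_kernel :: "(nat \<Rightarrow> nat) \<Rightarrow> (nat \<Rightarrow> nat) \<Rightarrow> nat \<Rightarrow> nat \<Rightarrow> nat \<Rightarrow> real" where
  "mixed_kernel \<sigma> b v x y =
     (let j = (if v < N then v else inv \<sigma> (v - N)); k = Suc (if v < N then \<sigma> v else j);
          c = (if v < N then 1 else 2) in
      if j \<noteq> inv \<sigma> 0 \<and> b j = c then \<rho> 0 x y - \<rho> k x y
      else \<rho> (if j = inv \<sigma> 0 then 0 else if b j = 0 \<or> v < N then k else 0) x y)"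

lemma prod_positions:
  assumes "\<sigma> \<in> perms"
  shows "(\<Prod>v<2 * N. f v) = (\<Prod>j<N. f j * f (N + \<sigma> j))"
proof -
  have p: "\<sigma> permutes {..<N}" using assms by simp
  have "{..<2 * N} = {..<N} \<union> (\<lambda>j. N + j) ` {..<N}"
    using ivl_disj_un_one(2)[of N "2 * N"] image_add_atLeastLessThan[of N 0 N]
    by (auto simp: lessThan_atLeast0 mult_2)
  then have "(\<Prod>v<2 * N. f v) = (\<Prod>v<N. f v) * (\<Prod>v\<in>(\<lambda>j. N + j) ` {..<N}. f v)"
    by (simp add: prod.union_disjoint[symmetric] disjoint_iff image_iff)
  also have "(\<Prod>v\<in>(\<lambda>j. N + j) ` {..<N}. f v) = (\<Prod>j<N. f (N + j))"
    by (subst prod.reindex) auto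
  also have "\<dots> = (\<Prod>j<N. f (N + \<sigma> j))"
    using prod.permute[OF p, of "\<lambda>j. f (N + j)"] by (simp add: comp_def)
  finally show ?thesis by (simp add: prod.distrib)
qed

abbreviation mixed_prod :: "(nat \<Rightarrow> nat) \<Rightarrow> (nat \<Rightarrow> nat) \<Rightarrow> (nat \<Rightarrow> nat) \<Rightarrow> (nat \<Rightarrow> nat) \<Rightarrow> real" where
  "mixed_prod \<sigma> b X Y \<equiv> \<Prod>v<2 * N. mixed_kernel \<sigma> b v (X v) (Y v)"

lemma cut_weight_expand:
  assumes \<sigma>: "\<sigma> \<in> perms"
  defines "U \<equiv> {..<N} - {inv \<sigma> 0}"
  shows "(\<Sum>J\<in>Pow U. p ^ card J * (1 - p) ^ card (U - J) * weight \<sigma> (insert (inv \<sigma> 0) J) X Y)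
     = (\<Sum>b\<in>U \<rightarrow>\<^sub>E {0,1,2}. p ^ card {j\<in>U. b j \<noteq> 0} * mixed_prod \<sigma> b X Y)"
proof -
  let ?t = "inv \<sigma> 0"
  let ?r0 = "\<lambda>j. \<rho> (Suc (\<sigma> j)) (X j) (Y j)" and ?s0 = "\<lambda>j. \<rho> (Suc j) (X (N + \<sigma> j)) (Y (N + \<sigma> j))"
  let ?r1 = "\<lambda>j. \<rho> 0 (X j) (Y j)" and ?s1 = "\<lambda>j. \<rho> 0 (X (N + \<sigma> j)) (Y (N + \<sigma> j))"
  let ?m = "\<lambda>b j. mixed_kernel \<sigma> b j (X j) (Y j) * mixed_kernel \<sigma> b (N + \<sigma> j) (X (N + \<sigma> j)) (Y (N + \<sigma> j))"
  let ?g = "\<lambda>J j. if j \<in> insert ?t J then ?r1 j * ?s1 j else ?r0 j * ?s0 j"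
  have t: "?t < N" using inv_perm(1)[OF \<sigma>, of 0] N_pos by simp
  have U: "finite U" "{..<N} = insert ?t U" "?t \<notin> U" using t by (auto simp: U_def)
  have inv\<sigma>: "inv \<sigma> (\<sigma> j) = j" for j using \<sigma> permutes_inverses(2) by fastforce
  have w: "weight \<sigma> (insert ?t J) X Y = (?r1 ?t * ?s1 ?t) *
      ((\<Prod>j\<in>J. ?r1 j * ?s1 j) * (\<Prod>j\<in>U - J. ?r0 j * ?s0 j))" if J: "J \<in> Pow U" for J
  proof -
    have fJ: "finite J" "J \<subseteq> U" using J U(1) finite_subset by auto
    have "weight \<sigma> (insert ?t J) X Y
       = (\<Prod>j<N. ?g J j)"
      unfolding weight_def prod_positions[OF \<sigma>]
      by (intro prod.cong refl) (auto simp: pointers_def Let_def inv\<sigma>)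
    also have "\<dots> = (?r1 ?t * ?s1 ?t) * (\<Prod>j\<in>U. ?g J j)"
      using U by simp
    also have "(\<Prod>j\<in>U. ?g J j) = (\<Prod>j\<in>U - J. ?g J j) * (\<Prod>j\<in>J. ?g J j)"
      by (rule prod.subset_diff[OF fJ(2) U(1)])
    also have "(\<Prod>j\<in>J. ?g J j) = (\<Prod>j\<in>J. ?r1 j * ?s1 j)"
      by (intro prod.cong) auto
    also have "(\<Prod>j\<in>U - J. ?g J j) = (\<Prod>j\<in>U - J. ?r0 j * ?s0 j)"
      using U(3) by (intro prod.cong) auto
    finally show ?thesis by (simp only: mult_ac)
  qed
  have "(\<Sum>J\<in>Pow U. p ^ card J * (1 - p) ^ card (U - J) * weight \<sigma> (insert ?t J) X Y)
     = (?r1 ?t * ?s1 ?t) * (\<Sum>J\<in>Pow U. (\<Prod>j\<in>J. p * (?r1 j * ?s1 j)) * (\<Prod>j\<in>U - J. (1 - p) * (?r0 j * ?s0 j)))"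
    unfolding sum_distrib_left
    by (intro sum.cong refl) (simp only: w prod.distrib prod_constant mult_ac)
  also have "\<dots> = (?r1 ?t * ?s1 ?t) * (\<Prod>j\<in>U. p * (?r1 j * ?s1 j) + (1 - p) * (?r0 j * ?s0 j))"
    by (subst prod_add[OF U(1)]) simp
  also have "(\<Prod>j\<in>U. p * (?r1 j * ?s1 j) + (1 - p) * (?r0 j * ?s0 j))
     = (\<Prod>j\<in>U. \<Sum>c\<in>{0,1,2}. (if c = 0 then 1 else p) *
          ?m (\<lambda>_. c) j)"
    by (intro prod.cong refl) (auto simp: U_def mixed_kernel_def inv\<sigma> algebra_simps)
  also have "\<dots> = (\<Sum>b\<in>U \<rightarrow>\<^sub>E {0,1,2}. \<Prod>j\<in>U. (if b j = 0 then 1 else p) *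
          ?m (\<lambda>_. b j) j)"
    by (rule prod_sum_PiE) (use U in auto)
  also have "(?r1 ?t * ?s1 ?t) * \<dots> = (\<Sum>b\<in>U \<rightarrow>\<^sub>E {0,1,2}. p ^ card {j\<in>U. b j \<noteq> 0} *
          mixed_prod \<sigma> b X Y)"
    unfolding sum_distrib_left
  proof (intro sum.cong refl)
    fix b
    have r: "?r1 ?t * ?s1 ?t = ?m b ?t"
      using t by (simp add: mixed_kernel_def inv\<sigma> Let_def)
    have m: "?m (\<lambda>_. b j) j = ?m b j" if "j \<in> U" for j
      using that by (simp add: U_def mixed_kernel_def inv\<sigma> Let_def)
    have "(\<Prod>j\<in>U. if b j = 0 then 1 else p) = p ^ card {j\<in>U. b j \<noteq> 0}"
      using U(1) by (simp add: prod.If_cases Int_def)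
    then have "(\<Prod>j\<in>U. (if b j = 0 then 1 else p) * ?m (\<lambda>_. b j) j)
       = (p ^ card {j\<in>U. b j \<noteq> 0} * (\<Prod>j\<in>U. ?m b j))"
      using m by (simp add: prod.distrib cong: prod.cong)
    then show "(?r1 ?t * ?s1 ?t) * (\<Prod>j\<in>U. (if b j = 0 then 1 else p) * ?m (\<lambda>_. b j) j)
       = p ^ card {j\<in>U. b j \<noteq> 0} * mixed_prod \<sigma> b X Y"
      unfolding prod_positions[OF \<sigma>] U(2) prod.insert[OF U(1,3)] r by (simp only: mult_ac)
  qed
  finally show ?thesis .
qed

lemma kernel_bound_mixed:
  assumes \<sigma>: "\<sigma> \<in> perms" and v: "v < 2 * N"
  shows "kernel_bound {..<cX} {..<cY} (mixed_kernel \<sigma> b v)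
    (unit_norm * (if (let j = (if v < N then v else inv \<sigma> (v - N)); c = (if v < N then 1 else 2)
         in j \<noteq> inv \<sigma> 0 \<and> b j = c) then 2 * \<eta> else 1 + \<eta>))"
proof -
  have "(if v < N then \<sigma> v else inv \<sigma> (v - N)) < N"
    using inv_perm[OF \<sigma>] v by (auto simp: less_diff_conv2)
  then have k: "Suc (if v < N then \<sigma> v else inv \<sigma> (v - N)) < cZ" "0 < cZ" using NZ by auto
  show ?thesis
    using k unfolding mixed_kernel_def[abs_def] Let_def by (auto intro!: kernel_bound_\<rho> kernel_bound_\<rho>_diff)
qed

text \<open>Norms multiply over the positions: every nonzero label contributes a factor
  \<open>2 * \<eta>\<close>, all other positions at most \<open>1 + \<eta>\<close>. The factors
  \<open>unit_norm\<close> cancel against the size of the rectangle.\<close>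

lemma mixed_sum_bound:
  assumes \<sigma>: "\<sigma> \<in> perms"
  defines "U \<equiv> {..<N} - {inv \<sigma> 0}"
  assumes b: "b \<in> U \<rightarrow>\<^sub>E {0,1,2}"
  shows "\<bar>\<Sum>X\<in>inputsA. \<Sum>Y\<in>inputsB. mixed_prod \<sigma> b X Y *
            of_bool (near i (run P (fa X) (fb Y)))\<bar>
     \<le> 2 ^ cost P * ((1 + \<eta>) ^ (2 * N) * (2 * \<eta>) ^ card {j\<in>U. b j \<noteq> 0})"
proof (rule run_sum_bound)
  let ?\<nu> = "\<lambda>v. if (let j = (if v < N then v else inv \<sigma> (v - N)); c = (if v < N then 1 else 2)
         in j \<noteq> inv \<sigma> 0 \<and> b j = c) then 2 * \<eta> else 1 + \<eta>"
  have inv\<sigma>: "inv \<sigma> (\<sigma> j) = j" for j using \<sigma> permutes_inverses(2) by fastforce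
  have \<nu>: "(\<Prod>v<2 * N. ?\<nu> v) \<le> (1 + \<eta>) ^ (2 * N) * (2 * \<eta>) ^ card {j\<in>U. b j \<noteq> 0}"
  proof -
    have "(\<Prod>v<2 * N. ?\<nu> v) = (\<Prod>j<N. ?\<nu> j * ?\<nu> (N + \<sigma> j))" by (rule prod_positions[OF \<sigma>])
    also have "\<dots> \<le> (\<Prod>j<N. (1 + \<eta>)\<^sup>2 * (if j \<in> U \<and> b j \<noteq> 0 then 2 * \<eta> else 1))"
    proof (intro prod_mono conjI)
      fix j assume j: "j \<in> {..<N}"
      show "0 \<le> ?\<nu> j * ?\<nu> (N + \<sigma> j)" using \<eta>_nonneg by simp
      show "?\<nu> j * ?\<nu> (N + \<sigma> j) \<le> (1 + \<eta>)\<^sup>2 * (if j \<in> U \<and> b j \<noteq> 0 then 2 * \<eta> else 1)"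
      proof (cases "j \<in> U \<and> b j \<noteq> 0")
        case True
        then have "b j \<in> {1, 2}" using PiE_mem[OF b, of j] by auto
        then have "?\<nu> j * ?\<nu> (N + \<sigma> j) = (1 + \<eta>) * (2 * \<eta>)"
          using True j by (auto simp: inv\<sigma> U_def)
        also have "\<dots> \<le> (1 + \<eta>)\<^sup>2 * (2 * \<eta>)"
          using \<eta>_nonneg by (intro mult_right_mono) (auto simp: power2_eq_square)
        finally show ?thesis using True by simp
      next
        case False
        then show ?thesis using j by (auto simp: inv\<sigma> U_def power2_eq_square)
      qed
    qed
    also have "\<dots> = (1 + \<eta>) ^ (2 * N) * (\<Prod>j<N. if j \<in> U \<and> b j \<noteq> 0 then 2 * \<eta> else 1)"
      by (simp add: prod.distrib power_mult)
    also have "(\<Prod>j<N. if j \<in> U \<and> b j \<noteq> 0 then 2 * \<eta> else 1) = (2 * \<eta>) ^ card {j\<in>U. b j \<noteq> 0}"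
    proof -
      have "{..<N} \<inter> {j. j \<in> U \<and> b j \<noteq> 0} = {j\<in>U. b j \<noteq> 0}" by (auto simp: U_def)
      then show ?thesis by (simp add: prod.If_cases)
    qed
    finally show ?thesis .
  qed
  have K: "kernel_bound inputsA inputsB (\<lambda>X Y. mixed_prod \<sigma> b X Y)
     (\<Prod>v<2 * N. unit_norm * ?\<nu> v)"
    by (rule kernel_bound_prod) (use kernel_bound_mixed[OF \<sigma>] in auto)
  fix A B assume sub: "A \<subseteq> inputsA" "B \<subseteq> inputsB"
  have "\<bar>\<Sum>X\<in>A. \<Sum>Y\<in>B. mixed_prod \<sigma> b X Y\<bar>
      \<le> (\<Prod>v<2 * N. unit_norm * ?\<nu> v) * sqrt (real (card inputsA) * real (card inputsB))"
    by (rule kernel_bound_rectangle[OF K finite_inputs sub])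
  also have "\<dots> = (\<Prod>v<2 * N. ?\<nu> v) * (unit_norm * sqrt (real cX * real cY)) ^ (2 * N)"
    by (simp add: card_PiE prod.distrib power_mult_distrib real_sqrt_mult real_sqrt_power mult_ac)
  also have "unit_norm * sqrt (real cX * real cY) = 1"
    using pos by (simp add: unit_norm_def)
  finally show "\<bar>\<Sum>X\<in>A. \<Sum>Y\<in>B. mixed_prod \<sigma> b X Y\<bar>
     \<le> (1 + \<eta>) ^ (2 * N) * (2 * \<eta>) ^ card {j\<in>U. b j \<noteq> 0}" using \<nu> by simp
qed (use \<eta>_nonneg finite_inputs in auto)

text \<open>Terms with fewer than \<open>D\<close> nonzero labels are annihilated by the weights.
  For \<open>d\<close> labels with \<open>d \<ge> D\<close> the weighted sum of powers is at most
  \<open>4 ^ D\<close>, which is relaxed to \<open>4 ^ D * 64 ^ (d - D)\<close>. The factor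
  \<open>64 ^ d\<close> merges with \<open>(2 * \<eta>) ^ d\<close>, so the sum over all labels is
  still a product, \<open>(1 + 256 * \<eta>) ^ card U\<close>, and the gain
  \<open>1 / 16 ^ D\<close> is left over.\<close>

lemma leaf_sum_bound:
  assumes \<sigma>: "\<sigma> \<in> perms"
  shows "\<bar>\<Sum>i\<le>2 * D. leaf_weight D i * cut_hit \<sigma> (node D i)\<bar> \<le> 9 * 2 ^ cost P / 16 ^ D"
proof -
  define U where "U = {..<N} - {inv \<sigma> 0}"
  have U: "finite U" "card U \<le> N" by (auto simp: U_def intro: order_trans[OF card_Diff1_le])
  define Q where "Q b = (\<Sum>X\<in>inputsA. \<Sum>Y\<in>inputsB. mixed_prod \<sigma> b X Y *
            of_bool (near (inv \<sigma> 0) (run P (fa X) (fb Y))))" for b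
  define d where "d b = card {j\<in>U. b j \<noteq> 0}" for b :: "nat \<Rightarrow> nat"
  let ?T = "\<lambda>b. (4 ^ D * 64 ^ d b / 64 ^ D) * (2 ^ cost P * ((1 + \<eta>) ^ (2 * N) * (2 * \<eta>) ^ d b))" and ?c = "(4 ^ D / 64 ^ D * 2 ^ cost P * (1 + \<eta>) ^ (2 * N))"
  let ?B = "U \<rightarrow>\<^sub>E {0,1,2::nat}"
  have cut: "cut_hit \<sigma> p = (\<Sum>b\<in>?B. p ^ d b * Q b)" for p
  proof -
    have "cut_hit \<sigma> p = (\<Sum>X\<in>inputsA. \<Sum>Y\<in>inputsB.
        (\<Sum>J\<in>Pow U. p ^ card J * (1 - p) ^ card (U - J) * weight \<sigma> (insert (inv \<sigma> 0) J) X Y)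
         * of_bool (near (inv \<sigma> 0) (run P (fa X) (fb Y))))"
      unfolding cut_hit_def hit_def U_def sum_distrib_left sum_distrib_right mult.assoc
      by (rule trans[OF sum.swap], rule sum.cong[OF refl], rule sum.swap)
    also have "\<dots> = (\<Sum>X\<in>inputsA. \<Sum>Y\<in>inputsB. \<Sum>b\<in>?B.
        p ^ d b * (mixed_prod \<sigma> b X Y
         * of_bool (near (inv \<sigma> 0) (run P (fa X) (fb Y)))))"
      unfolding U_def d_def cut_weight_expand[OF \<sigma>] unfolding sum_distrib_right mult.assoc ..
    also have "\<dots> = (\<Sum>b\<in>?B. p ^ d b * Q b)"
      unfolding Q_def sum_distrib_left
      by (rule sym, rule trans[OF sum.swap], rule sum.cong[OF refl], rule sum.swap)
    finally show ?thesis .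
  qed
  define z where "z b = (\<Sum>i\<le>2 * D. leaf_weight D i * node D i ^ d b)" for b
  have z: "\<bar>z b\<bar> \<le> 4 ^ D * 64 ^ d b / 64 ^ D" for b
  proof (cases "d b < D")
    case True
    then show ?thesis unfolding z_def using leaf_weight_orthogonal by simp
  next
    case False
    have node: "\<bar>node D i\<bar> \<le> 1" if "i \<le> 2 * D" for i
    proof -
      have "\<bar>(real i - real D) / real D\<bar> \<le> 1" using that D by (auto simp: field_simps)
      then show ?thesis by (simp add: node_def abs_square_le_1)
    qed
    have "\<bar>z b\<bar> \<le> (\<Sum>i\<le>2 * D. \<bar>leaf_weight D i * node D i ^ d b\<bar>)" unfolding z_def by (rule sum_abs)
    also have "\<dots> \<le> (\<Sum>i\<le>2 * D. \<bar>leaf_weight D i\<bar> * 1)"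
      unfolding abs_mult power_abs using node by (intro sum_mono mult_left_mono power_le_one) auto
    also have "\<dots> = 4 ^ D" using sum_abs_leaf_weight by simp
    also have "\<dots> \<le> 4 ^ D * 64 ^ d b / 64 ^ D"
      using False by (simp add: field_simps power_increasing)
    finally show ?thesis .
  qed
  have Q: "\<bar>Q b\<bar> \<le> 2 ^ cost P * ((1 + \<eta>) ^ (2 * N) * (2 * \<eta>) ^ d b)" if "b \<in> ?B" for b
    using mixed_sum_bound[OF \<sigma>] that unfolding Q_def d_def U_def by blast
  have "(\<Sum>i\<le>2 * D. leaf_weight D i * cut_hit \<sigma> (node D i)) = (\<Sum>b\<in>?B. z b * Q b)"
    unfolding cut z_def sum_distrib_left sum_distrib_right mult.assoc by (rule sum.swap)
  also have "\<bar>\<dots>\<bar> \<le> (\<Sum>b\<in>?B. \<bar>z b\<bar> * \<bar>Q b\<bar>)" unfolding abs_mult[symmetric] by (rule sum_abs)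
  also have "\<dots> \<le> (\<Sum>b\<in>?B. ?T b)"
    by (intro sum_mono mult_mono z Q) auto
  also have "\<dots> = (\<Sum>b\<in>?B. ?c * (128 * \<eta>) ^ d b)"
  proof (intro sum.cong refl)
    fix b
    have "(128 * \<eta>) ^ d b = 64 ^ d b * (2 * \<eta>) ^ d b"
      unfolding power_mult_distrib[symmetric] by simp
    then show "?T b
        = ?c * (128 * \<eta>) ^ d b"
      by (simp only: times_divide_eq_left times_divide_eq_right mult_ac)
  qed
  also have "\<dots> = ?c * (\<Sum>b\<in>?B. (128 * \<eta>) ^ d b)"
    by (rule sum_distrib_left[symmetric])
  also have "(\<Sum>b\<in>?B. (128 * \<eta>) ^ d b) = (\<Sum>b\<in>?B. \<Prod>j\<in>U. if b j = 0 then 1 else 128 * \<eta>)"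
    using U(1) by (simp add: d_def prod.If_cases Int_def)
  also have "\<dots> = (\<Prod>j\<in>U. \<Sum>c\<in>{0,1,2::nat}. if c = 0 then 1 else 128 * \<eta>)"
    by (rule prod_sum_PiE[symmetric]) (use U in auto)
  also have "\<dots> = (1 + 256 * \<eta>) ^ card U" by simp
  also have "4 ^ D / 64 ^ D = (1 / 16 ^ D :: real)"
    by (simp add: power_one_over flip: power_divide)
  also have "1 / 16 ^ D * 2 ^ cost P * (1 + \<eta>) ^ (2 * N) * (1 + 256 * \<eta>) ^ card U
      \<le> 1 / 16 ^ D * 2 ^ cost P * exp 1 * exp 1"
  proof (intro mult_mono)
    have e: "(1 + x) ^ k \<le> exp 1" if "0 \<le> x" "real k * x \<le> 1" for x :: real and k
    proof -
      have "(1 + x) ^ k \<le> exp x ^ k" using that by (intro power_mono) auto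
      also have "\<dots> = exp (real k * x)" by (simp add: exp_of_nat_mult)
      also have "\<dots> \<le> exp 1" using that by simp
      finally show ?thesis .
    qed
    have N\<eta>: "real N * (256 * \<eta>) \<le> 1" using \<eta>_le N_pos by (simp add: field_simps)
    show "(1 + \<eta>) ^ (2 * N) \<le> exp 1" using N\<eta> \<eta>_nonneg by (intro e) auto
    have "real (card U) * (256 * \<eta>) \<le> real N * (256 * \<eta>)"
      using U(2) \<eta>_nonneg by (intro mult_right_mono) auto
    then show "(1 + 256 * \<eta>) ^ card U \<le> exp 1" using N\<eta> \<eta>_nonneg by (intro e) auto
  qed (use \<eta>_nonneg in auto)
  also have "\<dots> = (2 ^ cost P / 16 ^ D) * (exp 1 * exp 1)" by simp
  also have "\<dots> \<le> (2 ^ cost P / 16 ^ D) * (3 * 3)"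
    using exp_le by (intro mult_left_mono mult_mono) auto
  finally show ?thesis by (simp add: mult.commute)
qed

section \<open>The contradiction for cheap protocols\<close>

lemma sum_node_le: "(\<Sum>i\<in>{..2 * D} - {D}. 1 / node D i) \<le> 4 * (real D)\<^sup>2"
proof -
  let ?I = "{..2 * D} - {D}"
  have split: "?I = (\<lambda>i. D - i) ` {1..D} \<union> (\<lambda>i. D + i) ` {1..D}"
  proof (intro set_eqI iffI)
    fix i assume "i \<in> ?I"
    then consider "i < D" | "D < i" "i \<le> 2 * D" by force
    then show "i \<in> (\<lambda>i. D - i) ` {1..D} \<union> (\<lambda>i. D + i) ` {1..D}"
    proof cases
      case 1
      then have "i = D - (D - i)" "D - i \<in> {1..D}" by auto
      then show ?thesis by blast
    next
      case 2
      then have "i = D + (i - D)" "i - D \<in> {1..D}" by auto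
      then show ?thesis by blast
    qed
  qed auto
  have "(\<Sum>i\<in>?I. 1 / node D i)
     = (\<Sum>i\<in>(\<lambda>i. D - i) ` {1..D}. 1 / node D i) + (\<Sum>i\<in>(\<lambda>i. D + i) ` {1..D}. 1 / node D i)"
    unfolding split by (rule sum.union_disjoint) auto
  also have "(\<Sum>i\<in>(\<lambda>i. D - i) ` {1..D}. 1 / node D i) = (\<Sum>i\<in>{1..D}. 1 / node D (D - i))"
    by (rule sum.reindex_cong[where l = "\<lambda>i. D - i"]) (auto simp: inj_on_def)
  also have "\<dots> = (\<Sum>i\<in>{1..D}. (real D)\<^sup>2 * (1 / (real i)\<^sup>2))"
    by (intro sum.cong refl) (auto simp: node_def of_nat_diff power_divide)
  also have "(\<Sum>i\<in>(\<lambda>i. D + i) ` {1..D}. 1 / node D i) = (\<Sum>i\<in>{1..D}. 1 / node D (D + i))"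
    by (rule sum.reindex_cong[where l = "\<lambda>i. D + i"]) (auto simp: inj_on_def)
  also have "\<dots> = (\<Sum>i\<in>{1..D}. (real D)\<^sup>2 * (1 / (real i)\<^sup>2))"
    by (intro sum.cong refl) (auto simp: node_def power_divide)
  also have "(\<Sum>i\<in>{1..D}. (real D)\<^sup>2 * (1 / (real i)\<^sup>2)) + (\<Sum>i\<in>{1..D}. (real D)\<^sup>2 * (1 / (real i)\<^sup>2))
     = 2 * (real D)\<^sup>2 * (\<Sum>i=1..D. 1 / (real i)\<^sup>2)"
    by (simp add: sum_distrib_left)
  also have "\<dots> \<le> 2 * (real D)\<^sup>2 * 2"
    by (intro mult_left_mono sum_inverse_squares_le) auto
  finally show ?thesis by simp
qed

text \<open>The weighted sum over the nodes nearly vanishes if the protocol is cheap. But the node 0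
  contributes at least \<open>32 / 3 * D^2 * q\<close> times the largest weight \<open>C\<close>,
  and all other nodes together at most \<open>4 * D^2 * q\<close> times \<open>C\<close> in absolute
  value.\<close>

theorem cost_ge:
  assumes "(\<Sum>\<sigma>\<in>perms. hit \<sigma> {inv \<sigma> 0} (inv \<sigma> 0)) \<ge> 2 / 3 * real (card perms)"
  shows "D \<le> cost P"
proof (rule ccontr)
  assume less: "\<not> D \<le> cost P"
  let ?I = "{..2 * D} - {D}"
  define q where "q = real (card (ending 0))"
  define C where "C = real ((2 * D) choose D)"
  define R where "R p = (\<Sum>\<sigma>\<in>perms. cut_hit \<sigma> p)" for p
  have "(id :: nat \<Rightarrow> nat) \<in> ending 0" by (auto simp: permutes_id)
  then have "ending 0 \<noteq> {}" by blast
  then have q: "q > 0" using finite_perms unfolding q_def by (simp add: card_gt_0_iff)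
  have C: "C \<ge> 1" unfolding C_def by (metis One_nat_def Suc_leI binomial_symmetric
      le_add1 mult_2 of_nat_1 of_nat_mono zero_less_binomial)
  have cp: "real (card perms) = 16 * (real D)\<^sup>2 * q" using card_perms N by (simp add: q_def)
  have R0: "R 0 \<ge> 2 / 3 * (16 * (real D)\<^sup>2 * q)"
    using assms unfolding R_def cut_hit_0 cp .
  have "C * (R 0 - 4 * (real D)\<^sup>2 * q) \<le> (\<Sum>i\<le>2 * D. leaf_weight D i * R (node D i))"
  proof -
    have "(\<Sum>i\<in>?I. leaf_weight D i * R (node D i))
        \<ge> (\<Sum>i\<in>?I. - (C * (q * (1 / node D i))))"
    proof (rule sum_mono)
      fix i assume i: "i \<in> ?I"
      have node: "0 < node D i" using i D by (auto simp: node_def)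
      have "\<bar>(real i - real D) / real D\<bar> \<le> 1" using i D by (auto simp: field_simps)
      then have node1: "node D i \<le> 1" by (simp add: node_def abs_square_le_1)
      have R: "0 \<le> R (node D i)" "R (node D i) \<le> q * (1 / node D i)"
        unfolding R_def q_def using node node1 sum_cut_hit_le[OF node node1]
        by (auto intro!: sum_nonneg cut_hit_nonneg)
      have "\<bar>leaf_weight D i\<bar> \<le> C"
        unfolding leaf_weight_def C_def using binomial_maximum[of "2 * D" i] by (simp add: abs_mult)
      then have "\<bar>leaf_weight D i * R (node D i)\<bar> \<le> C * (q * (1 / node D i))"
        unfolding abs_mult using R C by (intro mult_mono) auto
      then show "- (C * (q * (1 / node D i))) \<le> leaf_weight D i * R (node D i)" by linarith
    qed
    moreover have "(\<Sum>i\<in>?I. - (C * (q * (1 / node D i))))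
        = - (C * (q * (\<Sum>i\<in>?I. 1 / node D i)))"
      by (simp only: sum_negf sum_distrib_left)
    moreover have "C * (q * (\<Sum>i\<in>?I. 1 / node D i)) \<le> C * (q * (4 * (real D)\<^sup>2))"
      using q C by (intro mult_left_mono sum_node_le) auto
    moreover have "(\<Sum>i\<le>2 * D. leaf_weight D i * R (node D i))
        = leaf_weight D D * R (node D D) + (\<Sum>i\<in>?I. leaf_weight D i * R (node D i))"
      by (rule sum.remove) auto
    moreover have "leaf_weight D D * R (node D D) = C * R 0"
      by (simp add: leaf_weight_def C_def node_def)
    ultimately show ?thesis by (simp add: algebra_simps)
  qed
  also have "(\<Sum>i\<le>2 * D. leaf_weight D i * R (node D i))
     = (\<Sum>\<sigma>\<in>perms. \<Sum>i\<le>2 * D. leaf_weight D i * cut_hit \<sigma> (node D i))"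
    unfolding R_def sum_distrib_left by (rule sum.swap)
  also have "\<dots> \<le> (\<Sum>\<sigma>\<in>perms. 9 * 2 ^ cost P / 16 ^ D)"
    using leaf_sum_bound by (intro sum_mono) (meson abs_le_D1)
  also have "\<dots> = (16 * (real D)\<^sup>2 * q) * (9 * 2 ^ cost P / 16 ^ D)"
    by (simp add: cp)
  finally have "C * (R 0 - 4 * (real D)\<^sup>2 * q) \<le> (16 * (real D)\<^sup>2 * q) * (9 * 2 ^ cost P / 16 ^ D)" .
  moreover have "1 * ((real D)\<^sup>2 * q * (20 / 3)) \<le> C * (R 0 - 4 * (real D)\<^sup>2 * q)"
    using C R0 q by (intro mult_mono) (auto simp: mult_ac)
  moreover have "(16 * (real D)\<^sup>2 * q) * (9 * 2 ^ cost P / 16 ^ D)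
      = (real D)\<^sup>2 * q * (144 * (2 ^ cost P / 16 ^ D))" by simp
  moreover have "(real D)\<^sup>2 * q > 0" using D q by simp
  ultimately have "(real D)\<^sup>2 * q * (20 / 3) \<le> (real D)\<^sup>2 * q * (144 * (2 ^ cost P / 16 ^ D))"
    by linarith
  with \<open>(real D)\<^sup>2 * q > 0\<close> have "20 / 3 \<le> 144 * (2 ^ cost P / 16 ^ D :: real)"
    by (simp only: mult_le_cancel_left_pos)
  moreover have "2 ^ cost P / 16 ^ D \<le> (1 / 64 :: real)"
  proof -
    have "2 ^ cost P \<le> (2 ^ D :: real)" using less by (intro power_increasing) auto
    then have "2 ^ cost P / 16 ^ D \<le> (2 ^ D / 16 ^ D :: real)" by (intro divide_right_mono) auto
    also have "\<dots> = (1 / 8) ^ D" by (simp flip: power_divide)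
    also have "\<dots> \<le> (1 / 8) ^ 2" using D by (intro power_decreasing) auto
    finally show ?thesis by (simp add: power2_eq_square)
  qed
  ultimately show False by linarith
qed

end

section \<open>Toeplitz hashing\<close>

text \<open>Row \<open>i\<close> of a matrix over the field with two elements applied to
  \<open>y\<close>; its entry in column \<open>j\<close> is the bit \<open>i + j\<close> of
  \<open>a\<close>. The matrix is constant along antidiagonals, that is, Toeplitz after reversing
  the columns.\<close>

definition row_parity :: "nat set \<Rightarrow> nat set \<Rightarrow> nat \<Rightarrow> bool" where
  "row_parity a y i = odd (card {j\<in>y. i + j \<in> a})"

definition toeplitz_hash :: "nat \<Rightarrow> nat set \<Rightarrow> nat set \<Rightarrow> nat set \<Rightarrow> nat set" where
  "toeplitz_hash l a b y = {i. i < l \<and> (row_parity a y i \<noteq> (i \<in> b))}"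

definition toggle :: "'a \<Rightarrow> 'a set \<Rightarrow> 'a set" where
  "toggle t a = (if t \<in> a then a - {t} else insert t a)"

lemma mem_toggle: "x \<in> toggle t a \<longleftrightarrow> (if x = t then t \<notin> a else x \<in> a)"
  by (auto simp: toggle_def)

lemma toggle_toggle: "toggle t (toggle t a) = a"
  by (auto simp: toggle_def)

text \<open>Let \<open>m\<close> be the largest element of \<open>d\<close>. Toggling the bit
  \<open>k + m\<close> of \<open>a\<close> flips the parity of row \<open>k\<close> and leaves the
  rows \<open>i < k\<close> alone, since \<open>i + j < k + m\<close> for all \<open>j\<close> in
  \<open>d\<close>. So each further row halves the count.\<close>

lemma card_toeplitz_kernel:
  assumes d: "d \<subseteq> {..<w}" "d \<noteq> {}" and k: "k \<le> l"
  shows "card {a\<in>Pow {..<l + w}. \<forall>i<k. even (card {j\<in>d. i + j \<in> a})} * 2 ^ k = 2 ^ (l + w)"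
  using k
proof (induction k)
  case 0
  have "{a\<in>Pow {..<l + w}. \<forall>i<0. even (card {j\<in>d. i + j \<in> a})} = Pow {..<l + w}" by auto
  then show ?case by (simp only: card_Pow finite_lessThan card_lessThan) simp
next
  case (Suc k)
  let ?E = "\<lambda>a i. even (card {j\<in>d. i + j \<in> a})"
  let ?A = "{a\<in>Pow {..<l + w}. \<forall>i<k. ?E a i}"
  define m where "m = Max d"
  have fd: "finite d" using d finite_subset by blast
  have m: "m \<in> d" "\<And>j. j \<in> d \<Longrightarrow> j \<le> m" using fd d(2) by (auto simp: m_def)
  have mw: "m < w" using m(1) d(1) by auto
  let ?t = "toggle (k + m)"
  have row: "?E (?t a) i = ?E a i" if "i < k" for a i
  proof -
    have "{j\<in>d. i + j \<in> ?t a} = {j\<in>d. i + j \<in> a}"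
      using m(2) that by (fastforce simp: mem_toggle)
    then show ?thesis by simp
  qed
  have rowk: "?E (?t a) k \<longleftrightarrow> \<not> ?E a k" for a
  proof -
    have "{j\<in>d. k + j \<in> ?t a} = toggle m {j\<in>d. k + j \<in> a}"
      using m(1) by (auto simp: mem_toggle split: if_splits)
    moreover have "even (card (toggle m B)) \<longleftrightarrow> odd (card B)" if "finite B" for B :: "nat set"
      using that by (auto simp: toggle_def card_Diff_singleton_if card_gt_0_iff)
    ultimately show ?thesis using fd by simp
  qed
  have sub: "?t a \<subseteq> {..<l + w}" if "a \<subseteq> {..<l + w}" for a
    using that mw Suc.prems by (auto simp: toggle_def)
  have "bij_betw ?t {a\<in>?A. ?E a k} {a\<in>?A. \<not> ?E a k}"
    by (rule bij_betwI[where g = "?t"]) (use row rowk sub in \<open>auto simp: toggle_toggle\<close>)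
  then have "card {a\<in>?A. ?E a k} = card {a\<in>?A. \<not> ?E a k}" by (rule bij_betw_same_card)
  moreover have "card ?A = card {a\<in>?A. ?E a k} + card {a\<in>?A. \<not> ?E a k}"
    by (subst card_Un_disjoint[symmetric]) (auto intro!: arg_cong[where f = card])
  moreover have "{a\<in>?A. ?E a k} = {a\<in>Pow {..<l + w}. \<forall>i<Suc k. ?E a i}"
    by (auto simp: less_Suc_eq)
  ultimately have "card ?A = 2 * card {a\<in>Pow {..<l + w}. \<forall>i<Suc k. ?E a i}" by simp
  then show ?case using Suc by simp
qed

lemma odd_card_sym_diff:
  assumes "finite A" "finite B"
  shows "odd (card {j\<in>(A - B) \<union> (B - A). p j}) \<longleftrightarrow> (odd (card {j\<in>A. p j}) \<noteq> odd (card {j\<in>B. p j}))"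
proof -
  have "card {j\<in>A. p j} = card {j\<in>A - B. p j} + card {j\<in>A \<inter> B. p j}"
    "card {j\<in>B. p j} = card {j\<in>B - A. p j} + card {j\<in>A \<inter> B. p j}"
    "card {j\<in>(A - B) \<union> (B - A). p j} = card {j\<in>A - B. p j} + card {j\<in>B - A. p j}"
    by (subst card_Un_disjoint[symmetric]; use assms in \<open>auto intro!: arg_cong[where f = card]\<close>)+
  then show ?thesis by auto
qed

abbreviation seeds :: "nat \<Rightarrow> nat \<Rightarrow> (nat set \<times> nat set) set" where
  "seeds l w \<equiv> Pow {..<l + w} \<times> Pow {..<l}"

text \<open>The shift \<open>b\<close> is determined by \<open>a\<close> and the first hash value, so collisions are counted by the
  kernel of the Toeplitz matrix of \<open>a\<close> at the symmetric difference of the two arguments.\<close>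

lemma toeplitz_hash_subset: "toeplitz_hash l a b y \<subseteq> {..<l}"
  by (auto simp: toeplitz_hash_def)

lemma toeplitz_hash_eq_iff:
  assumes "b \<subseteq> {..<l}" "z \<subseteq> {..<l}"
  shows "toeplitz_hash l a b y = z \<longleftrightarrow> b = toeplitz_hash l a z y"
proof -
  have "(i \<in> toeplitz_hash l a b y \<longleftrightarrow> i \<in> z) \<longleftrightarrow> (i \<in> b \<longleftrightarrow> i \<in> toeplitz_hash l a z y)" for i
    using assms unfolding toeplitz_hash_def mem_Collect_eq by blast
  then show ?thesis unfolding set_eq_iff by simp
qed

lemma card_graph:
  assumes "\<And>a b. a \<in> A \<Longrightarrow> b \<in> B \<Longrightarrow> Q a b \<longleftrightarrow> b = f a \<and> P a" "\<And>a. a \<in> A \<Longrightarrow> f a \<in> B"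
  shows "card {(a, b)\<in>A \<times> B. Q a b} = card {a\<in>A. P a}"
proof -
  have "{(a, b)\<in>A \<times> B. Q a b} = (\<lambda>a. (a, f a)) ` {a\<in>A. P a}" using assms by auto
  then show ?thesis by (simp add: card_image inj_on_def)
qed

lemma card_toeplitz_uniform:
  assumes "z \<subseteq> {..<l}"
  shows "card {(a, b)\<in>seeds l w. toeplitz_hash l a b y = z} = 2 ^ (l + w)"
proof -
  have "card {(a, b)\<in>seeds l w. toeplitz_hash l a b y = z}
      = card {a\<in>Pow {..<l + w}. True}" (is "_ = card ?A")
    by (rule card_graph[where f = "\<lambda>a. toeplitz_hash l a z y"])
      (use toeplitz_hash_eq_iff assms in \<open>auto simp: toeplitz_hash_subset\<close>)
  also have "?A = Pow {..<l + w}" by auto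
  finally show ?thesis by (simp only: card_Pow finite_lessThan card_lessThan)
qed

lemma card_toeplitz_pairwise:
  assumes z: "z \<subseteq> {..<l}" and y: "y \<subseteq> {..<w}" "y' \<subseteq> {..<w}" "y \<noteq> y'"
  shows "card {(a, b)\<in>seeds l w. toeplitz_hash l a b y = z \<and> toeplitz_hash l a b y' = z} * 2 ^ l
     = 2 ^ (l + w)"
proof -
  let ?b = "\<lambda>a. toeplitz_hash l a z y"
  let ?d = "(y - y') \<union> (y' - y)"
  let ?K = "{a\<in>Pow {..<l + w}. \<forall>i<l. \<not> row_parity a ?d i}"
  have fin: "finite y" "finite y'" using y finite_subset by auto
  have K: "row_parity a ?d i \<longleftrightarrow> row_parity a y i \<noteq> row_parity a y' i" for a i
    unfolding row_parity_def by (rule odd_card_sym_diff[OF fin])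
  have "card {(a, b)\<in>seeds l w. toeplitz_hash l a b y = z \<and> toeplitz_hash l a b y' = z}
     = card ?K"
  proof (rule card_graph[where f = ?b])
    fix a b assume "a \<in> Pow {..<l + w}" "b \<in> Pow {..<l}"
    then have b: "b \<subseteq> {..<l}" by auto
    have "?b a = toeplitz_hash l a z y' \<longleftrightarrow> (\<forall>i<l. row_parity a y i = row_parity a y' i)"
      unfolding toeplitz_hash_def set_eq_iff mem_Collect_eq by (rule iffI; metis)
    also have "\<dots> \<longleftrightarrow> (\<forall>i<l. \<not> row_parity a ?d i)" using K by simp
    finally show "toeplitz_hash l a b y = z \<and> toeplitz_hash l a b y' = z
        \<longleftrightarrow> b = ?b a \<and> (\<forall>i<l. \<not> row_parity a ?d i)"
      unfolding toeplitz_hash_eq_iff[OF b z] by metis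
  qed (simp add: toeplitz_hash_subset)
  moreover have "card ?K * 2 ^ l = 2 ^ (l + w)"
    using card_toeplitz_kernel[of ?d w l l] y unfolding row_parity_def by auto
  ultimately show ?thesis by simp
qed

lemma card_bij_betw_filter:
  assumes "bij_betw f S T"
  shows "card {x\<in>S. Q (f x)} = card {y\<in>T. Q y}"
proof -
  have "f ` {x\<in>S. Q (f x)} = {y\<in>T. Q y}" using assms by (auto simp: bij_betw_def)
  moreover have "inj_on f {x\<in>S. Q (f x)}" using assms by (auto simp: bij_betw_def inj_on_def)
  ultimately show ?thesis by (metis card_image)
qed

text \<open>The locale works with numbers, so sets of bits are numbered by arbitrary bijections. A
  seed has \<open>l + w\<close> bits for the matrix and \<open>l\<close> bits for the shift.\<close>

lemma ex_hash_gadget: "\<exists>G. hash_gadget G (2 ^ (2 * l + w)) (2 ^ w) (2 ^ l) \<and> (\<forall>x y. G x y < 2 ^ l)"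
proof -
  let ?X = "seeds l w"
  have ex: "\<exists>f. bij_betw f {..<k :: nat} A" if "finite A" "card A = k" for A :: "'c set" and k
    using ex_bij_betw_nat_finite[OF that(1)] that(2) by (simp add: atLeast0LessThan)
  have cards: "card ?X = 2 ^ (2 * l + w)" "card (Pow {..<w}) = 2 ^ w" "card (Pow {..<l}) = 2 ^ l"
    by (simp_all only: card_cartesian_product card_Pow finite_lessThan card_lessThan power_add[symmetric])
       (simp add: mult_2)
  obtain fx where fx: "bij_betw fx {..<2 ^ (2 * l + w) :: nat} ?X" using ex[OF _ cards(1)] by auto
  obtain fy where fy: "bij_betw fy {..<2 ^ w :: nat} (Pow {..<w})" using ex[OF _ cards(2)] by auto
  obtain fz where fz: "bij_betw fz {..<2 ^ l :: nat} (Pow {..<l})" using ex[OF _ cards(3)] by auto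
  define gz where "gz = inv_into {..<2 ^ l} fz"
  have gz: "gz z < 2 ^ l" "fz (gz z) = z" if "z \<subseteq> {..<l}" for z
    using bij_betw_inv_into[OF fz] bij_betw_inv_into_right[OF fz, of z] that
    unfolding gz_def by (auto simp: bij_betw_def)
  have gzf: "gz (fz z) = z" if "z < 2 ^ l" for z
    using bij_betw_inv_into_left[OF fz, of z] that by (simp add: gz_def)
  define H where "H x y = toeplitz_hash l (fst (fx x)) (snd (fx x)) (fy y)" for x y
  have H: "H x y \<subseteq> {..<l}" for x y by (simp add: H_def toeplitz_hash_subset)
  have eq: "gz (H x y) = z \<longleftrightarrow> H x y = fz z" if "z < 2 ^ l" for x y z
    using gz(2)[OF H] gzf[OF that] by metis
  have fzs: "fz z \<subseteq> {..<l}" if "z < 2 ^ l" for z using fz that by (auto simp: bij_betw_def)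
  have fys: "fy y \<subseteq> {..<w}" if "y < 2 ^ w" for y using fy that by (auto simp: bij_betw_def)
  have count: "card {x\<in>{..<2 ^ (2 * l + w)}. Q (fst (fx x)) (snd (fx x))} = card {(a, b)\<in>?X. Q a b}" for Q
    using card_bij_betw_filter[OF fx, of "\<lambda>p. Q (fst p) (snd p)"] by (simp only: case_prod_unfold prod.collapse)
  have "hash_gadget (\<lambda>x y. gz (H x y)) (2 ^ (2 * l + w)) (2 ^ w) (2 ^ l)"
  proof
    fix y z :: nat assume y: "y < 2 ^ w" and z: "z < 2 ^ l"
    have "card {x\<in>{..<2 ^ (2 * l + w)}. gz (H x y) = z} = 2 ^ (l + w)"
      unfolding eq[OF z] unfolding H_def
      using count[of "\<lambda>a b. toeplitz_hash l a b (fy y) = fz z"] card_toeplitz_uniform[OF fzs[OF z]] by simp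
    then show "2 ^ l * card {x\<in>{..<2 ^ (2 * l + w)}. gz (H x y) = z} = 2 ^ (2 * l + w)"
      by (simp add: power_add mult_2)
  next
    fix y y' z :: nat assume y: "y < 2 ^ w" "y' < 2 ^ w" "y \<noteq> y'" and z: "z < 2 ^ l"
    have "fy y \<noteq> fy y'" using fy y by (auto simp: bij_betw_def inj_on_def)
    then have "card {x\<in>{..<2 ^ (2 * l + w)}. gz (H x y) = z \<and> gz (H x y') = z} * 2 ^ l = 2 ^ (l + w)"
      unfolding eq[OF z] unfolding H_def
      using count[of "\<lambda>a b. toeplitz_hash l a b (fy y) = fz z \<and> toeplitz_hash l a b (fy y') = fz z"]
        card_toeplitz_pairwise[OF fzs[OF z] fys[OF y(1)] fys[OF y(2)]] by simp
    then have "2 ^ l * (card {x\<in>{..<2 ^ (2 * l + w)}. gz (H x y) = z \<and> gz (H x y') = z} * 2 ^ l)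
        = 2 ^ (2 * l + w)"
      by (simp only: power_add[symmetric]) simp
    then show "2 ^ l * 2 ^ l * card {x\<in>{..<2 ^ (2 * l + w)}. gz (H x y) = z \<and> gz (H x y') = z} = 2 ^ (2 * l + w)"
      by (simp only: mult_ac)
  qed auto
  then show ?thesis using gz(1)[OF H] by blast
qed

section \<open>Codes and derandomization\<close>

lemma sum_power_card_Pow:
  fixes x :: real
  assumes "finite A"
  shows "(\<Sum>B\<in>Pow A. x ^ card B) = (x + 1) ^ card A"
  using prod_add[OF assms, of "\<lambda>_. x" "\<lambda>_. 1"] by simp

text \<open>Symmetric difference with \<open>A\<close> moves the centre to the empty set. The rest
  is an exponential-weight bound.\<close>

lemma card_hamming_ball:
  assumes A: "A \<subseteq> {..<16 * h}"
  shows "card {B\<in>Pow {..<16 * h}. card ((A - B) \<union> (B - A)) \<le> h} \<le> 64 ^ h"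
proof -
  let ?V = "{..<16 * h}" and ?s = "\<lambda>B. (A - B) \<union> (B - A)"
  have "bij_betw ?s {B\<in>Pow ?V. card (?s B) \<le> h} {B\<in>Pow ?V. card B \<le> h}"
  proof (rule bij_betwI[where g = ?s])
    have ss: "?s (?s B) = B" for B by blast
    show "?s \<in> {B\<in>Pow ?V. card B \<le> h} \<rightarrow> {B\<in>Pow ?V. card (?s B) \<le> h}"
      using A by (auto simp: ss)
  qed (use A in auto)
  then have "card {B\<in>Pow ?V. card (?s B) \<le> h} = card {B\<in>Pow ?V. card B \<le> h}" by (rule bij_betw_same_card)
  moreover have "real (card {B\<in>Pow ?V. card B \<le> h}) \<le> 64 ^ h"
  proof -
    have "real (card {B\<in>Pow ?V. card B \<le> h}) = (\<Sum>B\<in>{B\<in>Pow ?V. card B \<le> h}. 1)" by simp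
    \<comment> \<open>15 is the optimal base, the ratio of \<open>16 * h - h\<close> to
      \<open>h\<close>. It gives \<open>15 * (16 / 15) ^ 16\<close>, about 42, per unit of
      \<open>h\<close>.\<close>
    also have "\<dots> \<le> (\<Sum>B\<in>{B\<in>Pow ?V. card B \<le> h}. 15 ^ h * (1 / 15) ^ card B)"
    proof (rule sum_mono)
      fix B assume "B \<in> {B\<in>Pow ?V. card B \<le> h}"
      then have "(15 :: real) ^ card B \<le> 15 ^ h" by (intro power_increasing) auto
      then show "1 \<le> 15 ^ h * (1 / 15 :: real) ^ card B" by (simp add: power_one_over field_simps)
    qed
    also have "\<dots> \<le> (\<Sum>B\<in>Pow ?V. 15 ^ h * (1 / 15) ^ card B)" by (rule sum_mono2) auto
    also have "\<dots> = 15 ^ h * (1 / 15 + 1) ^ (16 * h)"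
      by (simp only: sum_distrib_left[symmetric] sum_power_card_Pow finite_lessThan card_lessThan)
    also have "\<dots> = (15 * (1 / 15 + 1) ^ 16) ^ h" by (simp only: power_mult power_mult_distrib)
    also have "\<dots> \<le> 64 ^ h" by (intro power_mono) (auto simp: power_divide)
    finally show ?thesis .
  qed
  ultimately show ?thesis by (metis of_nat_le_iff of_nat_numeral of_nat_power)
qed

text \<open>The greedy argument of Gilbert and Varshamov: fewer than \<open>2 ^ (10 * h)\<close>
  balls of size at most \<open>2 ^ (6 * h)\<close> cannot cover all \<open>2 ^ (16 * h)\<close>
  words.\<close>

lemma ex_code:
  assumes "M \<le> 2 ^ (10 * h)"
  shows "\<exists>c :: nat \<Rightarrow> nat set. (\<forall>a<M. c a \<subseteq> {..<16 * h}) \<and>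
    (\<forall>a<M. \<forall>b<M. a \<noteq> b \<longrightarrow> h < card ((c a - c b) \<union> (c b - c a)))"
  using assms
proof (induction M)
  case (Suc M)
  then obtain c :: "nat \<Rightarrow> nat set" where c: "\<forall>a<M. c a \<subseteq> {..<16 * h}"
    "\<forall>a<M. \<forall>b<M. a \<noteq> b \<longrightarrow> h < card ((c a - c b) \<union> (c b - c a))"
    by auto
  let ?ball = "\<lambda>A. {B\<in>Pow {..<16 * h}. card ((A - B) \<union> (B - A)) \<le> h}"
  have "card (\<Union>a<M. ?ball (c a)) \<le> (\<Sum>a<M. card (?ball (c a)))" by (rule card_UN_le) simp
  also have "\<dots> \<le> (\<Sum>a<M. 64 ^ h)" using c(1) by (intro sum_mono card_hamming_ball) auto
  also have "\<dots> = M * 64 ^ h" by simp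
  also have "\<dots> < 2 ^ (10 * h) * 64 ^ h" using Suc.prems by (intro mult_strict_right_mono) auto
  also have "\<dots> = card (Pow {..<16 * h})"
  proof -
    have "(2 :: nat) ^ (10 * h) * 64 ^ h = (2 ^ 10 * 64) ^ h"
      by (simp only: power_mult power_mult_distrib)
    also have "\<dots> = (2 ^ 16) ^ h" by simp
    also have "\<dots> = card (Pow {..<16 * h})" by (simp only: card_Pow finite_lessThan card_lessThan power_mult)
    finally show ?thesis .
  qed
  finally have less: "card (\<Union>a<M. ?ball (c a)) < card (Pow {..<16 * h})" .
  have "\<not> Pow {..<16 * h} \<subseteq> (\<Union>a<M. ?ball (c a))"
  proof
    assume "Pow {..<16 * h} \<subseteq> (\<Union>a<M. ?ball (c a))"
    then have "card (Pow {..<16 * h}) \<le> card (\<Union>a<M. ?ball (c a))" by (intro card_mono) auto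
    then show False using less by linarith
  qed
  then obtain B where "B \<in> Pow {..<16 * h}" "B \<notin> (\<Union>a<M. ?ball (c a))" by blast
  then have B: "B \<subseteq> {..<16 * h}" "\<forall>a<M. h < card ((c a - B) \<union> (B - c a))"
    by (auto simp: not_le)
  show ?case
  proof (intro exI[of _ "c(M := B)"] conjI allI impI)
    fix a b assume "a < Suc M" "b < Suc M" "a \<noteq> b"
    then consider "a < M" "b < M" | "a = M" "b < M" | "b = M" "a < M" by linarith
    then show "h < card (((c(M := B)) a - (c(M := B)) b) \<union> ((c(M := B)) b - (c(M := B)) a))"
      using c(2) B(2) \<open>a \<noteq> b\<close> by cases (auto simp: Un_commute)
  qed (use c(1) B(1) less_Suc_eq in auto)
qed simp

text \<open>The averaging half of Yao's principle: the expected weighted success is at least 2/3 of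
  the total weight, so some deterministic protocol attains it.\<close>

lemma ex_good_protocol:
  assumes M: "randomized_protocol X Y R c M" and I: "finite I" "\<And>i. i \<in> I \<Longrightarrow> w i \<ge> (0::real)"
    and ab: "\<And>i. i \<in> I \<Longrightarrow> a i \<in> X" "\<And>i. i \<in> I \<Longrightarrow> b i \<in> Y"
  shows "\<exists>P\<in>space M. 2 / 3 * (\<Sum>i\<in>I. w i)
           \<le> (\<Sum>i\<in>I. w i * of_bool (R (a i) (b i) (run P (a i) (b i))))"
proof (rule ccontr)
  interpret prob_space M using M by (simp add: randomized_protocol_def)
  define S where "S i = {P\<in>space M. R (a i) (b i) (run P (a i) (b i))}" for i
  have S: "measure M (S i) \<ge> 2 / 3" if "i \<in> I" for i
    using M ab[OF that] by (simp add: randomized_protocol_def S_def)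
  \<comment> \<open>A set outside the sigma-algebra would get measure 0, so the success bound itself
    yields measurability.\<close>
  have S_sets: "S i \<in> sets M" if "i \<in> I" for i
    using S[OF that] measure_notin_sets[of "S i" M] by fastforce
  let ?f = "\<lambda>P. \<Sum>i\<in>I. w i * indicator (S i) P"
  assume "\<not> ?thesis"
  then have "(\<Sum>i\<in>I. w i * of_bool (R (a i) (b i) (run P (a i) (b i)))) < 2 / 3 * (\<Sum>i\<in>I. w i)"
    if "P \<in> space M" for P using that by force
  moreover have "?f P = (\<Sum>i\<in>I. w i * of_bool (R (a i) (b i) (run P (a i) (b i))))" if "P \<in> space M" for P
    using that by (intro sum.cong) (auto simp: S_def indicator_def)
  ultimately have less: "?f P < 2 / 3 * (\<Sum>i\<in>I. w i)" if "P \<in> space M" for P using that by simp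
  have int: "integrable M ?f"
    using S_sets by (intro Bochner_Integration.integrable_sum integrable_mult_right) (auto simp: emeasure_eq_measure)
  have "expectation ?f < 2 / 3 * (\<Sum>i\<in>I. w i)"
    using less by (intro expectation_less int) auto
  moreover have "expectation ?f = (\<Sum>i\<in>I. w i * measure M (S i))"
    using S_sets by (subst Bochner_Integration.integral_sum) (auto simp: emeasure_eq_measure)
  moreover have "(\<Sum>i\<in>I. w i * measure M (S i)) \<ge> (\<Sum>i\<in>I. w i * (2 / 3))"
    using S I by (intro sum_mono mult_left_mono) auto
  moreover have "(\<Sum>i\<in>I. w i * (2 / 3)) = 2 / 3 * (\<Sum>i\<in>I. w i)"
    by (simp only: sum_distrib_right[symmetric] mult.commute)
  ultimately show False by linarith
qed

section \<open>The phase field\<close>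

type_synonym point = "nat \<Rightarrow> real"

definition ndist :: "nat \<Rightarrow> point \<Rightarrow> point \<Rightarrow> real" where
  "ndist k x y = L2_set (\<lambda>i. x i - y i) {..<k} / sqrt (real k)"

lemma ndist_nonneg: "ndist k x y \<ge> 0"
  by (simp add: ndist_def)

lemma ndist_sym: "ndist k x y = ndist k y x"
  by (simp add: ndist_def L2_set_def power2_commute)

lemma ndist_triangle: "ndist k x z \<le> ndist k x y + ndist k y z"
proof -
  have "L2_set (\<lambda>i. x i - z i) {..<k} = L2_set (\<lambda>i. (x i - y i) + (y i - z i)) {..<k}" by simp
  also have "\<dots> \<le> L2_set (\<lambda>i. x i - y i) {..<k} + L2_set (\<lambda>i. y i - z i) {..<k}"
    by (rule L2_set_triangle_ineq)
  finally show ?thesis by (simp add: ndist_def add_divide_distrib[symmetric] divide_right_mono)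
qed

lemma ndist_cong: "(\<And>i. i < k \<Longrightarrow> x i = x' i) \<Longrightarrow> (\<And>i. i < k \<Longrightarrow> y i = y' i) \<Longrightarrow> ndist k x y = ndist k x' y'"
  unfolding ndist_def by (intro arg_cong2[where f = "(/)"] L2_set_cong) auto

lemma ndist_mono:
  assumes "\<And>i. i < k \<Longrightarrow> l * \<bar>u i - v i\<bar> \<le> \<bar>x i - y i\<bar>" "0 \<le> l"
  shows "l * ndist k u v \<le> ndist k x y"
proof -
  have "l * L2_set (\<lambda>i. u i - v i) {..<k} = L2_set (\<lambda>i. l * \<bar>u i - v i\<bar>) {..<k}"
    using assms(2) by (simp add: L2_set_right_distrib[symmetric]) (simp add: L2_set_def)
  also have "\<dots> \<le> L2_set (\<lambda>i. \<bar>x i - y i\<bar>) {..<k}"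
    using assms by (intro L2_set_mono) auto
  also have "\<dots> = L2_set (\<lambda>i. x i - y i) {..<k}" by (simp add: L2_set_def)
  finally show ?thesis unfolding ndist_def times_divide_eq_right by (rule divide_right_mono) simp
qed

lemma ndist_mix:
  assumes "0 \<le> l"
  shows "l * ndist k u v \<le> ndist k u (\<lambda>i. (1 - l) * u i + l * v i)"
proof (rule ndist_mono[OF _ assms])
  fix i
  have "u i - ((1 - l) * u i + l * v i) = l * (u i - v i)" by (simp add: algebra_simps)
  then show "l * \<bar>u i - v i\<bar> \<le> \<bar>u i - ((1 - l) * u i + l * v i)\<bar>" using assms by (simp add: abs_mult)
qed

text \<open>Where \<open>w\<close> and \<open>u\<close> differ, \<open>w\<close> is an endpoint of
  the unit interval, and the convex combination stays at least \<open>l\<close> away from it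
  whatever \<open>v\<close> is.\<close>

lemma ndist_mix_binary:
  assumes "0 \<le> l" "l \<le> 1" "\<And>i. w i \<in> {0, 1}" "\<And>i. u i \<in> {0, 1}" "\<And>i. v i \<in> {0, 1}"
  shows "l * ndist k w u \<le> ndist k w (\<lambda>i. l * u i + (1 - l) * v i)"
proof (rule ndist_mono[OF _ assms(1)])
  fix i
  show "l * \<bar>w i - u i\<bar> \<le> \<bar>w i - (l * u i + (1 - l) * v i)\<bar>"
    using assms(1,2) assms(3)[of i] assms(4)[of i] assms(5)[of i] by (auto simp: algebra_simps)
qed

section \<open>Cut-off functions, decoding, and the dynamics\<close>

definition clip :: "real \<Rightarrow> real" where "clip x = max 0 (min 1 x)"

lemma clip_bounds: "0 \<le> clip x" "clip x \<le> 1" "\<bar>clip x\<bar> \<le> 1"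
  by (auto simp: clip_def)

lemma clip_eq: "1 \<le> x \<Longrightarrow> clip x = 1" "x \<le> 0 \<Longrightarrow> clip x = 0"
  by (auto simp: clip_def)

definition hat :: "real \<Rightarrow> nat \<Rightarrow> point \<Rightarrow> point \<Rightarrow> real" where
  "hat r k u P = clip (2 - ndist k P u / r)"

text \<open>The radii 1/128, 1/64 and 1/32 are nested: wherever a weight of one radius is positive,
  the decoding with the next radius is exact. A weight vanishes outside twice its radius, and
  codewords are 1/4 apart, so at most one summand is nonzero.\<close>

definition code_sum :: "real \<Rightarrow> nat \<Rightarrow> nat \<Rightarrow> (nat \<Rightarrow> nat \<Rightarrow> real) \<Rightarrow> point \<Rightarrow> point \<Rightarrow> real" where
  "code_sum r k M c P w = (\<Sum>a<M. hat r k (c a) P * w a)"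

lemma hat_bounds: "0 \<le> hat r k u P" "hat r k u P \<le> 1"
  using clip_bounds by (auto simp: hat_def)

lemma hat_eq_1: "ndist k P u \<le> r \<Longrightarrow> 0 < r \<Longrightarrow> hat r k u P = 1"
  by (auto simp: hat_def intro!: clip_eq simp: field_simps)

lemma hat_eq_0: "2 * r \<le> ndist k P u \<Longrightarrow> 0 < r \<Longrightarrow> hat r k u P = 0"
  by (auto simp: hat_def intro!: clip_eq simp: field_simps)

lemma code_sum_single:
  assumes "a < M" "\<And>b. b < M \<Longrightarrow> b \<noteq> a \<Longrightarrow> hat r k (c b) P = 0"
  shows "code_sum r k M c P w = hat r k (c a) P * w a"
proof -
  have "code_sum r k M c P w = (\<Sum>b<M. if b = a then hat r k (c a) P * w a else 0)"
    unfolding code_sum_def using assms(2) by (intro sum.cong) auto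
  then show ?thesis using assms(1) by simp
qed

text \<open>The phase \<open>(C, S)\<close> rotates with angular speed \<open>speed y ms C\<close> and is attracted to the unit circle.
  The weight \<open>ms\<close> tells how close \<open>P2\<close> is to the start of the line; there the speed is at least
  \<open>- 2 * C\<close>, so that backward rotation stops at \<open>(0, - 1)\<close>. Near the top of the cube, first \<open>P1\<close> and
  \<open>P2\<close> are pulled to the start of the line and then the phase is pulled to \<open>(0, - 1)\<close>.\<close>

definition speed :: "real \<Rightarrow> real \<Rightarrow> real \<Rightarrow> real" where
  "speed y ms C = max (max (-4) (min 4 (12 - 32 * y))) (-4 + ms * (4 - 2 * C))"

definition field_C :: "real \<Rightarrow> real \<Rightarrow> real \<Rightarrow> real" where
  "field_C A C S = - S * A + (1 - (C\<^sup>2 + S\<^sup>2)) * C"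

definition field_S :: "real \<Rightarrow> real \<Rightarrow> real \<Rightarrow> real" where
  "field_S A C S = C * A + (1 - (C\<^sup>2 + S\<^sup>2)) * S"

text \<open>\<open>fadeP\<close> falls from 1 to 0 between the heights 1/2 and 5/8 and
  \<open>fadeT\<close> between 5/8 and 3/4, so the codewords have arrived at the start before the
  phase is pulled.\<close>

definition fadeP :: "real \<Rightarrow> real" where "fadeP y = clip (5 - 8 * y)"
definition fadeT :: "real \<Rightarrow> real" where "fadeT y = clip (6 - 8 * y)"

definition next_C :: "real \<Rightarrow> real \<Rightarrow> real \<Rightarrow> real \<Rightarrow> real" where
  "next_C y ms C S = fadeT y * (C + field_C (speed y ms C) C S / 256)"

definition next_S :: "real \<Rightarrow> real \<Rightarrow> real \<Rightarrow> real \<Rightarrow> real" where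
  "next_S y ms C S = - (1 - fadeT y) + fadeT y * (S + field_S (speed y ms C) C S / 256)"

text \<open>In the right quarter of the circle \<open>P2\<close> moves between codewords and in the left quarter \<open>P1\<close> does,
  so their closeness \<open>q2\<close> resp. \<open>q1\<close> to the code is ignored there. The last factor cuts off the
  tail that backward motion from the start of the line would create.\<close>

definition tube :: "real \<Rightarrow> real \<Rightarrow> real \<Rightarrow> real \<Rightarrow> real \<Rightarrow> real" where
  "tube q1 q2 ms C S = min (min (clip (4 * (C\<^sup>2 + S\<^sup>2) - 1)) (max q1 (clip (- 4 * C - 2))))
     (min (max q2 (clip (4 * C - 2))) (1 - ms * clip (2 * S)))"

text \<open>Inside the tube (\<open>q = 1\<close>) the height is driven to 3/16, outside it
  (\<open>q = 0\<close>) the height rises. For intermediate \<open>q\<close> the drift can vanish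
  only if \<open>q\<close> is at least 1/2.\<close>

definition drift :: "real \<Rightarrow> real \<Rightarrow> real" where
  "drift q y = q * max (-1) (min 1 (3 - 16 * y)) + (1 - q)"

definition next_y :: "real \<Rightarrow> real \<Rightarrow> real" where
  "next_y q y = clip (y + drift q y / 8)"

text \<open>\<open>d\<close> is the point's own codeword, \<open>e\<close> that of the other point,
  \<open>p\<close> a pointer and \<open>b\<close> the start of the line. In one forward turn, both
  points are at \<open>a\<close> at the bottom; on the right \<open>P1\<close> rests and
  \<open>P2\<close> passes from \<open>a\<close> to its successor; on the left \<open>P2\<close>
  rests and \<open>P1\<close> passes from the predecessor of \<open>P2\<close> to \<open>P2\<close>.
  On the left only \<open>P2\<close> is remembered, which is why predecessor pointers are
  needed.\<close>

definition next_P :: "real \<Rightarrow> real \<Rightarrow> real \<Rightarrow> real \<Rightarrow> real \<Rightarrow> real \<Rightarrow> real \<Rightarrow> real" where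
  "next_P y w z p d e b = (1 - fadeP y) * b + fadeP y * (w * d + (1 - w) * (z * p + (1 - z) * e))"

section \<open>Bounds for the phase field\<close>

lemma speed_bounds:
  assumes "0 \<le> ms" "ms \<le> 1" "\<bar>C\<bar> \<le> 2"
  shows "\<bar>speed y ms C\<bar> \<le> 4"
proof -
  have "ms * (4 - 2 * C) \<le> 1 * 8" using assms by (intro mult_mono) auto
  then have "-4 + ms * (4 - 2 * C) \<le> 4" by simp
  then have "speed y ms C \<le> 4" unfolding speed_def by (intro max.boundedI) auto
  moreover have "-4 \<le> speed y ms C" unfolding speed_def by (intro max.coboundedI1) auto
  ultimately show ?thesis unfolding abs_le_iff by linarith
qed

lemma field_bounds:
  assumes "\<bar>A\<bar> \<le> 4" "\<bar>C\<bar> \<le> 2" "\<bar>S\<bar> \<le> 2"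
  shows "\<bar>field_C A C S\<bar> \<le> 22" "\<bar>field_S A C S\<bar> \<le> 22"
proof -
  have sq: "C\<^sup>2 \<le> 4" "S\<^sup>2 \<le> 4"
    using assms abs_le_square_iff[of C 2] abs_le_square_iff[of S 2] by auto
  have R: "\<bar>1 - (C\<^sup>2 + S\<^sup>2)\<bar> \<le> 7"
    unfolding abs_le_iff using sq zero_le_power2[of C] zero_le_power2[of S] by linarith
  have "\<bar>S * A\<bar> \<le> 2 * 4" "\<bar>C * A\<bar> \<le> 2 * 4"
    "\<bar>(1 - (C\<^sup>2 + S\<^sup>2)) * C\<bar> \<le> 7 * 2" "\<bar>(1 - (C\<^sup>2 + S\<^sup>2)) * S\<bar> \<le> 7 * 2"
    unfolding abs_mult using assms R by (intro mult_mono; simp)+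
  then show "\<bar>field_C A C S\<bar> \<le> 22" "\<bar>field_S A C S\<bar> \<le> 22"
    unfolding field_C_def field_S_def by linarith+
qed

text \<open>The step is shorter than 1/10, so it can leave the interval only from
  \<open>C > 19 / 10\<close>. There the attraction to the unit circle outweighs the
  rotation.\<close>

lemma field_step_le:
  assumes "\<bar>A\<bar> \<le> 4" "\<bar>C\<bar> \<le> 2" "\<bar>S\<bar> \<le> 2"
  shows "C + field_C A C S / 256 \<le> 2"
proof (cases "C \<le> 19 / 10")
  case True
  then show ?thesis using field_bounds(1)[OF assms] by linarith
next
  case False
  have "- S * A \<le> \<bar>- S * A\<bar>" by (rule abs_ge_self)
  also have "\<dots> \<le> \<bar>S\<bar> * 4" unfolding abs_mult abs_minus_cancel using assms(1) by (intro mult_left_mono) auto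
  finally have "- S * A \<le> \<bar>S\<bar> * 4" .
  moreover have "(1 - (C\<^sup>2 + S\<^sup>2)) * C \<le> (1 - ((19/10)\<^sup>2 + S\<^sup>2)) * (19/10)"
  proof -
    have le: "(19/10)\<^sup>2 + S\<^sup>2 - 1 \<le> C\<^sup>2 + S\<^sup>2 - 1" using False by (auto intro!: power_mono)
    have nonneg: "0 \<le> (19/10)\<^sup>2 + S\<^sup>2 - (1 :: real)" by (simp add: power2_eq_square)
    have "((19/10)\<^sup>2 + S\<^sup>2 - 1) * (19/10) \<le> (C\<^sup>2 + S\<^sup>2 - 1) * (19/10)"
      by (rule mult_right_mono[OF le]) simp
    also have "\<dots> \<le> (C\<^sup>2 + S\<^sup>2 - 1) * C"
      by (rule mult_left_mono) (use False le nonneg in linarith)+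
    finally have "((19/10)\<^sup>2 + S\<^sup>2 - 1) * (19/10) \<le> (C\<^sup>2 + S\<^sup>2 - 1) * C" .
    then show ?thesis by (simp add: algebra_simps)
  qed
  moreover have "\<bar>S\<bar> * 4 + (1 - ((19/10)\<^sup>2 + S\<^sup>2)) * (19/10) \<le> 0"
  proof -
    \<comment> \<open>The value 20/19 maximizes
      \<open>4 * \<bar>S\<bar> - 19 / 10 * S\<^sup>2\<close>.\<close>
    have "0 \<le> (\<bar>S\<bar> - 20/19)\<^sup>2" by simp
    then have "\<bar>S\<bar> * (40/19) \<le> S\<^sup>2 + (20/19)\<^sup>2" by (simp add: power2_diff algebra_simps)
    then show ?thesis by (simp add: power2_eq_square algebra_simps)
  qed
  ultimately have "field_C A C S \<le> 0" unfolding field_C_def by linarith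
  then show ?thesis using assms by auto
qed

lemma field_symmetries:
  "field_C A (- C) S = - field_C (- A) C S" "field_S A C S = field_C (- A) S C"
  by (simp_all add: field_C_def field_S_def algebra_simps)

lemma field_step_range:
  assumes "\<bar>A\<bar> \<le> 4" "\<bar>C\<bar> \<le> 2" "\<bar>S\<bar> \<le> 2"
  shows "\<bar>C + field_C A C S / 256\<bar> \<le> 2" "\<bar>S + field_S A C S / 256\<bar> \<le> 2"
proof -
  have *: "\<bar>C + field_C A C S / 256\<bar> \<le> 2" if "\<bar>A\<bar> \<le> 4" "\<bar>C\<bar> \<le> 2" "\<bar>S\<bar> \<le> 2" for A C S
    using field_step_le[OF that] field_step_le[of "- A" "- C" S] that by (simp add: field_symmetries(1))
  show "\<bar>C + field_C A C S / 256\<bar> \<le> 2" "\<bar>S + field_S A C S / 256\<bar> \<le> 2"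
    using *[OF assms] *[of "- A" S C] assms by (simp_all add: field_symmetries(2))
qed

lemma next_range:
  assumes "0 \<le> ms" "ms \<le> 1" "\<bar>C\<bar> \<le> 2" "\<bar>S\<bar> \<le> 2"
  shows "\<bar>next_C y ms C S\<bar> \<le> 2" "\<bar>next_S y ms C S\<bar> \<le> 2"
proof -
  define f where "f = fadeT y"
  have f: "0 \<le> f" "f \<le> 1" using clip_bounds by (auto simp: fadeT_def f_def)
  note r = field_step_range[OF speed_bounds[OF assms(1-3)] assms(3,4), of y]
  have "\<bar>f * (C + field_C (speed y ms C) C S / 256)\<bar> \<le> 1 * 2"
    unfolding abs_mult using f r by (intro mult_mono) auto
  then show "\<bar>next_C y ms C S\<bar> \<le> 2" by (simp add: next_C_def f_def)
  have "\<bar>f * (S + field_S (speed y ms C) C S / 256)\<bar> \<le> f * 2"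
    unfolding abs_mult using f r by (intro mult_mono) auto
  then have "\<bar>- (1 - f) + f * (S + field_S (speed y ms C) C S / 256)\<bar> \<le> (1 - f) + f * 2"
    using f by linarith
  then show "\<bar>next_S y ms C S\<bar> \<le> 2" using f unfolding next_S_def f_def[symmetric] by linarith
qed

text \<open>The tangential component of the field times the radius is the speed times the squared
  radius, and the radial one is \<open>1 - (C\<^sup>2 + S\<^sup>2)\<close> times it. So away from
  the origin a nearly vanishing field makes both the speed and
  \<open>1 - (C\<^sup>2 + S\<^sup>2)\<close> small.\<close>

lemma fixed_speed_zero:
  assumes V: "\<bar>field_C A C S\<bar> \<le> 1 / 10000" "\<bar>field_S A C S\<bar> \<le> 1 / 10000"
    and b: "\<bar>C\<bar> \<le> 2" "\<bar>S\<bar> \<le> 2" and R: "7 / 20 \<le> C\<^sup>2 + S\<^sup>2"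
  shows "\<bar>A\<bar> \<le> 1 / 100" "\<bar>1 - (C\<^sup>2 + S\<^sup>2)\<bar> \<le> 1 / 100"
proof -
  let ?VC = "field_C A C S" and ?VS = "field_S A C S" and ?R = "C\<^sup>2 + S\<^sup>2"
  have small: "\<bar>u * v\<bar> \<le> 2 * (1 / 10000)" if "\<bar>u\<bar> \<le> 2" "\<bar>v\<bar> \<le> 1 / 10000" for u v :: real
    unfolding abs_mult using that by (intro mult_mono) auto
  have gen: "\<bar>x\<bar> \<le> 1 / 100" if "\<bar>x * ?R\<bar> \<le> 4 / 10000" for x
  proof -
    have "\<bar>x\<bar> * (7 / 20) \<le> \<bar>x\<bar> * ?R" using R by (intro mult_left_mono) auto
    also have "\<dots> = \<bar>x * ?R\<bar>" using R by (simp add: abs_mult)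
    finally show ?thesis using that by linarith
  qed
  have "A * ?R = C * ?VS - S * ?VC" unfolding field_C_def field_S_def by (simp add: power2_eq_square algebra_simps)
  then have "\<bar>A * ?R\<bar> \<le> 4 / 10000" using small[OF b(1) V(2)] small[OF b(2) V(1)] by linarith
  then show "\<bar>A\<bar> \<le> 1 / 100" by (rule gen)
  have "(1 - ?R) * ?R = C * ?VC + S * ?VS" unfolding field_C_def field_S_def by (simp add: power2_eq_square algebra_simps)
  then have "\<bar>(1 - ?R) * ?R\<bar> \<le> 4 / 10000" using small[OF b(1) V(1)] small[OF b(2) V(2)] by linarith
  then show "\<bar>1 - ?R\<bar> \<le> 1 / 100" by (rule gen)
qed

section \<open>Approximate fixed points\<close>

text \<open>A self-loop of \<open>outp\<close> marks the end and one of \<open>inp\<close> the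
  start. The graph consists of the path from \<open>s\<close> to \<open>t\<close> and possibly of
  cycles, on which the phase can rotate forever.\<close>

locale line_instance =
  fixes k M :: nat and c :: "nat \<Rightarrow> point" and outp inp :: "nat \<Rightarrow> nat" and s t :: nat
  assumes binary: "\<And>a j. c a j \<in> {0, 1}"
    and sep: "\<And>a b. a < M \<Longrightarrow> b < M \<Longrightarrow> a \<noteq> b \<Longrightarrow> 1 / 4 \<le> ndist k (c a) (c b)"
    and range: "\<And>a. a < M \<Longrightarrow> outp a < M" "\<And>a. a < M \<Longrightarrow> inp a < M"
    and inverse: "\<And>a b. a < M \<Longrightarrow> b < M \<Longrightarrow> a \<noteq> b \<Longrightarrow> outp a = b \<longleftrightarrow> inp b = a"
    and ends: "\<And>a. a < M \<Longrightarrow> outp a = a \<longleftrightarrow> a = t" "\<And>a. a < M \<Longrightarrow> inp a = a \<longleftrightarrow> a = s"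
    and st: "s < M" "t < M" "s \<noteq> t"
begin

lemma close_unique:
  assumes "a < M" "b < M" "ndist k P (c a) + ndist k P (c b) < 1 / 4"
  shows "a = b"
proof (rule ccontr)
  assume "a \<noteq> b"
  then have "1 / 4 \<le> ndist k (c a) (c b)" using sep assms by auto
  also have "\<dots> \<le> ndist k (c a) P + ndist k P (c b)" by (rule ndist_triangle)
  finally show False using assms(3) ndist_sym[of k P "c a"] by simp
qed

lemma hat_other:
  assumes "a < M" "b < M" "b \<noteq> a" "ndist k P (c a) \<le> 1 / 64" "0 < r" "r \<le> 1 / 64"
  shows "hat r k (c b) P = 0"
proof (rule hat_eq_0[OF _ assms(5)])
  have "\<not> ndist k P (c a) + ndist k P (c b) < 1 / 4" using close_unique assms(1-3) by blast
  then show "2 * r \<le> ndist k P (c b)" using assms(4,6) by linarith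
qed

lemma code_sum_close:
  assumes "a < M" "ndist k P (c a) \<le> 1 / 64"
  shows "code_sum (1 / 64) k M c P w = w a"
proof -
  have "code_sum (1 / 64) k M c P w = hat (1 / 64) k (c a) P * w a"
    using assms by (intro code_sum_single hat_other) auto
  then show ?thesis using hat_eq_1[OF assms(2)] by simp
qed

abbreviation near :: "point \<Rightarrow> real" where
  "near P \<equiv> code_sum (1 / 128) k M c P (\<lambda>_. 1)"

lemma near_close:
  assumes "a < M" "ndist k P (c a) \<le> 1 / 64"
  shows "near P = hat (1 / 128) k (c a) P"
  using assms code_sum_single[OF assms(1), of "1 / 128" k c P "\<lambda>_. 1"] hat_other by simp

lemma near_pos:
  assumes "near P > 0"
  obtains a where "a < M" "ndist k P (c a) < 1 / 64"
proof -
  have "\<exists>a<M. ndist k P (c a) < 1 / 64"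
  proof (rule ccontr)
    assume "\<not> ?thesis"
    then have "near P = 0" unfolding code_sum_def by (intro sum.neutral ballI) (auto simp: hat_eq_0)
    then show False using assms by simp
  qed
  then show ?thesis using that by blast
qed

lemma near_bounds: "0 \<le> near P" "near P \<le> 1"
proof -
  show "0 \<le> near P" unfolding code_sum_def using hat_bounds by (auto intro!: sum_nonneg)
  show "near P \<le> 1"
  proof (cases "near P > 0")
    case True
    then obtain a where "a < M" "ndist k P (c a) < 1 / 64" by (rule near_pos)
    then show ?thesis using near_close[of a P] hat_bounds(2) by simp
  qed simp
qed

lemma near_eq_1: "a < M \<Longrightarrow> ndist k P (c a) \<le> 1 / 128 \<Longrightarrow> near P = 1"
  using near_close[of a P] hat_eq_1[of k P "c a" "1 / 128"] by simp

abbreviation ms :: "point \<Rightarrow> real" where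
  "ms P \<equiv> hat (1 / 64) k (c s) P"

abbreviation dec :: "point \<Rightarrow> point" where
  "dec P j \<equiv> code_sum (1 / 64) k M c P (\<lambda>a. c a j)"

abbreviation out_dec :: "point \<Rightarrow> point" where
  "out_dec P j \<equiv> code_sum (1 / 64) k M c P (\<lambda>a. c (outp a) j)"

abbreviation in_dec :: "point \<Rightarrow> point" where
  "in_dec P j \<equiv> code_sum (1 / 64) k M c P (\<lambda>a. c (inp a) j)"

end

lemma tube_eq_1I:
  assumes "1 / 2 \<le> C\<^sup>2 + S\<^sup>2" "q1 = 1 \<or> C \<le> - 3 / 4" "q2 = 1 \<or> 3 / 4 \<le> C" "ms * clip (2 * S) = 0"
    "q1 \<le> 1" "q2 \<le> 1"
  shows "tube q1 q2 ms C S = 1"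
proof -
  have "clip (4 * (C\<^sup>2 + S\<^sup>2) - 1) = 1" using assms by (intro clip_eq) auto
  moreover have "max q1 (clip (- 4 * C - 2)) = 1"
    using assms clip_bounds(2)[of "- 4 * C - 2"] clip_eq(1)[of "- 4 * C - 2"] by (auto simp: max_def)
  moreover have "max q2 (clip (4 * C - 2)) = 1"
    using assms clip_bounds(2)[of "4 * C - 2"] clip_eq(1)[of "4 * C - 2"] by (auto simp: max_def)
  moreover have "1 - ms * clip (2 * S) = 1" using assms(4) by (simp only:)
  ultimately show ?thesis unfolding tube_def by (simp only: min.idem)
qed

text \<open>The threshold lies below the value 1/2 at which the height balances, to leave room for
  the error of an approximate fixed point.\<close>

lemma tube_geD:
  assumes "2 / 5 \<le> tube q1 q2 ms C S"
  shows "7 / 20 \<le> C\<^sup>2 + S\<^sup>2" "- 1 / 2 \<le> C \<Longrightarrow> 2 / 5 \<le> q1" "C \<le> 1 / 2 \<Longrightarrow> 2 / 5 \<le> q2"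
    "ms * clip (2 * S) \<le> 3 / 5"
proof -
  have *: "2 / 5 \<le> clip (4 * (C\<^sup>2 + S\<^sup>2) - 1)" "2 / 5 \<le> max q1 (clip (- 4 * C - 2))"
    "2 / 5 \<le> max q2 (clip (4 * C - 2))" "2 / 5 \<le> 1 - ms * clip (2 * S)"
    using assms unfolding tube_def by auto
  show "7 / 20 \<le> C\<^sup>2 + S\<^sup>2" using *(1) by (auto simp: clip_def max_def min_def split: if_splits)
  show "ms * clip (2 * S) \<le> 3 / 5" using *(4) by simp
  show "2 / 5 \<le> q1" if "- 1 / 2 \<le> C" using *(2) clip_eq(2)[of "- 4 * C - 2"] that by (auto simp: max_def split: if_splits)
  show "2 / 5 \<le> q2" if "C \<le> 1 / 2" using *(3) clip_eq(2)[of "4 * C - 2"] that by (auto simp: max_def split: if_splits)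
qed

text \<open>The hypothetical configuration to be refuted: an approximate fixed point away from the
  end. The height alone forces \<open>2 / 5 \<le> q\<close> and \<open>q \<noteq> 1\<close>. In each
  case below, stationarity of the other coordinates either fails or places the point fully inside
  the tube.\<close>

locale line_fixpoint = line_instance +
  fixes P1 P2 :: point and C S y q :: real
  defines "q \<equiv> tube (code_sum (1 / 128) k M c P1 (\<lambda>_. 1)) (code_sum (1 / 128) k M c P2 (\<lambda>_. 1))
      (hat (1 / 64) k (c s) P2) C S"
  assumes fix1: "ndist k P1 (\<lambda>j. next_P y (clip (1 / 2 + C)) (clip (1 / 2 + S)) (in_dec P2 j) (dec P1 j) (dec P2 j) (c s j))
      \<le> 1 / 10 ^ 7"
    and fix2: "ndist k P2 (\<lambda>j. next_P y (1 - clip (1 / 2 + C)) (clip (1 / 2 + S)) (out_dec P1 j) (dec P2 j) (dec P1 j) (c s j))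
      \<le> 1 / 10 ^ 7"
    and fixC: "\<bar>next_C y (ms P2) C S - C\<bar> \<le> 1 / 10 ^ 7"
    and fixS: "\<bar>next_S y (ms P2) C S - S\<bar> \<le> 1 / 10 ^ 7"
    and fixy: "\<bar>next_y q y - y\<bar> \<le> 1 / 10 ^ 7"
    and C: "\<bar>C\<bar> \<le> 2" and S: "\<bar>S\<bar> \<le> 2" and y: "0 \<le> y" "y \<le> 1"
    and far: "1 / 64 \<le> ndist k P1 (c t)"
begin

abbreviation "A \<equiv> speed y (ms P2) C"
abbreviation "R \<equiv> C\<^sup>2 + S\<^sup>2"

lemma ms_bounds: "0 \<le> ms P2" "ms P2 \<le> 1"
  using hat_bounds by auto

lemma q_bounds: "0 \<le> q" "q \<le> 1"
proof -
  have "ms P2 * clip (2 * S) \<le> 1 * 1" using ms_bounds clip_bounds by (intro mult_mono) auto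
  then show "0 \<le> q" unfolding q_def tube_def using near_bounds clip_bounds by (auto simp: le_max_iff_disj)
  have "q \<le> clip (4 * (C\<^sup>2 + S\<^sup>2) - 1)" unfolding q_def tube_def by auto
  then show "q \<le> 1" using clip_bounds(2) order_trans by blast
qed

text \<open>Truncation of the height at 0 is impossible because the drift is nonnegative up to
  height 1/8 and at least -1 elsewhere. Truncation at 1 needs a height above 7/8.\<close>

lemma drift_cases:
  shows "7 / 8 < y \<and> 0 < drift q y \<or> \<bar>drift q y\<bar> \<le> 8 / 10 ^ 7"
proof -
  have "\<bar>drift q y\<bar> \<le> 1"
  proof -
    let ?H = "max (-1) (min 1 (3 - 16 * y))"
    have "\<bar>q * ?H\<bar> \<le> q * 1" unfolding abs_mult using q_bounds by (intro mult_mono) auto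
    then show ?thesis unfolding drift_def using q_bounds by linarith
  qed
  moreover have "0 \<le> drift q y" if "y \<le> 1 / 8"
  proof -
    have "max (-1) (min 1 (3 - 16 * y)) = 1" using that by auto
    then show ?thesis by (simp add: drift_def)
  qed
  ultimately consider "1 < y + drift q y / 8" | "0 \<le> y + drift q y / 8" "y + drift q y / 8 \<le> 1"
    using y by linarith
  then show ?thesis
  proof cases
    case 1
    then show ?thesis using \<open>\<bar>drift q y\<bar> \<le> 1\<close> y by linarith
  next
    case 2
    then have "next_y q y = y + drift q y / 8" by (simp add: next_y_def clip_def)
    then have "drift q y = 8 * (next_y q y - y)" by simp
    then have "\<bar>drift q y\<bar> = 8 * \<bar>next_y q y - y\<bar>" by (simp only: abs_mult abs_numeral)
    then show ?thesis using fixy by simp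
  qed
qed

lemma drift_q1: "q = 1 \<Longrightarrow> drift q y = max (-1) (min 1 (3 - 16 * y))"
  by (simp add: drift_def)

lemma field_small:
  assumes "y \<le> 5 / 8"
  shows "\<bar>field_C A C S\<bar> \<le> 1 / 10000" "\<bar>field_S A C S\<bar> \<le> 1 / 10000"
proof -
  have "fadeT y = 1" using assms by (auto simp: fadeT_def intro!: clip_eq)
  then show "\<bar>field_C A C S\<bar> \<le> 1 / 10000" "\<bar>field_S A C S\<bar> \<le> 1 / 10000"
    using fixC fixS by (simp_all add: next_C_def next_S_def)
qed

text \<open>Inside the tube the height settles near 3/16, where the phase still rotates at full
  speed.\<close>

lemma q_neq_1: "q \<noteq> 1"
proof
  assume q1: "q = 1"
  note H = drift_q1[OF q1]
  have yy: "1 / 8 < y" "y < 1 / 4"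
    using drift_cases unfolding H by (auto simp: max_def min_def abs_if split: if_splits)
  have R: "7 / 20 \<le> R" using tube_geD(1)[of "near P1" "near P2" "ms P2" C S] q1 unfolding q_def by simp
  have "\<bar>A\<bar> \<le> 1 / 100" using fixed_speed_zero(1)[OF field_small C S R] yy by auto
  moreover have "4 \<le> A" unfolding speed_def using yy by (auto simp: le_max_iff_disj)
  ultimately show False by linarith
qed

text \<open>A point held at the top by truncation has been pulled to the start and to the phase
  \<open>(0, - 1)\<close>, which is in the tube. Otherwise the drift nearly vanishes, and its first
  summand can compensate \<open>1 - q\<close> only by \<open>- q\<close>.\<close>

lemma q_ge: "2 / 5 \<le> q" "\<bar>drift q y\<bar> \<le> 8 / 10 ^ 7"
proof -
  show d: "\<bar>drift q y\<bar> \<le> 8 / 10 ^ 7"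
  proof (rule ccontr)
    assume "\<not> ?thesis"
    then have y78: "7 / 8 < y" using drift_cases by auto
    have f: "fadeP y = 0" "fadeT y = 0"
      using y78 by (auto simp: fadeP_def fadeT_def intro!: clip_eq)
    have P: "ndist k P1 (c s) \<le> 1 / 128" "ndist k P2 (c s) \<le> 1 / 128"
      using fix1 fix2 by (simp_all add: next_P_def f)
    have CS: "\<bar>- 1 - S\<bar> \<le> 1 / 10 ^ 7"
      using fixS by (simp add: next_S_def f)
    have "(99 / 100)\<^sup>2 \<le> S\<^sup>2" using CS by (intro abs_le_square_iff[THEN iffD1]) (simp add: abs_if split: if_splits)
    moreover have "(99 / 100)\<^sup>2 = (9801 / 10000 :: real)" by (simp add: power2_eq_square)
    ultimately have "1 / 2 \<le> R" using zero_le_power2[of C] by linarith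
    moreover have "clip (2 * S) = 0" using CS by (intro clip_eq) (simp add: abs_if split: if_splits)
    ultimately have "q = 1" unfolding q_def
      using near_eq_1[OF st(1)] P near_bounds by (intro tube_eq_1I) auto
    then show False using q_neq_1 by simp
  qed
  have "q * (-1) \<le> q * max (-1) (min 1 (3 - 16 * y))" using q_bounds by (intro mult_left_mono) auto
  moreover have "drift q y \<le> 1 / 1000" using abs_le_D1[OF d] by simp
  ultimately show "2 / 5 \<le> q" unfolding drift_def by linarith
qed

lemma R: "7 / 20 \<le> R"
  and near1: "- 1 / 2 \<le> C \<Longrightarrow> 2 / 5 \<le> near P1"
  and near2: "C \<le> 1 / 2 \<Longrightarrow> 2 / 5 \<le> near P2"
  and cut: "ms P2 * clip (2 * S) \<le> 3 / 5"
  using tube_geD[of "near P1" "near P2" "ms P2" C S] q_ge(1) unfolding q_def by auto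

lemma not_near1:
  assumes "- 1 / 2 \<le> C"
  obtains a where "a < M" "ndist k P1 (c a) < 1 / 64" "a \<noteq> t"
proof -
  have "near P1 > 0" using near1[OF assms] by linarith
  then obtain a where a: "a < M" "ndist k P1 (c a) < 1 / 64" by (rule near_pos)
  then have "a \<noteq> t" using far by auto
  then show ?thesis using a that by blast
qed

lemma not_near2:
  assumes "C \<le> 1 / 2"
  obtains b where "b < M" "ndist k P2 (c b) < 1 / 64"
proof -
  have "near P2 > 0" using near2[OF assms] by linarith
  then show ?thesis using that by (rule near_pos)
qed

lemma tube_1I:
  assumes "1 / 2 \<le> R" "near P1 = 1 \<or> C \<le> - 3 / 4" "near P2 = 1 \<or> 3 / 4 \<le> C" "ms P2 * clip (2 * S) = 0"
  shows False
  using tube_eq_1I[OF assms] near_bounds q_neq_1 unfolding q_def by blast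

lemma ms_1: "ndist k P2 (c s) \<le> 1 / 64 \<Longrightarrow> ms P2 = 1"
  by (rule hat_eq_1) auto

lemma ms_0: "b < M \<Longrightarrow> b \<noteq> s \<Longrightarrow> ndist k P2 (c b) \<le> 1 / 64 \<Longrightarrow> ms P2 = 0"
  using hat_other[of b s P2 "1 / 64"] st by auto

lemma ms_pos: "0 < ms P2 \<Longrightarrow> ndist k P2 (c s) < 1 / 32"
  using hat_eq_0[of "1 / 64" k P2 "c s"] by (force simp: not_le[symmetric])

lemma outp_neq_s:
  assumes "a < M"
  shows "outp a \<noteq> s"
  using assms inverse[of a s] ends[of s] st by metis

section \<open>The quarters of the phase circle\<close>

lemma phase_cases:
  assumes R1: "99 / 100 \<le> R" and "\<bar>C\<bar> \<le> u" "u\<^sup>2 + v\<^sup>2 < 99 / 100"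
  shows "S < - v \<or> v < S"
proof (rule ccontr)
  assume "\<not> ?thesis"
  then have "\<bar>S\<bar> \<le> \<bar>v\<bar>" by linarith
  then have "S\<^sup>2 \<le> v\<^sup>2" by (rule abs_le_square_iff[THEN iffD1])
  moreover have "C\<^sup>2 \<le> u\<^sup>2" by (rule abs_le_square_iff[THEN iffD1]) (use assms(2) in linarith)
  ultimately show False using assms by linarith
qed

lemma phase_quarters:
  assumes "99 / 100 \<le> R"
  shows "\<bar>C\<bar> \<le> 3 / 4 \<Longrightarrow> S < - 1 / 2 \<or> 1 / 2 < S"
    "\<bar>C\<bar> \<le> 1 / 2 \<Longrightarrow> S < - 4 / 5 \<or> 4 / 5 < S"
  using phase_cases[OF assms, of "3 / 4" "1 / 2"] phase_cases[OF assms, of "1 / 2" "4 / 5"]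
  by (simp_all add: power2_eq_square)

text \<open>\<open>P1\<close> rests at a codeword \<open>c a\<close> and \<open>P2\<close> lies
  between \<open>c a\<close> and \<open>c (outp a)\<close>. Unless \<open>3 / 4 \<le> C\<close>,
  where the tube ignores \<open>P2\<close>, the phase is high or low enough to put \<open>P2\<close>
  at one of the two. For \<open>S > 0\<close> at least half of \<open>P2\<close> comes from
  \<open>outp a\<close>; no vertex leads to \<open>s\<close>, so the cut at the start is
  inactive.\<close>

lemma regime_right:
  assumes y: "y \<le> 1 / 2" and R1: "99 / 100 \<le> R" and C1: "1 / 2 \<le> C"
  shows False
proof -
  define z where "z = clip (1 / 2 + S)"
  have f: "fadeP y = 1" using y by (auto simp: fadeP_def intro!: clip_eq)
  have k1: "clip (1 / 2 + C) = 1" using C1 by (intro clip_eq) auto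
  have z: "0 \<le> z" "z \<le> 1" by (auto simp: z_def clip_bounds)
  obtain a where a: "a < M" "ndist k P1 (c a) < 1 / 64" "a \<noteq> t" using C1 by (rule_tac not_near1) auto
  have v: "code_sum (1 / 64) k M c P1 w = w a" for w using a by (intro code_sum_close) auto
  have "ndist k P1 (c a) \<le> 1 / 10 ^ 7" using fix1 by (simp add: next_P_def f k1 v)
  then have n1: "near P1 = 1" using near_eq_1[OF a(1)] by simp
  have P2: "ndist k P2 (\<lambda>j. z * c (outp a) j + (1 - z) * c a j) \<le> 1 / 10 ^ 7"
    using fix2 by (simp add: next_P_def f k1 v z_def)
  have n2: "near P2 = 1 \<or> 3 / 4 \<le> C"
  proof (rule disjCI)
    assume "\<not> 3 / 4 \<le> C"
    then have "S < - 1 / 2 \<or> 1 / 2 < S" using phase_quarters(1)[OF R1] C1 by auto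
    then have "z = 0 \<or> z = 1" unfolding z_def using clip_eq by auto
    then have "ndist k P2 (c a) \<le> 1 / 128 \<or> ndist k P2 (c (outp a)) \<le> 1 / 128" using P2 by auto
    then show "near P2 = 1" using near_eq_1 a(1) range by blast
  qed
  have "ms P2 * clip (2 * S) = 0"
  proof (rule ccontr)
    assume *: "ms P2 * clip (2 * S) \<noteq> 0"
    then have "0 < ms P2" "0 < S" using ms_bounds(1) clip_eq(2)[of "2 * S"] by fastforce+
    then have m: "ndist k P2 (c s) < 1 / 32" and z12: "1 / 2 \<le> z"
      using ms_pos by (auto simp: z_def clip_def)
    have "1 / 2 * (1 / 4) \<le> z * ndist k (c s) (c (outp a))"
      using z12 outp_neq_s[OF a(1)] sep[OF st(1) range(1)[OF a(1)]] by (intro mult_mono) auto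
    also have "\<dots> \<le> ndist k (c s) (\<lambda>j. z * c (outp a) j + (1 - z) * c a j)"
      using z binary by (intro ndist_mix_binary) auto
    also have "\<dots> \<le> ndist k (c s) P2 + ndist k P2 (\<lambda>j. z * c (outp a) j + (1 - z) * c a j)"
      by (rule ndist_triangle)
    finally show False using m P2 ndist_sym[of k P2] by simp
  qed
  then show False using tube_1I n1 n2 R1 by auto
qed

text \<open>The mirror image, with \<open>P2\<close> resting at \<open>c b\<close> and
  \<open>P1\<close> between \<open>c b\<close> and \<open>c (inp b)\<close>. For
  \<open>b = s\<close> the speed is at least \<open>- 2 * C\<close>, hence at least 1, so the point
  is not stationary.\<close>

lemma regime_left:
  assumes y: "y \<le> 1 / 2" and R1: "99 / 100 \<le> R" and A: "\<bar>A\<bar> \<le> 1 / 100" and C1: "C \<le> - 1 / 2"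
  shows False
proof -
  define z where "z = clip (1 / 2 + S)"
  have f: "fadeP y = 1" using y by (auto simp: fadeP_def intro!: clip_eq)
  have k1: "clip (1 / 2 + C) = 0" using C1 by (intro clip_eq) auto
  obtain b where b: "b < M" "ndist k P2 (c b) < 1 / 64" using C1 by (rule_tac not_near2) auto
  have v: "code_sum (1 / 64) k M c P2 w = w b" for w using b by (intro code_sum_close) auto
  have "ndist k P2 (c b) \<le> 1 / 10 ^ 7" using fix2 by (simp add: next_P_def f k1 v)
  then have n2: "near P2 = 1" using near_eq_1[OF b(1)] by simp
  have P1: "ndist k P1 (\<lambda>j. z * c (inp b) j + (1 - z) * c b j) \<le> 1 / 10 ^ 7"
    using fix1 by (simp add: next_P_def f k1 v z_def)
  have n1: "near P1 = 1 \<or> C \<le> - 3 / 4"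
  proof (rule disjCI)
    assume "\<not> C \<le> - 3 / 4"
    then have "S < - 1 / 2 \<or> 1 / 2 < S" using phase_quarters(1)[OF R1] C1 by auto
    then have "z = 0 \<or> z = 1" unfolding z_def using clip_eq by auto
    then have "ndist k P1 (c b) \<le> 1 / 128 \<or> ndist k P1 (c (inp b)) \<le> 1 / 128" using P1 by auto
    then show "near P1 = 1" using near_eq_1 b(1) range by blast
  qed
  have "b \<noteq> s"
  proof
    assume "b = s"
    then have "ms P2 = 1" using ms_1 b(2) by auto
    then have "- 2 * C \<le> A" by (simp add: speed_def)
    then show False using A C1 by linarith
  qed
  then have "ms P2 = 0" using ms_0[OF b(1)] b(2) by simp
  then show False using tube_1I n1 n2 R1 by auto
qed

text \<open>\<open>P1\<close> decodes to \<open>a\<close> and \<open>P2\<close> to \<open>b\<close>.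
  If \<open>b\<close> is not the successor of \<open>a\<close>, then \<open>P1\<close> is drawn to
  \<open>inp b\<close> with weight \<open>1 - w\<close> and \<open>P2\<close> to
  \<open>outp a\<close> with weight \<open>w\<close>, and these cannot both be small. Distance from
  the end matters here: at \<open>a = b = t\<close> the successor table answers \<open>t\<close>,
  but the predecessor table does not.\<close>

lemma regime_top:
  assumes y: "y \<le> 1 / 2" and R1: "99 / 100 \<le> R" and C1: "\<bar>C\<bar> \<le> 1 / 2" and S1: "4 / 5 < S"
  shows False
proof -
  define w where "w = clip (1 / 2 + C)"
  have f: "fadeP y = 1" using y by (auto simp: fadeP_def intro!: clip_eq)
  have z: "clip (1 / 2 + S) = 1" "clip (2 * S) = 1" using S1 by (auto intro!: clip_eq)
  have w: "0 \<le> w" "w \<le> 1" by (auto simp: w_def clip_bounds)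
  obtain a where a: "a < M" "ndist k P1 (c a) < 1 / 64" "a \<noteq> t" using C1 by (rule_tac not_near1) auto
  obtain b where b: "b < M" "ndist k P2 (c b) < 1 / 64" using C1 by (rule_tac not_near2) auto
  have "b \<noteq> s" using cut ms_1 b(2) z by fastforce
  have v1: "code_sum (1 / 64) k M c P1 w = w a" for w using a by (intro code_sum_close) auto
  have v2: "code_sum (1 / 64) k M c P2 w = w b" for w using b by (intro code_sum_close) auto
  have P1: "ndist k P1 (\<lambda>j. w * c a j + (1 - w) * c (inp b) j) \<le> 1 / 10 ^ 7"
    using fix1 by (simp add: next_P_def f z v1 v2 w_def)
  have P2: "ndist k P2 (\<lambda>j. (1 - w) * c b j + w * c (outp a) j) \<le> 1 / 10 ^ 7"
    using fix2 by (simp add: next_P_def f z v1 v2 w_def)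
  have "1 - w \<le> 1 / 10" if "inp b \<noteq> a"
  proof -
    have "(1 - w) * (1 / 4) \<le> (1 - w) * ndist k (c a) (c (inp b))"
      using w that a b range by (intro mult_left_mono sep) auto
    also have "\<dots> \<le> ndist k (c a) (\<lambda>j. (1 - (1 - w)) * c a j + (1 - w) * c (inp b) j)"
      using w by (intro ndist_mix) auto
    also have "\<dots> \<le> ndist k (c a) P1 + ndist k P1 (\<lambda>j. w * c a j + (1 - w) * c (inp b) j)"
      by (simp add: ndist_triangle)
    finally show ?thesis using P1 a(2) ndist_sym[of k P1] by simp
  qed
  moreover have "w \<le> 1 / 10" if "outp a \<noteq> b"
  proof -
    have "w * (1 / 4) \<le> w * ndist k (c b) (c (outp a))"
      using w that a b range by (intro mult_left_mono sep) auto
    also have "\<dots> \<le> ndist k (c b) (\<lambda>j. (1 - w) * c b j + w * c (outp a) j)"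
      using w by (intro ndist_mix) auto
    also have "\<dots> \<le> ndist k (c b) P2 + ndist k P2 (\<lambda>j. (1 - w) * c b j + w * c (outp a) j)"
      by (rule ndist_triangle)
    finally show ?thesis using P2 b(2) ndist_sym[of k P2] by simp
  qed
  moreover have "inp b = a \<longleftrightarrow> outp a = b"
    using inverse[of a b] ends a b \<open>b \<noteq> s\<close> by metis
  ultimately have ab: "inp b = a" "outp a = b" by linarith+
  have "ndist k P1 (c a) \<le> 1 / 10 ^ 7" "ndist k P2 (c b) \<le> 1 / 10 ^ 7"
    using P1 P2 by (simp_all add: ab algebra_simps)
  then have "near P1 = 1" "near P2 = 1" using near_eq_1[OF a(1)] near_eq_1[OF b(1)] by simp_all
  moreover have "ms P2 = 0" using ms_0[OF b(1) \<open>b \<noteq> s\<close>] b(2) by simp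
  ultimately show False using tube_1I R1 by auto
qed

text \<open>Both points have the same image \<open>Q\<close>, so they are close to each other and
  decode to the same codeword. Pulling towards the start does not disturb this if that codeword is
  the start, which is the case \<open>0 < ms P2\<close>.\<close>

lemma regime_bottom:
  assumes R1: "99 / 100 \<le> R" and C1: "\<bar>C\<bar> \<le> 1 / 2" and S1: "S < - 4 / 5"
    and y: "y \<le> 1 / 2 \<or> 0 < ms P2"
  shows False
proof -
  define w where "w = clip (1 / 2 + C)"
  define f where "f = fadeP y"
  have z: "clip (1 / 2 + S) = 0" "clip (2 * S) = 0" using S1 by (auto intro!: clip_eq)
  obtain a where a: "a < M" "ndist k P1 (c a) < 1 / 64" "a \<noteq> t" using C1 by (rule_tac not_near1) auto
  obtain b where b: "b < M" "ndist k P2 (c b) < 1 / 64" using C1 by (rule_tac not_near2) auto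
  have v1: "code_sum (1 / 64) k M c P1 w = w a" for w using a by (intro code_sum_close) auto
  have v2: "code_sum (1 / 64) k M c P2 w = w b" for w using b by (intro code_sum_close) auto
  define Q where "Q j = (1 - f) * c s j + f * (w * c a j + (1 - w) * c b j)" for j
  have P1: "ndist k P1 Q \<le> 1 / 10 ^ 7"
    using fix1 by (simp add: next_P_def z v1 v2 w_def f_def Q_def[abs_def])
  have P2: "ndist k P2 Q \<le> 1 / 10 ^ 7"
  proof -
    have "(\<lambda>j. next_P y (1 - clip (1 / 2 + C)) (clip (1 / 2 + S)) (out_dec P1 j) (dec P2 j) (dec P1 j) (c s j)) = Q"
      unfolding next_P_def z v1 v2 w_def f_def Q_def by (rule ext) (simp add: algebra_simps)
    then show ?thesis using fix2 by simp
  qed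
  have "ndist k P2 (c a) \<le> ndist k P2 Q + (ndist k Q P1 + ndist k P1 (c a))"
    using ndist_triangle[of k P2 "c a" Q] ndist_triangle[of k Q "c a" P1] by linarith
  then have "ndist k P2 (c a) + ndist k P2 (c b) < 1 / 4"
    using P1 P2 a(2) b(2) ndist_sym[of k P1 Q] by simp
  then have ab: "a = b" using close_unique a b by blast
  have "f = 1 \<or> b = s"
  proof (cases "f = 1")
    case False
    have "f = 1" if "y \<le> 1 / 2" unfolding f_def fadeP_def by (intro clip_eq) (use that in auto)
    then have "0 < ms P2" using y False by blast
    then show ?thesis using ms_0[OF b(1)] b(2) by fastforce
  qed simp
  then have "Q = c b" unfolding Q_def[abs_def] using ab by (auto simp: algebra_simps)
  then have "near P1 = 1" "near P2 = 1"
    using P1 P2 near_eq_1[OF b(1)] by simp_all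
  then show False using tube_1I R1 z by auto
qed

section \<open>The ranges of the height\<close>

lemma y_gt_half: "1 / 2 < y"
proof (rule ccontr)
  assume "\<not> ?thesis"
  then have y: "y \<le> 1 / 2" by simp
  have A: "\<bar>A\<bar> \<le> 1 / 100" and "\<bar>1 - R\<bar> \<le> 1 / 100"
    using fixed_speed_zero[OF field_small C S R] y by auto
  then have R1: "99 / 100 \<le> R" by linarith
  consider "1 / 2 \<le> C" | "C \<le> - 1 / 2" | "\<bar>C\<bar> \<le> 1 / 2" by linarith
  then show False
    using regime_right[OF y R1] regime_left[OF y R1 A] regime_top[OF y R1] regime_bottom[OF R1]
      phase_quarters(2)[OF R1] y by cases blast+
qed

lemma speed_late: "A = -4 + ms P2 * (4 - 2 * C)"
proof -
  have "max (-4) (min 4 (12 - 32 * y)) = -4" using y_gt_half by auto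
  moreover have "0 \<le> ms P2 * (4 - 2 * C)" using ms_bounds C by (intro mult_nonneg_nonneg) auto
  ultimately show ?thesis by (simp add: speed_def)
qed

text \<open>Between 1/2 and 5/8 the speed would be -4 without the correction near the start.
  Stationarity therefore puts \<open>P2\<close> at the start with \<open>C\<close> near 0. The cut
  of the tube excludes the top of the circle, and the bottom is already settled.\<close>

lemma y_gt: "5 / 8 < y"
proof (rule ccontr)
  assume "\<not> ?thesis"
  then have y: "y \<le> 5 / 8" by simp
  have A: "\<bar>A\<bar> \<le> 1 / 100" and "\<bar>1 - R\<bar> \<le> 1 / 100"
    using fixed_speed_zero[OF field_small C S R] y by auto
  then have R1: "99 / 100 \<le> R" by linarith
  have "- A \<le> 1 / 100" using A by linarith
  then have m: "399 / 100 \<le> ms P2 * (4 - 2 * C)" using speed_late by simp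
  have "ms P2 * (4 - 2 * C) \<le> 1 * (4 - 2 * C)" using ms_bounds C by (intro mult_right_mono) auto
  then have C1: "C \<le> 1 / 100" using m by simp
  have mpos: "0 < ms P2" using m ms_bounds(1) by (cases "ms P2 = 0") auto
  obtain b where b: "b < M" "ndist k P2 (c b) < 1 / 64" using C1 by (rule_tac not_near2) auto
  then have "ndist k P2 (c s) \<le> 1 / 64" using ms_0[OF b(1)] mpos by (cases "b = s") auto
  then have m1: "ms P2 = 1" by (rule ms_1)
  then have C2: "\<bar>C\<bar> \<le> 1 / 100" using A speed_late by (simp add: abs_le_iff)
  have "\<not> 4 / 5 < S"
  proof
    assume "4 / 5 < S"
    then have "clip (2 * S) = 1" by (intro clip_eq) auto
    then show False using cut m1 by simp
  qed
  then have "S < - 4 / 5" using phase_quarters(2)[OF R1] C2 by auto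
  then show False using regime_bottom[OF R1] C2 mpos by auto
qed

text \<open>Now \<open>P1\<close> and \<open>P2\<close> are at the start and the speed is
  \<open>- 2 * C\<close>, which attracts the phase to \<open>(0, - 1)\<close>; its other rest point
  on the circle, \<open>(0, 1)\<close>, is removed by the cut. The case distinction on
  \<open>f\<close> asks how strong the additional pull to \<open>(0, - 1)\<close> is.\<close>

lemma contradiction: False
proof -
  define f where "f = fadeT y"
  have f: "0 \<le> f" "f \<le> 1" using clip_bounds by (auto simp: f_def fadeT_def)
  have fP: "fadeP y = 0" using y_gt by (auto simp: fadeP_def intro!: clip_eq)
  have P: "ndist k P1 (c s) \<le> 1 / 10 ^ 7" "ndist k P2 (c s) \<le> 1 / 10 ^ 7"
    using fix1 fix2 by (simp_all add: next_P_def fP)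
  have n: "near P1 = 1" "near P2 = 1" using near_eq_1[OF st(1)] P by simp_all
  have m: "ms P2 = 1" using P(2) by (intro ms_1) simp
  have A: "A = - 2 * C" using speed_late m by simp
  have S3: "S \<le> 3 / 10"
  proof (rule ccontr)
    assume "\<not> ?thesis"
    then have "3 / 5 < clip (2 * S)" by (auto simp: clip_def)
    then show False using cut m by simp
  qed
  define VC VS where "VC = field_C A C S" and "VS = field_S A C S"
  have V: "\<bar>VC\<bar> \<le> 22" "\<bar>VS\<bar> \<le> 22"
    using field_bounds[OF speed_bounds[OF ms_bounds C] C S] by (auto simp: VC_def VS_def)
  define WC WS where "WC = - (1 - f) * C + f * VC / 256" and "WS = - (1 - f) * (1 + S) + f * VS / 256"
  have WC: "\<bar>WC\<bar> \<le> 1 / 10 ^ 7" and WS: "\<bar>WS\<bar> \<le> 1 / 10 ^ 7"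
    using fixC fixS unfolding next_C_def next_S_def f_def[symmetric] VC_def[symmetric] VS_def[symmetric]
      WC_def WS_def by (simp_all add: algebra_simps)
  have finish: False if "1 / 2 \<le> R" "S \<le> 0"
    using tube_1I n that clip_eq(2)[of "2 * S"] by auto
  show False
  proof (cases "f \<le> 1 / 2")
    case True
    have fV: "\<bar>f * v / 256\<bar> \<le> 1 / 2 * 22 / 256" if "\<bar>v\<bar> \<le> 22" for v
      unfolding abs_divide abs_mult abs_numeral using that True f by (intro divide_right_mono mult_mono) auto
    have "WS = - ((1 - f) * (1 + S)) + f * VS / 256" unfolding WS_def by (simp only: minus_mult_left)
    moreover have "(1 / 10 ^ 7 :: real) \<le> 1 / 1000" by simp
    ultimately have "\<bar>(1 - f) * (1 + S)\<bar> \<le> 1 / 20" using WS fV[OF V(2)] by linarith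
    moreover have "1 / 2 * \<bar>1 + S\<bar> \<le> \<bar>(1 - f) * (1 + S)\<bar>"
      unfolding abs_mult using True by (intro mult_right_mono) auto
    ultimately have "1 / 2 * \<bar>1 + S\<bar> \<le> 1 / 20" by (rule order_trans[rotated])
    then have "\<bar>1 + S\<bar> \<le> 1 / 10" by simp
    then have S9: "S \<le> - 9 / 10" by linarith
    then have "(9 / 10)\<^sup>2 \<le> S\<^sup>2" by (intro abs_le_square_iff[THEN iffD1]) auto
    moreover have "(9 / 10)\<^sup>2 = (81 / 100 :: real)" by (simp add: power2_eq_square)
    ultimately have "1 / 2 \<le> R" using zero_le_power2[of C] by linarith
    then show False using finish S9 by simp
  next
    case False
    \<comment> \<open>Taking the component orthogonal to the pull towards \<open>(0, - 1)\<close> eliminates that pull.\<close>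
    have id: "- (S + 1) * WC + C * WS = - (f / 256) * (C * ((S + 1)\<^sup>2 + C\<^sup>2))"
      unfolding WC_def WS_def VC_def VS_def field_C_def field_S_def A
      by (simp add: power2_eq_square power3_eq_cube field_simps)
    have "\<bar>(S + 1) * WC\<bar> \<le> 3 * (1 / 10 ^ 7)" "\<bar>C * WS\<bar> \<le> 2 * (1 / 10 ^ 7)"
      unfolding abs_mult using S C WC WS by (intro mult_mono; simp)+
    then have "\<bar>C * WS - (S + 1) * WC\<bar> \<le> 2 * (1 / 10 ^ 7) + 3 * (1 / 10 ^ 7)"
      using abs_triangle_ineq4[of "C * WS" "(S + 1) * WC"] by simp
    moreover have "- (S + 1) * WC + C * WS = C * WS - (S + 1) * WC" by (simp add: algebra_simps)
    ultimately have "\<bar>- (S + 1) * WC + C * WS\<bar> \<le> 5 / 10 ^ 7" by simp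
    then have "f / 256 * \<bar>C * ((S + 1)\<^sup>2 + C\<^sup>2)\<bar> \<le> 5 / 10 ^ 7"
      unfolding id using f by (simp add: abs_mult)
    moreover have "1 / 512 * \<bar>C * ((S + 1)\<^sup>2 + C\<^sup>2)\<bar> \<le> f / 256 * \<bar>C * ((S + 1)\<^sup>2 + C\<^sup>2)\<bar>"
      using False by (intro mult_right_mono) auto
    ultimately have small: "\<bar>C * ((S + 1)\<^sup>2 + C\<^sup>2)\<bar> \<le> 2560 / 10 ^ 7" by linarith
    have C10: "\<bar>C\<bar> \<le> 1 / 10"
    proof (rule ccontr)
      assume "\<not> ?thesis"
      then have c: "1 / 10 \<le> \<bar>C\<bar>" by simp
      then have "(1 / 10)\<^sup>2 \<le> C\<^sup>2" by (intro abs_le_square_iff[THEN iffD1]) auto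
      moreover have "(1 / 10)\<^sup>2 = (1 / 100 :: real)" by (simp add: power2_eq_square)
      ultimately have "1 / 100 \<le> (S + 1)\<^sup>2 + C\<^sup>2" using zero_le_power2[of "S + 1"] by linarith
      then have "1 / 10 * (1 / 100) \<le> \<bar>C\<bar> * ((S + 1)\<^sup>2 + C\<^sup>2)" using c by (intro mult_mono) auto
      then show False using small by (simp add: abs_mult)
    qed
    then have C2: "C\<^sup>2 \<le> 1 / 100" using abs_le_square_iff[of C "1 / 10"] by (simp add: power_divide)
    \<comment> \<open>\<open>R \<ge> 7 / 20\<close> and \<open>C\<^sup>2 \<le> 1 / 100\<close> leave
      at least 34/100 for the square of \<open>S\<close>, which exceeds that of 29/50. Positive
      values are excluded by the cut.\<close>
    have S58: "S \<le> - 29 / 50"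
    proof (rule ccontr)
      assume "\<not> ?thesis"
      then have "\<bar>S\<bar> \<le> 29 / 50" using S3 by (simp add: abs_le_iff)
      then have "S\<^sup>2 \<le> (29 / 50)\<^sup>2" using abs_le_square_iff[of S "29 / 50"] by simp
      moreover have "(29 / 50)\<^sup>2 = (841 / 2500 :: real)" by (simp add: power2_eq_square)
      ultimately show False using R C2 by linarith
    qed
    show False
    proof (cases "1 / 2 \<le> R")
      case True
      then show False using finish S58 by simp
    next
      case R2: False
      have "S\<^sup>2 \<le> 1" using R2 zero_le_power2[of C] by linarith
      then have "- 1 \<le> S" using abs_le_square_iff[of S 1] by simp
      then have "0 \<le> (1 - f) * (1 + S)" using f by (intro mult_nonneg_nonneg) auto
      \<comment> \<open>Inside the circle and below its centre, the pull, the rotation and the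
        outward push of size \<open>X\<close> all act downwards, so they cannot cancel.\<close>
      define X where "X = (1 - R) * (- S)"
      have "(1 / 2) * (29 / 50) \<le> X" unfolding X_def
      proof (rule mult_mono)
        show r: "1 / 2 \<le> 1 - R" and "29 / 50 \<le> - S" using R2 S58 by linarith+
        show "0 \<le> 1 - R" using r by linarith
      qed simp
      moreover have "VS = - (2 * C\<^sup>2) - X"
        unfolding VS_def field_S_def A X_def by algebra
      ultimately have "VS \<le> - 29 / 100" using zero_le_power2[of C] by linarith
      then have "1 / 2 * (29 / 100) \<le> f * (- VS)" using False by (intro mult_mono) auto
      moreover have "WS = - ((1 - f) * (1 + S)) + f * VS / 256" unfolding WS_def by (simp only: minus_mult_left)
      moreover have "- WS \<le> 1 / 10000" using abs_le_D2[OF WS] by simp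
      ultimately show False using \<open>0 \<le> (1 - f) * (1 + S)\<close> by linarith
    qed
  qed
qed

end

section \<open>Lipschitz maps of the cube\<close>

definition block :: "nat \<Rightarrow> nat \<Rightarrow> point \<Rightarrow> point" where
  "block k b x j = x (b + j)"

definition mean :: "nat \<Rightarrow> point \<Rightarrow> real" where
  "mean k x = (\<Sum>i<k. x i) / real k"

lemma pnorm_2: "pnorm 2 k v = L2_set v {..<k} / sqrt (real k)"
proof -
  have "real_of_ereal 2 = 2" by simp
  moreover have "(2::ereal) \<noteq> \<infinity>" by simp
  ultimately show ?thesis
    by (simp add: pnorm_def L2_set_def powr_half_sqrt real_sqrt_divide sum_nonneg)
qed

lemma L2_set_le_max:
  assumes "\<And>i. i < k \<Longrightarrow> \<bar>v i\<bar> \<le> u" "0 \<le> u"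
  shows "L2_set v {..<k} / sqrt (real k) \<le> u"
proof (cases "k = 0")
  case False
  have "(\<Sum>i<k. (v i)\<^sup>2) \<le> (\<Sum>i<k. u\<^sup>2)"
    using assms by (intro sum_mono) (metis abs_le_square_iff abs_of_nonneg lessThan_iff)
  then have "L2_set v {..<k} \<le> sqrt (real k * u\<^sup>2)" by (simp add: L2_set_def)
  also have "\<dots> = sqrt (real k) * u" using assms(2) by (simp add: real_sqrt_mult)
  finally show ?thesis using False by (simp add: field_simps)
qed (use assms in simp)

lemma ndist_le_coord: "(\<And>i. i < k \<Longrightarrow> \<bar>x i - y i\<bar> \<le> u) \<Longrightarrow> 0 \<le> u \<Longrightarrow> ndist k x y \<le> u"
  unfolding ndist_def by (rule L2_set_le_max)

lemma pnorm_infty_ge: "i < k \<Longrightarrow> \<bar>v i\<bar> \<le> pnorm \<infinity> k v"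
  by (simp add: pnorm_def)

lemma pnorm_infty_le: "0 < k \<Longrightarrow> (\<And>i. i < k \<Longrightarrow> \<bar>v i\<bar> \<le> u) \<Longrightarrow> pnorm \<infinity> k v \<le> u"
  by (auto simp: pnorm_def intro!: Max.boundedI)

lemma ndist_le_pnorm:
  assumes "p \<in> {2, \<infinity>}" "0 < k"
  shows "ndist k x y \<le> pnorm p k (\<lambda>i. x i - y i)"
proof (cases "p = 2")
  case True
  show ?thesis unfolding True pnorm_2 by (simp add: ndist_def)
next
  case False
  then have p: "p = \<infinity>" using assms by simp
  have "0 \<le> pnorm \<infinity> k (\<lambda>i. x i - y i)"
    using pnorm_infty_ge[OF assms(2), of "\<lambda>i. x i - y i"] by (rule order_trans[OF abs_ge_zero])
  then show ?thesis unfolding p by (intro ndist_le_coord pnorm_infty_ge)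
qed

text \<open>The first \<open>q\<close> coordinates are copied, the others are computed. The
  normalized 2-norm is at most either \<open>p\<close>-norm, so computed coordinates may be
  estimated by \<open>ndist\<close> in both cases. Copied coordinates do not raise the mean square
  because the target dimension is at least \<open>n\<close>. The first player uses
  \<open>q = n\<close>, the second \<open>q = 0\<close>.\<close>

lemma pnorm_lipschitz_of_coords:
  assumes p: "p \<in> {2, \<infinity>}" and nm: "0 < n" "q = 0 \<or> n \<le> m'" "0 < m'" "0 \<le> L" and q: "q \<le> n" "q \<le> m'"
    and copy: "\<And>i. i < q \<Longrightarrow> \<bar>u i - v i\<bar> \<le> \<bar>x i - y i\<bar>"
    and lip: "\<And>i. q \<le> i \<Longrightarrow> i < m' \<Longrightarrow> \<bar>u i - v i\<bar> \<le> L * ndist n x y"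
  shows "pnorm p m' (\<lambda>i. u i - v i) \<le> (1 + L) * pnorm p n (\<lambda>i. x i - y i)"
proof (cases "p = 2")
  case True
  let ?d = "ndist n x y"
  have d: "(\<Sum>i<n. (x i - y i)\<^sup>2) = real n * ?d\<^sup>2"
    using nm by (simp add: ndist_def L2_set_def power_divide sum_nonneg)
  have "(\<Sum>i<m'. (u i - v i)\<^sup>2) = (\<Sum>i<q. (u i - v i)\<^sup>2) + (\<Sum>i=q..<m'. (u i - v i)\<^sup>2)"
    using sum.atLeastLessThan_concat[of 0 q m' "\<lambda>i. (u i - v i)\<^sup>2"] q by (simp add: atLeast0LessThan)
  also have "\<dots> \<le> (\<Sum>i<q. (x i - y i)\<^sup>2) + (\<Sum>i=q..<m'. (L * ?d)\<^sup>2)"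
  proof (intro add_mono sum_mono)
    fix i assume "i \<in> {..<q}"
    then show "(u i - v i)\<^sup>2 \<le> (x i - y i)\<^sup>2" using copy abs_le_square_iff by blast
  next
    fix i assume "i \<in> {q..<m'}"
    then have "\<bar>u i - v i\<bar> \<le> \<bar>L * ?d\<bar>" using lip nm by (simp add: abs_mult ndist_nonneg)
    then show "(u i - v i)\<^sup>2 \<le> (L * ?d)\<^sup>2" using abs_le_square_iff by blast
  qed
  also have "\<dots> \<le> real m' * ?d\<^sup>2 + real m' * (L * ?d)\<^sup>2"
  proof (intro add_mono)
    show "(\<Sum>i<q. (x i - y i)\<^sup>2) \<le> real m' * ?d\<^sup>2"
    proof (cases "q = 0")
      case False
      have "(\<Sum>i<q. (x i - y i)\<^sup>2) \<le> (\<Sum>i<n. (x i - y i)\<^sup>2)" using q by (intro sum_mono2) auto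
      also have "\<dots> \<le> real m' * ?d\<^sup>2" unfolding d using nm False by (intro mult_right_mono) auto
      finally show ?thesis .
    qed simp
    show "(\<Sum>i=q..<m'. (L * ?d)\<^sup>2) \<le> real m' * (L * ?d)\<^sup>2" by (auto intro: mult_right_mono)
  qed
  also have "\<dots> \<le> real m' * ((1 + L) * ?d)\<^sup>2"
  proof -
    have "?d\<^sup>2 + (L * ?d)\<^sup>2 \<le> ((1 + L) * ?d)\<^sup>2"
      using nm by (simp add: power2_eq_square algebra_simps ndist_nonneg)
    then have "real m' * (?d\<^sup>2 + (L * ?d)\<^sup>2) \<le> real m' * ((1 + L) * ?d)\<^sup>2" by (intro mult_left_mono) auto
    then show ?thesis by (simp add: distrib_left)
  qed
  finally have "L2_set (\<lambda>i. u i - v i) {..<m'} \<le> sqrt (real m' * ((1 + L) * ?d)\<^sup>2)"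
    by (simp add: L2_set_def)
  also have "\<dots> = sqrt (real m') * ((1 + L) * ?d)"
    using nm by (simp add: real_sqrt_mult ndist_nonneg)
  finally have "L2_set (\<lambda>i. u i - v i) {..<m'} / sqrt (real m') \<le> (1 + L) * ?d"
    using nm by (simp add: field_simps)
  then show ?thesis unfolding True pnorm_2 by (simp add: ndist_def)
next
  case False
  then have pinf: "p = \<infinity>" using p by simp
  let ?D = "pnorm \<infinity> n (\<lambda>i. x i - y i)"
  have D: "ndist n x y \<le> ?D" using ndist_le_pnorm[of \<infinity> n x y] nm by simp
  then have D0: "0 \<le> ?D" using ndist_nonneg order_trans by blast
  show ?thesis unfolding pinf
  proof (rule pnorm_infty_le[OF nm(3)])
    fix i assume i: "i < m'"
    show "\<bar>u i - v i\<bar> \<le> (1 + L) * ?D"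
    proof (cases "i < q")
      case True
      then have "\<bar>u i - v i\<bar> \<le> ?D" using copy[OF True] pnorm_infty_ge[of i n "\<lambda>i. x i - y i"] q by simp
      also have "\<dots> \<le> (1 + L) * ?D" using nm D0 by (simp add: distrib_right)
      finally show ?thesis .
    next
      case False
      then have "\<bar>u i - v i\<bar> \<le> L * ndist n x y" using lip i by simp
      also have "\<dots> \<le> L * ?D" using D nm by (intro mult_left_mono) auto
      also have "\<dots> \<le> (1 + L) * ?D" using D0 by (intro mult_right_mono) auto
      finally show ?thesis .
    qed
  qed
qed

text \<open>A block contains at least 1/16 of all coordinates, so changing the normalization costs
  at most the square root of 16.\<close>

lemma ndist_block:
  assumes "b + k \<le> m" "m \<le> 16 * k" "0 < k"
  shows "ndist k (block k b x) (block k b y) \<le> 4 * ndist m x y"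
proof -
  have "(\<Sum>j<k. (x (b + j) - y (b + j))\<^sup>2) = (\<Sum>i\<in>(\<lambda>j. b + j) ` {..<k}. (x i - y i)\<^sup>2)"
    by (subst sum.reindex) auto
  also have "\<dots> \<le> (\<Sum>i<m. (x i - y i)\<^sup>2)" using assms by (intro sum_mono2) auto
  finally have "L2_set (\<lambda>j. x (b + j) - y (b + j)) {..<k} \<le> L2_set (\<lambda>i. x i - y i) {..<m}"
    by (simp add: L2_set_def)
  moreover have "sqrt (real m) \<le> 4 * sqrt (real k)"
  proof -
    have "real m \<le> 16 * real k" using assms(2) by linarith
    then have "sqrt (real m) \<le> sqrt (16 * real k)" by simp
    then show ?thesis by (simp add: real_sqrt_mult)
  qed
  moreover have "0 < m" using assms by linarith
  ultimately have "L2_set (\<lambda>j. x (b + j) - y (b + j)) {..<k} * sqrt (real m)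
      \<le> L2_set (\<lambda>i. x i - y i) {..<m} * (4 * sqrt (real k))"
    by (intro mult_mono) auto
  then show ?thesis using assms \<open>0 < m\<close> by (simp add: ndist_def block_def field_simps)
qed

lemma abs_mean_le:
  assumes "0 < k"
  shows "\<bar>mean k x - mean k y\<bar> \<le> ndist k x y"
proof -
  have "\<bar>\<Sum>i<k. x i - y i\<bar> \<le> (\<Sum>i<k. \<bar>1\<bar> * \<bar>x i - y i\<bar>)" by simp
  also have "\<dots> \<le> L2_set (\<lambda>_. 1) {..<k} * L2_set (\<lambda>i. x i - y i) {..<k}" by (rule L2_set_mult_ineq)
  finally have "\<bar>\<Sum>i<k. x i - y i\<bar> \<le> sqrt (real k) * L2_set (\<lambda>i. x i - y i) {..<k}"
    by (simp add: L2_set_def)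
  then have "\<bar>\<Sum>i<k. x i - y i\<bar> / real k \<le> sqrt (real k) * L2_set (\<lambda>i. x i - y i) {..<k} / real k"
    by (intro divide_right_mono) auto
  also have "\<dots> = ndist k x y"
    using assms by (simp add: ndist_def field_simps flip: power2_eq_square)
  finally have "\<bar>\<Sum>i<k. x i - y i\<bar> / real k \<le> ndist k x y" .
  moreover have "mean k x - mean k y = (\<Sum>i<k. x i - y i) / real k"
    by (simp add: mean_def sum_subtractf diff_divide_distrib)
  ultimately show ?thesis by simp
qed

lemma mean_const: "0 < k \<Longrightarrow> (\<And>i. i < k \<Longrightarrow> x i = u) \<Longrightarrow> mean k x = u"
  by (simp add: mean_def)

lemma mean_bounds:
  assumes "0 < k" "\<And>i. i < k \<Longrightarrow> 0 \<le> x i" "\<And>i. i < k \<Longrightarrow> x i \<le> 1"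
  shows "0 \<le> mean k x" "mean k x \<le> 1"
proof -
  show "0 \<le> mean k x" using assms by (auto simp: mean_def intro!: sum_nonneg divide_nonneg_nonneg)
  have "(\<Sum>i<k. x i) \<le> (\<Sum>i<k. 1)" using assms by (intro sum_mono) auto
  then show "mean k x \<le> 1" using assms(1) by (simp add: mean_def)
qed

text \<open>Lipschitz constant and supremum bound are carried together because the product rule
  needs both. They do not depend on the dimension.\<close>

definition lipb :: "nat \<Rightarrow> real \<Rightarrow> real \<Rightarrow> (point \<Rightarrow> real) \<Rightarrow> bool" where
  "lipb m L B f \<longleftrightarrow> 0 \<le> L \<and> (\<forall>x\<in>cube m. \<bar>f x\<bar> \<le> B) \<and>
     (\<forall>x\<in>cube m. \<forall>y\<in>cube m. \<bar>f x - f y\<bar> \<le> L * ndist m x y)"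

lemma lipbI:
  assumes "0 \<le> L" "\<And>x. x \<in> cube m \<Longrightarrow> \<bar>f x\<bar> \<le> B"
    "\<And>x y. x \<in> cube m \<Longrightarrow> y \<in> cube m \<Longrightarrow> \<bar>f x - f y\<bar> \<le> L * ndist m x y"
  shows "lipb m L B f"
  using assms unfolding lipb_def by blast

lemma lipbD:
  assumes "lipb m L B f" "x \<in> cube m"
  shows "0 \<le> L" "0 \<le> B" "\<bar>f x\<bar> \<le> B" "y \<in> cube m \<Longrightarrow> \<bar>f x - f y\<bar> \<le> L * ndist m x y"
  using assms unfolding lipb_def by (auto intro: order_trans[OF abs_ge_zero])

lemma cube_nonempty: "(\<lambda>i\<in>{..<m}. 0) \<in> cube m"
  by (auto simp: cube_def)

lemma lipb_mono: "lipb m L B f \<Longrightarrow> L \<le> L' \<Longrightarrow> B \<le> B' \<Longrightarrow> lipb m L' B' f"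
  unfolding lipb_def using ndist_nonneg[of m]
  by (meson mult_right_mono order_trans)

lemma lipb_const: "lipb m 0 \<bar>a\<bar> (\<lambda>_. a)"
  by (simp add: lipb_def)

lemma lipb_add:
  assumes "lipb m L B f" "lipb m L' B' g"
  shows "lipb m (L + L') (B + B') (\<lambda>x. f x + g x)"
proof (rule lipbI)
  show "0 \<le> L + L'" using assms by (simp add: lipb_def)
  fix x assume x: "x \<in> cube m"
  show "\<bar>f x + g x\<bar> \<le> B + B'" using lipbD(3)[OF assms(1) x] lipbD(3)[OF assms(2) x] by linarith
  fix y assume y: "y \<in> cube m"
  show "\<bar>f x + g x - (f y + g y)\<bar> \<le> (L + L') * ndist m x y"
    using lipbD(4)[OF assms(1) x y] lipbD(4)[OF assms(2) x y] by (simp add: distrib_right)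
qed

lemma lipb_mult:
  assumes "lipb m L B f" "lipb m L' B' g"
  shows "lipb m (L * B' + B * L') (B * B') (\<lambda>x. f x * g x)"
proof (rule lipbI)
  show "0 \<le> L * B' + B * L'"
    using lipbD(1,2)[OF assms(1) cube_nonempty] lipbD(1,2)[OF assms(2) cube_nonempty] by simp
  fix x assume x: "x \<in> cube m"
  note xf = lipbD[OF assms(1) x] and xg = lipbD[OF assms(2) x]
  show "\<bar>f x * g x\<bar> \<le> B * B'" unfolding abs_mult using xf xg by (intro mult_mono) auto
  fix y assume y: "y \<in> cube m"
  note yf = lipbD[OF assms(1) y] and yg = lipbD[OF assms(2) y]
  have "f x * g x - f y * g y = (f x - f y) * g x + f y * (g x - g y)" by (simp add: algebra_simps)
  then have "\<bar>f x * g x - f y * g y\<bar> \<le> \<bar>f x - f y\<bar> * \<bar>g x\<bar> + \<bar>f y\<bar> * \<bar>g x - g y\<bar>"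
    by (metis abs_mult abs_triangle_ineq)
  also have "\<dots> \<le> L * ndist m x y * B' + B * (L' * ndist m x y)"
    using xf xg yf yg y ndist_nonneg[of m x y] by (intro add_mono mult_mono) auto
  finally show "\<bar>f x * g x - f y * g y\<bar> \<le> (L * B' + B * L') * ndist m x y" by (simp add: algebra_simps)
qed

lemma lipb_diff:
  assumes "lipb m L B f" "lipb m L' B' g"
  shows "lipb m (L + L') (B + B') (\<lambda>x. f x - g x)"
  using lipb_add[OF assms(1) lipb_mult[OF lipb_const[of m "-1"] assms(2)]] by simp

lemma lipb_uminus: "lipb m L B f \<Longrightarrow> lipb m L B (\<lambda>x. - f x)"
  using lipb_diff[OF lipb_const[of m 0]] by simp

lemma lipb_divide: "lipb m L B f \<Longrightarrow> lipb m (L * \<bar>1 / a\<bar>) (B * \<bar>1 / a\<bar>) (\<lambda>x. f x / a)"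
  using lipb_mult[OF _ lipb_const[of m "1 / a"]] by fastforce

lemma lipb_max:
  assumes "lipb m L B f" "lipb m L' B' g"
  shows "lipb m (L + L') (B + B') (\<lambda>x. max (f x) (g x))"
proof (rule lipbI)
  show "0 \<le> L + L'" using assms by (simp add: lipb_def)
  fix x assume x: "x \<in> cube m"
  note xf = lipbD[OF assms(1) x] and xg = lipbD[OF assms(2) x]
  show "\<bar>max (f x) (g x)\<bar> \<le> B + B'" using xf(2,3) xg(2,3) by linarith
  fix y assume y: "y \<in> cube m"
  have "\<bar>max (f x) (g x) - max (f y) (g y)\<bar> \<le> \<bar>f x - f y\<bar> + \<bar>g x - g y\<bar>" by linarith
  then show "\<bar>max (f x) (g x) - max (f y) (g y)\<bar> \<le> (L + L') * ndist m x y"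
    using xf(4)[OF y] xg(4)[OF y] by (simp add: distrib_right)
qed

lemma lipb_min:
  assumes "lipb m L B f" "lipb m L' B' g"
  shows "lipb m (L + L') (B + B') (\<lambda>x. min (f x) (g x))"
proof -
  have "min (f x) (g x) = - max (- f x) (- g x)" for x by (simp add: min_def max_def)
  then show ?thesis using lipb_uminus[OF lipb_max[OF assms[THEN lipb_uminus]]] by simp
qed

lemma lipb_clip:
  assumes "lipb m L B f"
  shows "lipb m L 1 (\<lambda>x. clip (f x))"
proof (rule lipbI)
  show "0 \<le> L" using assms by (simp add: lipb_def)
  fix x assume x: "x \<in> cube m"
  show "\<bar>clip (f x)\<bar> \<le> 1" by (rule clip_bounds)
  fix y assume y: "y \<in> cube m"
  have "\<bar>clip (f x) - clip (f y)\<bar> \<le> \<bar>f x - f y\<bar>" unfolding clip_def by linarith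
  then show "\<bar>clip (f x) - clip (f y)\<bar> \<le> L * ndist m x y"
    using lipbD(4)[OF assms x y] by linarith
qed

lemma lipb_power2: "lipb m L B f \<Longrightarrow> lipb m (L * B + B * L) (B * B) (\<lambda>x. (f x)\<^sup>2)"
  using lipb_mult by (fastforce simp: power2_eq_square)

lemmas lipb_intros = lipb_const lipb_add lipb_mult lipb_diff lipb_uminus lipb_divide lipb_max lipb_min
  lipb_clip lipb_power2

section \<open>The two players' maps\<close>

text \<open>One code names the \<open>M\<close> vertices and the \<open>K\<close> possible shares of
  the first player. Five blocks of length \<open>k\<close> hold \<open>P1\<close>,
  \<open>P2\<close>, \<open>C\<close>, \<open>S\<close> and \<open>y\<close>; a scalar is spread
  over a whole block, since a single coordinate would hardly count in the normalized 2-norm.\<close>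

locale encoding =
  fixes n k M K :: nat and c :: "nat \<Rightarrow> point" and s :: nat
  assumes dims: "0 < k" "5 * k \<le> n" "2 * n + 1 \<le> 16 * k"
    and MK: "M \<le> K" "s < M"
    and binary: "\<And>a j. c a j \<in> {0, 1}"
    and code_sep: "\<And>a b. a < K \<Longrightarrow> b < K \<Longrightarrow> a \<noteq> b \<Longrightarrow> 1 / 4 \<le> ndist k (c a) (c b)"
begin

lemma c_bounds: "0 \<le> c a j" "c a j \<le> 1" "\<bar>c a j\<bar> \<le> 1"
  using binary[of a j] by auto

definition share :: "(nat \<Rightarrow> nat) \<Rightarrow> point \<Rightarrow> point" where
  "share X P j = code_sum (1 / 32) k M c P (\<lambda>a. c (X a) j)"

definition alice_coord :: "(nat \<Rightarrow> nat) \<Rightarrow> point \<Rightarrow> point" where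
  "alice_coord X x i =
    (if i < n then x i
     else if i < n + k then share X (block k 0 x) (i - n)
     else if i < n + 2 * k then share X (block k k x) (i - n - k)
     else 0)"

text \<open>The input is passed on unchanged, followed by the two shares and by zeros. The summand 1
  keeps the public dimension positive for \<open>n = 0\<close>.\<close>

definition alice :: "(nat \<Rightarrow> nat) \<Rightarrow> point \<Rightarrow> point" where
  "alice X = (\<lambda>x\<in>cube n. restrict (alice_coord X x) {..<2 * n + 1})"

text \<open>The second player does not know \<open>X\<close>: he decodes the vertex from
  \<open>P\<close>, the share from \<open>\<alpha>\<close>, and then consults his own table
  \<open>h\<close>.\<close>

definition lookup :: "(nat \<Rightarrow> nat \<Rightarrow> nat) \<Rightarrow> point \<Rightarrow> point \<Rightarrow> point" where
  "lookup h P \<alpha> j = code_sum (1 / 64) k M c P (\<lambda>a. code_sum (1 / 64) k K c \<alpha> (\<lambda>x. c (h a x) j))"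

abbreviation coordC :: "point \<Rightarrow> real" where "coordC z \<equiv> 4 * mean k (block k (2 * k) z) - 2"
abbreviation coordS :: "point \<Rightarrow> real" where "coordS z \<equiv> 4 * mean k (block k (3 * k) z) - 2"
abbreviation coordy :: "point \<Rightarrow> real" where "coordy z \<equiv> mean k (block k (4 * k) z)"
abbreviation \<kappa> :: "point \<Rightarrow> real" where "\<kappa> z \<equiv> clip (1 / 2 + coordC z)"
abbreviation \<zeta> :: "point \<Rightarrow> real" where "\<zeta> z \<equiv> clip (1 / 2 + coordS z)"
abbreviation decode :: "point \<Rightarrow> point" where
  "decode P j \<equiv> code_sum (1 / 64) k M c P (\<lambda>a. c a j)"
abbreviation vicinity :: "point \<Rightarrow> real" where
  "vicinity P \<equiv> code_sum (1 / 128) k M c P (\<lambda>_. 1)"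
abbreviation start_hat :: "point \<Rightarrow> real" where
  "start_hat z \<equiv> hat (1 / 64) k (c s) (block k k z)"

definition stepP1 :: "(nat \<Rightarrow> nat \<Rightarrow> nat) \<Rightarrow> nat \<Rightarrow> point \<Rightarrow> real" where
  "stepP1 hi j z = next_P (coordy z) (\<kappa> z) (\<zeta> z) (lookup hi (block k k z) (block k (n + k) z) j)
     (decode (block k 0 z) j) (decode (block k k z) j) (c s j)"

definition stepP2 :: "(nat \<Rightarrow> nat \<Rightarrow> nat) \<Rightarrow> nat \<Rightarrow> point \<Rightarrow> real" where
  "stepP2 ho j z = next_P (coordy z) (1 - \<kappa> z) (\<zeta> z) (lookup ho (block k 0 z) (block k n z) j)
     (decode (block k k z) j) (decode (block k 0 z) j) (c s j)"

definition stepC :: "point \<Rightarrow> real" where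
  "stepC z = (next_C (coordy z) (start_hat z) (coordC z) (coordS z) + 2) / 4"

definition stepS :: "point \<Rightarrow> real" where
  "stepS z = (next_S (coordy z) (start_hat z) (coordC z) (coordS z) + 2) / 4"

definition stepy :: "point \<Rightarrow> real" where
  "stepy z = next_y (tube (vicinity (block k 0 z)) (vicinity (block k k z)) (start_hat z) (coordC z) (coordS z)) (coordy z)"

definition bob_coord :: "(nat \<Rightarrow> nat \<Rightarrow> nat) \<Rightarrow> (nat \<Rightarrow> nat \<Rightarrow> nat) \<Rightarrow> point \<Rightarrow> point" where
  "bob_coord ho hi z i =
    (if i < k then stepP1 hi i z
     else if i < 2 * k then stepP2 ho (i - k) z
     else if i < 3 * k then stepC z
     else if i < 4 * k then stepS z
     else if i < 5 * k then stepy z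
     else 0)"

definition bob :: "(nat \<Rightarrow> nat \<Rightarrow> nat) \<Rightarrow> (nat \<Rightarrow> nat \<Rightarrow> nat) \<Rightarrow> point \<Rightarrow> point" where
  "bob ho hi = (\<lambda>z\<in>cube (2 * n + 1). restrict (bob_coord ho hi z) {..<n})"

section \<open>Lipschitz constants of the players' maps\<close>

lemma code_active:
  fixes P :: point
  assumes "0 < Q" "Q \<le> K" "0 < r" "r \<le> 1 / 32"
  obtains a where "a < Q" "\<And>b. b < Q \<Longrightarrow> b \<noteq> a \<Longrightarrow> hat r k (c b) P = 0"
proof (cases "\<exists>a<Q. ndist k P (c a) < 1 / 16")
  case True
  then obtain a where a: "a < Q" "ndist k P (c a) < 1 / 16" by blast
  have "hat r k (c b) P = 0" if b: "b < Q" "b \<noteq> a" for b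
  proof (rule hat_eq_0[OF _ assms(3)])
    have "1 / 4 \<le> ndist k (c a) (c b)" using code_sep a b assms by auto
    also have "\<dots> \<le> ndist k (c a) P + ndist k P (c b)" by (rule ndist_triangle)
    finally show "2 * r \<le> ndist k P (c b)" using a(2) assms(4) ndist_sym[of k P "c a"] by linarith
  qed
  then show ?thesis using a(1) that by blast
next
  case False
  have "hat r k (c b) P = 0" if "b < Q" for b
  proof (rule hat_eq_0[OF _ assms(3)])
    have "1 / 16 \<le> ndist k P (c b)" using False that by (meson not_less)
    then show "2 * r \<le> ndist k P (c b)" using assms(4) by linarith
  qed
  then show ?thesis using that assms(1) by blast
qed

lemma code_sum_bounds:
  assumes "0 < Q" "Q \<le> K" "0 < r" "r \<le> 1 / 32" "\<And>a. 0 \<le> w a" "\<And>a. w a \<le> 1"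
  shows "0 \<le> code_sum r k Q c P w" "code_sum r k Q c P w \<le> 1"
proof -
  obtain a where a: "a < Q" "\<And>b. b < Q \<Longrightarrow> b \<noteq> a \<Longrightarrow> hat r k (c b) P = 0"
    using code_active[OF assms(1-4)] by blast
  have eq: "code_sum r k Q c P w = hat r k (c a) P * w a" using a by (rule code_sum_single)
  show "0 \<le> code_sum r k Q c P w" unfolding eq using hat_bounds assms by simp
  have "hat r k (c a) P * w a \<le> 1 * 1" using hat_bounds assms by (intro mult_mono) auto
  then show "code_sum r k Q c P w \<le> 1" unfolding eq by simp
qed

lemma lipb_hat:
  assumes b: "b + k \<le> m" "m \<le> 16 * k" and r: "0 < r"
  shows "lipb m (4 / r) 1 (\<lambda>z. hat r k u (block k b z))"
proof (rule lipbI)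
  show "0 \<le> 4 / r" using r by simp
  fix x show "\<bar>hat r k u (block k b x)\<bar> \<le> 1" using hat_bounds[of r k u] by simp
  fix y
  have "\<bar>ndist k (block k b x) u - ndist k (block k b y) u\<bar> \<le> ndist k (block k b x) (block k b y)"
    using ndist_triangle[of k "block k b x" u "block k b y"] ndist_triangle[of k "block k b y" u "block k b x"]
      ndist_sym[of k "block k b x" "block k b y"] by linarith
  also have "\<dots> \<le> 4 * ndist m x y" using b dims by (intro ndist_block) auto
  finally have *: "\<bar>ndist k (block k b x) u - ndist k (block k b y) u\<bar> \<le> 4 * ndist m x y" .
  have "\<bar>hat r k u (block k b x) - hat r k u (block k b y)\<bar>
      \<le> \<bar>ndist k (block k b x) u / r - ndist k (block k b y) u / r\<bar>"
    unfolding hat_def clip_def by linarith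
  also have "\<dots> = \<bar>ndist k (block k b x) u - ndist k (block k b y) u\<bar> / r"
    using r by (simp add: abs_divide flip: diff_divide_distrib)
  also have "\<dots> \<le> 4 * ndist m x y / r" using * r by (intro divide_right_mono) auto
  finally show "\<bar>hat r k u (block k b x) - hat r k u (block k b y)\<bar> \<le> 4 / r * ndist m x y" by simp
qed

text \<open>At each point at most one codeword is active, so the constant does not grow with the
  number of codewords. If different ones are active at \<open>x\<close> and \<open>y\<close>, each
  weight vanishes at the other point and is thus small itself, which accounts for twice
  \<open>4 / r\<close>.\<close>

lemma lipb_code_sum:
  assumes b: "b + k \<le> m" "m \<le> 16 * k" and r: "0 < r" "r \<le> 1 / 32" and Q: "0 < Q" "Q \<le> K"
    and T: "\<And>a. lipb m L 1 (T a)"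
  shows "lipb m (8 / r + L) 1 (\<lambda>z. code_sum r k Q c (block k b z) (\<lambda>a. T a z))"
proof (rule lipbI)
  have L: "0 \<le> L" using T unfolding lipb_def by blast
  then show "0 \<le> 8 / r + L" using r by simp
  let ?h = "\<lambda>a z. hat r k (c a) (block k b z)"
  have ex: "\<exists>a<Q. (\<forall>a'<Q. a' \<noteq> a \<longrightarrow> ?h a' z = 0) \<and>
      code_sum r k Q c (block k b z) (\<lambda>a. T a z) = ?h a z * T a z" for z
  proof -
    obtain a where "a < Q" "\<And>a'. a' < Q \<Longrightarrow> a' \<noteq> a \<Longrightarrow> ?h a' z = 0"
      using code_active[OF Q r, of "block k b z"] by blast
    then show ?thesis using code_sum_single[of a Q r k c "block k b z" "\<lambda>a. T a z"] by blast
  qed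
  have h1: "\<bar>?h a z\<bar> \<le> 1" for a z using hat_bounds[of r k] by simp
  have hd: "\<bar>?h a x - ?h a y\<bar> \<le> 4 / r * ndist m x y" if "x \<in> cube m" "y \<in> cube m" for a x y
    using lipbD(4)[OF lipb_hat[OF b r(1)]] that by blast
  fix x assume x: "x \<in> cube m"
  obtain a where a: "a < Q" "\<forall>a'<Q. a' \<noteq> a \<longrightarrow> ?h a' x = 0"
    "code_sum r k Q c (block k b x) (\<lambda>a. T a x) = ?h a x * T a x" using ex by blast
  have Tx: "\<bar>T a x\<bar> \<le> 1" for a using lipbD(3)[OF T x] .
  show "\<bar>code_sum r k Q c (block k b x) (\<lambda>a. T a x)\<bar> \<le> 1"
    unfolding a(3) abs_mult using h1[of a x] Tx[of a] mult_mono[of "\<bar>?h a x\<bar>" 1 "\<bar>T a x\<bar>" 1] by simp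
  fix y assume y: "y \<in> cube m"
  have Ty: "\<bar>T a y\<bar> \<le> 1" for a using lipbD(3)[OF T y] .
  obtain a2 where a2: "a2 < Q" "\<forall>a'<Q. a' \<noteq> a2 \<longrightarrow> ?h a' y = 0"
    "code_sum r k Q c (block k b y) (\<lambda>a. T a y) = ?h a2 y * T a2 y" using ex by blast
  have d0: "0 \<le> 4 / r * ndist m x y" using r ndist_nonneg by simp
  show "\<bar>code_sum r k Q c (block k b x) (\<lambda>a. T a x) - code_sum r k Q c (block k b y) (\<lambda>a. T a y)\<bar>
      \<le> (8 / r + L) * ndist m x y"
  proof (cases "a2 = a")
    case True
    have "?h a x * T a x - ?h a y * T a y = (?h a x - ?h a y) * T a x + ?h a y * (T a x - T a y)"
      by (simp add: algebra_simps)
    then have "\<bar>?h a x * T a x - ?h a y * T a y\<bar> \<le> \<bar>?h a x - ?h a y\<bar> * \<bar>T a x\<bar> + \<bar>?h a y\<bar> * \<bar>T a x - T a y\<bar>"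
      by (metis abs_mult abs_triangle_ineq)
    also have "\<dots> \<le> (4 / r * ndist m x y) * 1 + 1 * (L * ndist m x y)"
      using hd[OF x y] Tx h1 lipbD(4)[OF T x y] d0 by (intro add_mono mult_mono) auto
    also have "\<dots> \<le> 2 * (4 / r * ndist m x y) + L * ndist m x y" using d0 by linarith
    also have "\<dots> = (8 / r + L) * ndist m x y" by (simp add: distrib_right)
    finally show ?thesis unfolding a(3) a2(3) True .
  next
    case False
    have "?h a y = 0" "?h a2 x = 0" using a a2 False by auto
    then have "\<bar>?h a x\<bar> \<le> 4 / r * ndist m x y" "\<bar>?h a2 y\<bar> \<le> 4 / r * ndist m x y"
      using hd[OF x y, of a] hd[OF x y, of a2] by simp_all
    then have "\<bar>?h a x\<bar> * \<bar>T a x\<bar> \<le> (4 / r * ndist m x y) * 1" "\<bar>?h a2 y\<bar> * \<bar>T a2 y\<bar> \<le> (4 / r * ndist m x y) * 1"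
      using Tx Ty d0 by (intro mult_mono; simp)+
    then have "\<bar>?h a x * T a x\<bar> + \<bar>?h a2 y * T a2 y\<bar> \<le> 8 / r * ndist m x y"
      unfolding abs_mult by linarith
    then have "\<bar>?h a x * T a x - ?h a2 y * T a2 y\<bar> \<le> 8 / r * ndist m x y" by linarith
    also have "\<dots> \<le> (8 / r + L) * ndist m x y"
      using L ndist_nonneg by (intro mult_right_mono) auto
    finally show ?thesis unfolding a(3) a2(3) .
  qed
qed

lemma lipb_mean:
  assumes "b + k \<le> m" "m \<le> 16 * k"
  shows "lipb m 4 1 (\<lambda>z. mean k (block k b z))"
proof (rule lipbI)
  fix x assume x: "x \<in> cube m"
  have "0 \<le> block k b x i \<and> block k b x i \<le> 1" if "i < k" for i
    using x that assms by (auto simp: cube_def block_def PiE_def Pi_def)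
  then show "\<bar>mean k (block k b x)\<bar> \<le> 1" using mean_bounds[OF dims(1), of "block k b x"] by auto
  fix y
  show "\<bar>mean k (block k b x) - mean k (block k b y)\<bar> \<le> 4 * ndist m x y"
    using order_trans[OF abs_mean_le[OF dims(1)] ndist_block[OF assms dims(1)]] .
qed simp

lemma pos: "0 < M" "0 < K" "0 < n"
  using MK dims by auto

lemma lipb_c: "lipb m 0 1 (\<lambda>_. c a j)"
  using lipb_mono[OF lipb_const, of 0 "c a j" 1] c_bounds by simp

lemma lipb_share:
  assumes "b + k \<le> m" "m \<le> 16 * k"
  shows "lipb m 256 1 (\<lambda>z. share X (block k b z) j)"
proof -
  have "lipb m (8 / (1 / 32) + 0) 1 (\<lambda>z. code_sum (1 / 32) k M c (block k b z) (\<lambda>a. c (X a) j))"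
    using assms pos MK by (intro lipb_code_sum lipb_c) auto
  then show ?thesis by (simp add: share_def)
qed

lemma lipb_dec:
  assumes "b + k \<le> m" "m \<le> 16 * k"
  shows "lipb m 512 1 (\<lambda>z. decode (block k b z) j)"
proof -
  have "lipb m (8 / (1 / 64) + 0) 1 (\<lambda>z. decode (block k b z) j)"
    using assms pos MK by (intro lipb_code_sum lipb_c) auto
  then show ?thesis by simp
qed

lemma lipb_near:
  assumes "b + k \<le> m" "m \<le> 16 * k"
  shows "lipb m 1024 1 (\<lambda>z. vicinity (block k b z))"
proof -
  have "lipb m 0 1 (\<lambda>_. 1)" using lipb_const[of m 1] by simp
  then have "lipb m (8 / (1 / 128) + 0) 1 (\<lambda>z. vicinity (block k b z))"
    using assms pos MK by (intro lipb_code_sum) auto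
  then show ?thesis by simp
qed

lemma lipb_lookup:
  assumes "b + k \<le> m" "b' + k \<le> m" "m \<le> 16 * k"
  shows "lipb m 1024 1 (\<lambda>z. lookup h (block k b z) (block k b' z) j)"
proof -
  have "lipb m (8 / (1 / 64) + (8 / (1 / 64) + 0)) 1 (\<lambda>z. code_sum (1 / 64) k M c (block k b z)
      (\<lambda>a. code_sum (1 / 64) k K c (block k b' z) (\<lambda>x. c (h a x) j)))"
    using assms pos MK by (intro lipb_code_sum lipb_c) auto
  then show ?thesis by (simp add: lookup_def)
qed

abbreviation "m \<equiv> 2 * n + 1"

lemma offsets: "0 + k \<le> m" "k + k \<le> m" "2 * k + k \<le> m" "3 * k + k \<le> m" "4 * k + k \<le> m"
  "n + k \<le> m" "n + k + k \<le> m" "m \<le> 16 * k"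
  using dims by auto

lemma lipb_ms: "lipb m 256 1 start_hat"
  using lipb_hat[OF offsets(2,8), of "1 / 64"] by simp

lemmas lipb_atoms = lipb_ms lipb_mean[OF offsets(3,8)] lipb_mean[OF offsets(4,8)] lipb_mean[OF offsets(5,8)]
  lipb_dec[OF offsets(1,8)] lipb_dec[OF offsets(2,8)] lipb_near[OF offsets(1,8)] lipb_near[OF offsets(2,8)]
  lipb_lookup[OF offsets(1,6,8)] lipb_lookup[OF offsets(2,7,8)] lipb_c

lemma lipb_steps:
  "lipb m (10 ^ 6) (10 ^ 6) (stepP1 hi j)" "lipb m (10 ^ 6) (10 ^ 6) (stepP2 ho j)"
  "lipb m (10 ^ 6) (10 ^ 6) stepC" "lipb m (10 ^ 6) (10 ^ 6) stepS" "lipb m (10 ^ 6) (10 ^ 6) stepy"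
proof -
  show "lipb m (10 ^ 6) (10 ^ 6) (stepP1 hi j)"
    unfolding stepP1_def[abs_def] next_P_def fadeP_def
    \<comment> \<open>The rules assemble schematic constants along the formula, and
      \<open>simp_all\<close> finally compares them with the claimed number.\<close>
    by (rule lipb_mono, (rule lipb_atoms lipb_intros)+, simp_all)
  show "lipb m (10 ^ 6) (10 ^ 6) (stepP2 ho j)"
    unfolding stepP2_def[abs_def] next_P_def fadeP_def
    by (rule lipb_mono, (rule lipb_atoms lipb_intros)+, simp_all)
  show "lipb m (10 ^ 6) (10 ^ 6) stepC"
    unfolding stepC_def[abs_def] next_C_def fadeT_def field_C_def speed_def
    by (rule lipb_mono, (rule lipb_atoms lipb_intros)+, simp_all)
  show "lipb m (10 ^ 6) (10 ^ 6) stepS"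
    unfolding stepS_def[abs_def] next_S_def fadeT_def field_S_def speed_def
    by (rule lipb_mono, (rule lipb_atoms lipb_intros)+, simp_all)
  show "lipb m (10 ^ 6) (10 ^ 6) stepy"
    unfolding stepy_def[abs_def] next_y_def drift_def tube_def
    by (rule lipb_mono, (rule lipb_atoms lipb_intros)+, simp_all)
qed

end

lemma cube_mem: "x \<in> cube n \<Longrightarrow> i < n \<Longrightarrow> x i \<in> {0..1}"
  unfolding cube_def by (erule PiE_mem) simp

lemma if_mem: "(b \<Longrightarrow> x \<in> A) \<Longrightarrow> (\<not> b \<Longrightarrow> y \<in> A) \<Longrightarrow> (if b then x else y) \<in> A"
  by simp

section \<open>The maps stay in the cube\<close>

context encoding
begin

lemma next_P_bounds:
  assumes "0 \<le> w" "w \<le> 1" "0 \<le> z" "z \<le> 1" "0 \<le> p" "p \<le> 1" "0 \<le> d" "d \<le> 1" "0 \<le> e" "e \<le> 1" "0 \<le> b" "b \<le> 1"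
  shows "0 \<le> next_P y w z p d e b" "next_P y w z p d e b \<le> 1"
proof -
  have mix: "0 \<le> l * u + (1 - l) * v \<and> l * u + (1 - l) * v \<le> 1"
    if "0 \<le> l" "l \<le> 1" "0 \<le> u" "u \<le> 1" "0 \<le> v" "v \<le> 1" for l u v :: real
    using that convex_bound_le[of u 1 v l "1 - l"] by auto
  have "0 \<le> fadeP y" "fadeP y \<le> 1" by (auto simp: fadeP_def clip_bounds)
  then show "0 \<le> next_P y w z p d e b" "next_P y w z p d e b \<le> 1"
    unfolding next_P_def using mix[of "fadeP y" "w * d + (1 - w) * (z * p + (1 - z) * e)" b]
      mix[of w d "z * p + (1 - z) * e"] mix[of z p e] assms by (simp_all add: add.commute)
qed

lemma dec_bounds: "0 \<le> decode P j" "decode P j \<le> 1"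
  using code_sum_bounds[OF pos(1) MK(1), of "1 / 64" "\<lambda>a. c a j"] c_bounds by auto

lemma share_bounds: "0 \<le> share X P j" "share X P j \<le> 1"
  using code_sum_bounds[OF pos(1) MK(1), of "1 / 32" "\<lambda>a. c (X a) j"] c_bounds by (auto simp: share_def)

lemma lookup_bounds: "0 \<le> lookup h P Q j" "lookup h P Q j \<le> 1"
proof -
  have *: "0 \<le> code_sum (1 / 64) k K c Q (\<lambda>x. c (h a x) j)" "code_sum (1 / 64) k K c Q (\<lambda>x. c (h a x) j) \<le> 1" for a
    using code_sum_bounds[OF pos(2), of "1 / 64" "\<lambda>x. c (h a x) j"] c_bounds by auto
  show "0 \<le> lookup h P Q j" "lookup h P Q j \<le> 1"
    unfolding lookup_def by (rule code_sum_bounds; use pos MK * in auto)+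
qed

lemma block_bounds:
  assumes "z \<in> cube q" "b + k \<le> q" "j < k"
  shows "0 \<le> block k b z j" "block k b z j \<le> 1"
  using assms by (auto simp: cube_def block_def PiE_def Pi_def)

lemma coord_bounds:
  assumes "z \<in> cube q" "b + k \<le> q"
  shows "\<bar>4 * mean k (block k b z) - 2\<bar> \<le> 2" "0 \<le> mean k (block k b z)" "mean k (block k b z) \<le> 1"
proof -
  show *: "0 \<le> mean k (block k b z)" "mean k (block k b z) \<le> 1"
    using mean_bounds[OF dims(1), of "block k b z"] block_bounds[OF assms] by auto
  then show "\<bar>4 * mean k (block k b z) - 2\<bar> \<le> 2" by (simp add: abs_le_iff)
qed

lemma step_bounds:
  assumes z: "z \<in> cube m"
  shows "stepP1 hi j z \<in> {0..1}" "stepP2 ho j z \<in> {0..1}" "stepC z \<in> {0..1}" "stepS z \<in> {0..1}" "stepy z \<in> {0..1}"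
proof -
  show "stepP1 hi j z \<in> {0..1}" "stepP2 ho j z \<in> {0..1}"
    unfolding stepP1_def stepP2_def atLeastAtMost_iff
    by (auto intro!: next_P_bounds clip_bounds lookup_bounds dec_bounds c_bounds simp: clip_bounds)
  have "\<bar>next_C (coordy z) (start_hat z) (coordC z) (coordS z)\<bar> \<le> 2" "\<bar>next_S (coordy z) (start_hat z) (coordC z) (coordS z)\<bar> \<le> 2"
    using coord_bounds[OF z] offsets hat_bounds by (auto intro!: next_range)
  then show "stepC z \<in> {0..1}" "stepS z \<in> {0..1}" by (auto simp: stepC_def stepS_def abs_le_iff)
  show "stepy z \<in> {0..1}" by (simp add: stepy_def next_y_def clip_bounds)
qed

lemma alice_maps:
  assumes p: "p \<in> {2, \<infinity>}"
  shows "alice X \<in> lipschitz_maps p n m (1 + 256)"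
  unfolding lipschitz_maps_def
proof (intro CollectI conjI ballI)
  show "alice X \<in> cube n \<rightarrow>\<^sub>E cube m"
  proof (rule PiE_I)
    fix x assume x: "x \<in> cube n"
    have "alice_coord X x i \<in> {0..1}" for i
      unfolding alice_coord_def by (intro if_mem cube_mem[OF x]) (use share_bounds in auto)
    then show "alice X x \<in> cube m" using x by (simp add: cube_def PiE_iff extensional_def alice_def)
  qed (simp add: alice_def)
  fix x y assume x: "x \<in> cube n" and y: "y \<in> cube n"
  have sh: "\<bar>share X (block k b x) j - share X (block k b y) j\<bar> \<le> 256 * ndist n x y" if "b + k \<le> n" for b j
    using lipbD(4)[OF lipb_share[OF that] x y] dims by simp
  show "pnorm p m (\<lambda>i. alice X x i - alice X y i) \<le> (1 + 256) * pnorm p n (\<lambda>i. x i - y i)"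
  proof (rule pnorm_lipschitz_of_coords[OF p, where q = n])
    fix i assume "n \<le> i" "i < m"
    then show "\<bar>alice X x i - alice X y i\<bar> \<le> 256 * ndist n x y"
      using x y sh[of 0] sh[of k] dims ndist_nonneg[of n x y] by (auto simp: alice_def alice_coord_def)
  qed (use x y dims pos in \<open>auto simp: alice_def alice_coord_def\<close>)
qed

lemma bob_maps:
  assumes p: "p \<in> {2, \<infinity>}"
  shows "bob ho hi \<in> lipschitz_maps p m n (1 + 10 ^ 6)"
  unfolding lipschitz_maps_def
proof (intro CollectI conjI ballI)
  show "bob ho hi \<in> cube m \<rightarrow>\<^sub>E cube n"
  proof (rule PiE_I)
    fix z assume z: "z \<in> cube m"
    have "bob_coord ho hi z i \<in> {0..1}" for i
      unfolding bob_coord_def by (intro if_mem step_bounds z) auto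
    then show "bob ho hi z \<in> cube n" using z by (simp add: cube_def PiE_iff extensional_def bob_def)
  qed (simp add: bob_def)
  fix x y assume x: "x \<in> cube m" and y: "y \<in> cube m"
  note L = lipb_steps[THEN lipbD(4), OF x y]
  show "pnorm p n (\<lambda>i. bob ho hi x i - bob ho hi y i) \<le> (1 + 10 ^ 6) * pnorm p m (\<lambda>i. x i - y i)"
  proof (rule pnorm_lipschitz_of_coords[OF p, where q = 0])
    fix i assume "i < n"
    then show "\<bar>bob ho hi x i - bob ho hi y i\<bar> \<le> 10 ^ 6 * ndist m x y"
      using x y L ndist_nonneg[of m x y] by (simp add: bob_def bob_coord_def)
  qed (use pos in auto)
qed

lemma code_sum_cong_P:
  "(\<And>j. j < k \<Longrightarrow> P j = P' j) \<Longrightarrow> code_sum r k Q c P w = code_sum r k Q c P' w"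
  unfolding code_sum_def hat_def using ndist_cong[of k P P'] by simp

text \<open>A positive weight of radius 1/64 places \<open>P\<close> within 1/32 of
  \<open>c a\<close>. There the share, computed with radius 1/32, is exactly the codeword of
  \<open>X a\<close>, so the table is read at the true share.\<close>

lemma lookup_share:
  assumes X: "\<And>a. a < M \<Longrightarrow> X a < K" and \<alpha>: "\<And>j. j < k \<Longrightarrow> \<alpha> j = share X P j"
  shows "lookup h P \<alpha> j = code_sum (1 / 64) k M c P (\<lambda>a. c (h a (X a)) j)"
  unfolding lookup_def
proof -
  have "code_sum (1 / 64) k K c \<alpha> (\<lambda>x. c (h a x) j) = c (h a (X a)) j"
    if a: "a < M" "hat (1 / 64) k (c a) P \<noteq> 0" for a
  proof -
    have d: "ndist k P (c a) < 1 / 32" using a(2) hat_eq_0[of "1 / 64" k P "c a"] by (force simp: not_le[symmetric])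
    have "hat (1 / 32) k (c b) P = 0" if b: "b < M" "b \<noteq> a" for b
    proof (rule hat_eq_0)
      have "1 / 4 \<le> ndist k (c a) (c b)" using code_sep a(1) b MK by auto
      also have "\<dots> \<le> ndist k (c a) P + ndist k P (c b)" by (rule ndist_triangle)
      finally show "2 * (1 / 32) \<le> ndist k P (c b)" using d ndist_sym[of k P "c a"] by linarith
    qed simp
    then have "share X P i = hat (1 / 32) k (c a) P * c (X a) i" for i
      unfolding share_def by (rule code_sum_single[OF a(1)])
    then have share: "share X P i = c (X a) i" for i using d hat_eq_1[of k P "c a" "1 / 32"] by simp
    have Xa: "X a < K" using X a(1) by blast
    have dist: "ndist k \<alpha> u = ndist k (c (X a)) u" for u
      using \<alpha> share by (intro ndist_cong) auto
    have "hat (1 / 64) k (c x) \<alpha> = 0" if "x < K" "x \<noteq> X a" for x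
    proof (rule hat_eq_0)
      show "2 * (1 / 64) \<le> ndist k \<alpha> (c x)"
        unfolding dist using code_sep[OF Xa that(1)] that(2) by (simp add: eq_commute)
    qed simp
    then have "code_sum (1 / 64) k K c \<alpha> (\<lambda>x. c (h a x) j) = hat (1 / 64) k (c (X a)) \<alpha> * c (h a (X a)) j"
      by (rule code_sum_single[OF Xa])
    moreover have "ndist k \<alpha> (c (X a)) = 0" unfolding dist by (simp add: ndist_def L2_set_def)
    then have "hat (1 / 64) k (c (X a)) \<alpha> = 1" by (intro hat_eq_1) auto
    ultimately show ?thesis by simp
  qed
  then show "code_sum (1 / 64) k M c P (\<lambda>a. code_sum (1 / 64) k K c \<alpha> (\<lambda>x. c (h a x) j))
      = code_sum (1 / 64) k M c P (\<lambda>a. c (h a (X a)) j)"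
    unfolding code_sum_def[of "1 / 64" k M] by (intro sum.cong refl) fastforce
qed

theorem approx_fixpoint_near_end:
  assumes line: "line_instance k M c (\<lambda>a. ho a (X a)) (\<lambda>a. hi a (X a)) s t"
    and X: "\<And>a. a < M \<Longrightarrow> X a < K"
    and x: "x \<in> cube n" and residual: "ndist n (bob ho hi (alice X x)) x \<le> 1 / 10 ^ 9"
  shows "ndist k (block k 0 x) (c t) < 1 / 64"
proof (rule ccontr)
  assume far: "\<not> ?thesis"
  interpret line_instance k M c "\<lambda>a. ho a (X a)" "\<lambda>a. hi a (X a)" s t by (rule line)
  define z where "z = alice X x"
  have z: "z \<in> cube m"
    using alice_maps[of 2 X] x unfolding z_def lipschitz_maps_def by auto
  have zx: "z i = x i" if "i < n" for i using x that by (simp add: z_def alice_def alice_coord_def)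
  have zb: "block k b z j = block k b x j" if "b + k \<le> n" "j < k" for b j
    using that zx by (simp add: block_def)
  have res: "ndist k (block k b (bob ho hi z)) (block k b z) \<le> 4 / 10 ^ 9" if b: "b + k \<le> n" for b
  proof -
    have "ndist k (block k b (bob ho hi z)) (block k b z) = ndist k (block k b (bob ho hi z)) (block k b x)"
      using zb[OF b] by (intro ndist_cong) auto
    also have "\<dots> \<le> 4 * ndist n (bob ho hi z) x" using b dims by (intro ndist_block) auto
    finally show ?thesis using residual by (simp add: z_def)
  qed
  have scalar: "\<bar>v - mean k (block k b z)\<bar> \<le> 4 / 10 ^ 9"
    if b: "b + k \<le> n" and v: "\<And>j. j < k \<Longrightarrow> block k b (bob ho hi z) j = v" for v b
    using order_trans[OF abs_mean_le[OF dims(1)] res[OF b]] mean_const[OF dims(1) v] by simp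
  have n5: "0 + k \<le> n" "k + k \<le> n" "2 * k + k \<le> n" "3 * k + k \<le> n" "4 * k + k \<le> n" using dims by auto
  have al1: "block k n z j = share X (block k 0 z) j" if "j < k" for j
  proof -
    have "share X (block k 0 x) j = share X (block k 0 z) j"
      unfolding share_def using zb[OF n5(1)] by (intro code_sum_cong_P) auto
    then show ?thesis using x that dims by (simp add: z_def alice_def alice_coord_def block_def)
  qed
  have al2: "block k (n + k) z j = share X (block k k z) j" if "j < k" for j
  proof -
    have "share X (block k k x) j = share X (block k k z) j"
      unfolding share_def using zb[OF n5(2)] by (intro code_sum_cong_P) auto
    then show ?thesis using x that dims by (simp add: z_def alice_def alice_coord_def block_def)
  qed
  have look1: "lookup h (block k 0 z) (block k n z) j
      = code_sum (1 / 64) k M c (block k 0 z) (\<lambda>a. c (h a (X a)) j)" for h j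
    by (rule lookup_share) (use X al1 in auto)
  have look2: "lookup h (block k k z) (block k (n + k) z) j
      = code_sum (1 / 64) k M c (block k k z) (\<lambda>a. c (h a (X a)) j)" for h j
    by (rule lookup_share) (use X al2 in auto)
  have bob: "block k 0 (bob ho hi z) j = stepP1 hi j z" "block k k (bob ho hi z) j = stepP2 ho j z"
    "block k (2 * k) (bob ho hi z) j = stepC z" "block k (3 * k) (bob ho hi z) j = stepS z"
    "block k (4 * k) (bob ho hi z) j = stepy z" if "j < k" for j
    using that z dims by (simp_all add: bob_def bob_coord_def block_def)
  \<comment> \<open>Restriction to a block costs a factor 4, and so does the scaling of the phase
    coordinates from the unit interval to \<open>[-2, 2]\<close>. This is why the residual is 1/10^9
    while the analysis tolerates 1/10^7.\<close>
  have small: "(4 / 10 ^ 9 :: real) \<le> 1 / 10 ^ 7" "4 * (4 / 10 ^ 9 :: real) \<le> 1 / 10 ^ 7" by simp_all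
  have rescale: "\<bar>u - (4 * v - 2)\<bar> = 4 * \<bar>(u + 2) / 4 - v\<bar>" for u v :: real
  proof -
    have "u - (4 * v - 2) = 4 * ((u + 2) / 4 - v)" by (simp add: field_simps)
    then show ?thesis by (simp only: abs_mult abs_numeral)
  qed
  have P1: "ndist k (block k 0 z) (\<lambda>j. stepP1 hi j z) \<le> 1 / 10 ^ 7"
  proof -
    have "ndist k (block k 0 z) (\<lambda>j. stepP1 hi j z) = ndist k (block k 0 (bob ho hi z)) (block k 0 z)"
      unfolding ndist_sym[of k "block k 0 z"] using bob(1) by (intro ndist_cong) auto
    then show ?thesis using order_trans[OF res[OF n5(1)] small(1)] by simp
  qed
  have P2: "ndist k (block k k z) (\<lambda>j. stepP2 ho j z) \<le> 1 / 10 ^ 7"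
  proof -
    have "ndist k (block k k z) (\<lambda>j. stepP2 ho j z) = ndist k (block k k (bob ho hi z)) (block k k z)"
      unfolding ndist_sym[of k "block k k z"] using bob(2) by (intro ndist_cong) auto
    then show ?thesis using order_trans[OF res[OF n5(2)] small(1)] by simp
  qed
  have small4: "4 * \<bar>v\<bar> \<le> 1 / 10 ^ 7" if "\<bar>v\<bar> \<le> 4 / 10 ^ 9" for v :: real
    using order_trans[OF mult_left_mono[OF that, of 4] small(2)] by simp
  have C: "4 * \<bar>stepC z - mean k (block k (2 * k) z)\<bar> \<le> 1 / 10 ^ 7"
    by (rule small4, rule scalar[OF n5(3)], rule bob(3))
  have S: "4 * \<bar>stepS z - mean k (block k (3 * k) z)\<bar> \<le> 1 / 10 ^ 7"
    by (rule small4, rule scalar[OF n5(4)], rule bob(4))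
  have y: "\<bar>stepy z - coordy z\<bar> \<le> 1 / 10 ^ 7" using order_trans[OF scalar[OF n5(5) bob(5)] small(1)] .
  have "ndist k (block k 0 z) (c t) = ndist k (block k 0 x) (c t)"
    using zb[OF n5(1)] by (intro ndist_cong) auto
  then have end_far: "1 / 64 \<le> ndist k (block k 0 z) (c t)" using far by simp
  interpret line_fixpoint k M c "\<lambda>a. ho a (X a)" "\<lambda>a. hi a (X a)" s t
    "block k 0 z" "block k k z" "coordC z" "coordS z" "coordy z"
    "tube (vicinity (block k 0 z)) (vicinity (block k k z)) (start_hat z) (coordC z) (coordS z)"
    using P1[unfolded stepP1_def look2] P2[unfolded stepP2_def look1] C[unfolded stepC_def] S[unfolded stepS_def]
      y[unfolded stepy_def] coord_bounds[OF z] offsets end_far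
    by unfold_locales (simp_all only: rescale)
  show False by (rule contradiction)
qed

end

section \<open>The lower bound\<close>

text \<open>The null pointer becomes a self-loop, as \<open>line_instance\<close> expects at an
  endpoint. Gadget values above \<open>N\<close>, possible for arbitrary shares, are read in the
  same way.\<close>

definition read_pointer :: "nat \<Rightarrow> nat \<Rightarrow> nat \<Rightarrow> nat \<Rightarrow> nat" where
  "read_pointer N b v z = (if 1 \<le> z \<and> z \<le> N then b + z - 1 else v)"

text \<open>Left vertices are numbered from 0, right vertices from \<open>N\<close>. The step from a
  right vertex to the left vertex with the same index is public; only the steps from left to right
  are hidden.\<close>

definition out_table :: "(nat \<Rightarrow> nat \<Rightarrow> nat) \<Rightarrow> nat \<Rightarrow> (nat \<Rightarrow> nat) \<Rightarrow> nat \<Rightarrow> nat \<Rightarrow> nat" where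
  "out_table G N Y v x = (if v < N then read_pointer N N v (G x (Y v)) else v - N)"

definition in_table :: "(nat \<Rightarrow> nat \<Rightarrow> nat) \<Rightarrow> nat \<Rightarrow> (nat \<Rightarrow> nat) \<Rightarrow> nat \<Rightarrow> nat \<Rightarrow> nat" where
  "in_table G N Y v x = (if v < N then N + v else read_pointer N 0 v (G x (Y v)))"

lemma ndist_code:
  assumes "h < card ((A - B) \<union> (B - A))" "A \<subseteq> {..<16 * h}" "B \<subseteq> {..<16 * h}"
  shows "1 / 4 \<le> ndist (16 * h) (\<lambda>j. of_bool (j \<in> A)) (\<lambda>j. of_bool (j \<in> B))"
proof -
  have "(\<Sum>j<16 * h. (of_bool (j \<in> A) - of_bool (j \<in> B))\<^sup>2) = (\<Sum>j\<in>(A - B) \<union> (B - A). 1 :: real)"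
    using assms(2,3) by (intro sum.mono_neutral_cong_right) auto
  then have "real h \<le> (\<Sum>j<16 * h. (of_bool (j \<in> A) - of_bool (j \<in> B))\<^sup>2)" using assms(1) by simp
  then have "sqrt (real h) \<le> L2_set (\<lambda>j. of_bool (j \<in> A) - of_bool (j \<in> B)) {..<16 * h}"
    by (simp add: L2_set_def)
  moreover have "h > 0"
  proof (rule ccontr)
    assume "\<not> h > 0"
    then show False using assms by auto
  qed
  moreover have "sqrt (real (16 * h)) = 4 * sqrt (real h)" by (simp add: real_sqrt_mult)
  ultimately show ?thesis by (simp add: ndist_def field_simps)
qed

context comm_instance
begin

lemma weight_support:
  assumes "weight \<sigma> J X Y \<noteq> 0" "v < 2 * N"
  shows "G (X v) (Y v) = pointers \<sigma> J v"
proof -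
  have "\<rho> (pointers \<sigma> J v) (X v) (Y v) \<noteq> 0"
    using assms unfolding weight_def by (auto simp: prod_zero_iff)
  then show ?thesis by (auto simp: \<rho>_def split: if_splits)
qed

text \<open>The line is the cycle of \<open>\<sigma>\<close> through 0, opened before the right
  vertex 0, which has number \<open>N\<close> and becomes the start. The other cycles of
  \<open>\<sigma>\<close> remain closed.\<close>

lemma line_instance_of_weight:
  assumes \<sigma>: "\<sigma> \<in> perms" and w: "weight \<sigma> {inv \<sigma> 0} X Y \<noteq> 0"
    and c: "\<And>a j. c a j \<in> {0, 1}"
      "\<And>a b. a < 2 * N \<Longrightarrow> b < 2 * N \<Longrightarrow> a \<noteq> b \<Longrightarrow> 1 / 4 \<le> ndist k (c a) (c b)"
  shows "line_instance k (2 * N) c (\<lambda>a. out_table G N Y a (X a)) (\<lambda>a. in_table G N Y a (X a)) N (inv \<sigma> 0)"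
proof -
  let ?t = "inv \<sigma> 0"
  note inv = inv_perm[OF \<sigma>]
  have t: "?t < N" "\<sigma> ?t = 0" using inv[of 0] N_pos by auto
  have t_iff: "l = 0 \<longleftrightarrow> inv \<sigma> l = ?t" if "l < N" for l using inv[OF that] t by metis
  have t_iff': "\<sigma> a = 0 \<longleftrightarrow> a = ?t" if "a < N" for a using inv(4)[OF that] t by metis
  have out: "out_table G N Y a (X a) = (if a < N then if a = ?t then a else N + \<sigma> a else a - N)"
    if "a < 2 * N" for a
    using weight_support[OF w that] inv(3)[of a]
    by (auto simp: out_table_def read_pointer_def pointers_def)
  have inp: "in_table G N Y b (X b) = (if b < N then N + b else if b = N then b else inv \<sigma> (b - N))"
    if "b < 2 * N" for b
  proof (cases "b < N")
    case False
    then have l: "b - N < N" using that by simp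
    show ?thesis
      using weight_support[OF w that] inv(1)[OF l] t_iff[OF l] False
      by (auto simp: in_table_def read_pointer_def pointers_def)
  qed (simp add: in_table_def)
  have inpb: "inv \<sigma> (b - N) = a \<longleftrightarrow> b = N + \<sigma> a" if "N \<le> b" "b < 2 * N" "a < N" for a b
    using inv(4)[OF that(3)] inv(2)[of "b - N"] that by fastforce
  show ?thesis
  proof
    fix a b assume a: "a < 2 * N" and b: "b < 2 * N" and ab: "a \<noteq> b"
    show "out_table G N Y a (X a) = b \<longleftrightarrow> in_table G N Y b (X b) = a"
    proof (cases "a < N")
      case True
      show ?thesis
      proof (cases "b < N")
        case False
        then have "in_table G N Y b (X b) = a \<longleftrightarrow> b \<noteq> N \<and> b = N + \<sigma> a"
          using inp[OF b] inpb[of b a] b True by auto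
        also have "\<dots> \<longleftrightarrow> a \<noteq> ?t \<and> b = N + \<sigma> a" using t_iff'[OF True] by auto
        also have "\<dots> \<longleftrightarrow> out_table G N Y a (X a) = b" using out[OF a] True ab by auto
        finally show ?thesis by blast
      qed (use out[OF a] inp[OF b] True ab in auto)
    next
      case False
      have "inv \<sigma> (b - N) < N" if "\<not> b < N" using inv(1)[of "b - N"] that b by auto
      then show ?thesis using out[OF a] inp[OF b] False a b ab by auto
    qed
  next
    fix a assume a: "a < 2 * N"
    show "out_table G N Y a (X a) < 2 * N" using out[OF a] inv(3)[of a] a by auto
    have "inv \<sigma> (a - N) < 2 * N" if "\<not> a < N" using inv(1)[of "a - N"] that a by linarith
    then show "in_table G N Y a (X a) < 2 * N" using inp[OF a] a by auto
    show "out_table G N Y a (X a) = a \<longleftrightarrow> a = ?t" using out[OF a] N_pos t by auto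
    have "inv \<sigma> (a - N) \<noteq> a" if "\<not> a < N" using inv(1)[of "a - N"] that a by linarith
    then show "in_table G N Y a (X a) = a \<longleftrightarrow> a = N" using inp[OF a] N_pos by auto
  qed (use c N_pos t in auto)
qed

end

theorem comp_cost_lower_bound:
  fixes e n :: nat and p :: ereal
  defines "k \<equiv> 16 * (e + 4)"
  assumes p: "p \<in> {2, \<infinity>}" and e: "1 \<le> e" and n: "5 * k \<le> n" "2 * n + 1 \<le> 16 * k"
    and M: "randomized_protocol (lipschitz_maps p n (2 * n + 1) (1 + 256))
        (lipschitz_maps p (2 * n + 1) n (1 + 10 ^ 6)) (comp_solution p n (1 / 10 ^ 9)) cst M"
  shows "2 ^ e \<le> cst"
proof -
  \<comment> \<open>\<open>l\<close> makes room for the null pointer besides \<open>N\<close>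
    vertices, and \<open>w\<close> makes \<open>\<eta>\<close> exactly \<open>1 / (256 * N)\<close>.
    The first player's share then has \<open>2 * l + w = 10 * e + 39\<close> bits, which the
    \<open>10 * (e + 4)\<close> bits of the code can name.\<close>
  define D N l w K :: nat where "D = 2 ^ e" and "N = 2 ^ (2 * e + 4)" and "l = 2 * e + 5"
    and "w = 6 * e + 29" and "K = 2 ^ (10 * (e + 4))"
  obtain G where G: "hash_gadget G (2 ^ (2 * l + w)) (2 ^ w) (2 ^ l)" using ex_hash_gadget by blast
  obtain A :: "nat \<Rightarrow> nat set" where A: "\<forall>a<K. A a \<subseteq> {..<k}"
    "\<forall>a<K. \<forall>b<K. a \<noteq> b \<longrightarrow> e + 4 < card ((A a - A b) \<union> (A b - A a))"
    using ex_code[of K "e + 4"] unfolding K_def k_def by auto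
  define c :: "nat \<Rightarrow> point" where "c a j = of_bool (j \<in> A a)" for a j
  have c01: "c a j \<in> {0, 1}" for a j by (simp add: c_def)
  have sep: "1 / 4 \<le> ndist k (c a) (c b)" if "a < K" "b < K" "a \<noteq> b" for a b
    using ndist_code[of "e + 4" "A a" "A b"] A that by (simp add: c_def[abs_def] k_def)
  have ND: "N = 16 * D\<^sup>2" by (simp add: N_def D_def power_add power_mult mult.commute[of 2 e])
  have NK: "2 * N \<le> K"
  proof -
    have "2 * N = 2 ^ (2 * e + 5)" by (simp add: N_def power_add)
    also have "\<dots> \<le> K" unfolding K_def by (intro power_increasing) auto
    finally show ?thesis .
  qed
  have XK: "2 ^ (2 * l + w) \<le> K" unfolding K_def l_def w_def by (intro power_increasing) auto
  interpret encoding n k "2 * N" K c N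
    by unfold_locales (use n NK c01 sep in \<open>auto simp: k_def N_def\<close>)
  interpret H: hash_gadget G "2 ^ (2 * l + w)" "2 ^ w" "2 ^ l" by (rule G)
  define fb where "fb Y = bob (out_table G N Y) (in_table G N Y)" for Y
  define close where "close i x \<longleftrightarrow> ndist k (block k 0 x) (c i) < 1 / 64" for i and x :: point
  have inst: "comm_instance G (2 ^ (2 * l + w)) (2 ^ w) (2 ^ l) N D close"
  proof unfold_locales
    show "N = 16 * D\<^sup>2" by (rule ND)
    have "(2 :: nat) ^ 1 \<le> 2 ^ e" using e by (intro power_increasing) auto
    then show "2 \<le> D" by (simp add: D_def)
    show "N < 2 ^ l" by (simp add: N_def l_def)
    have "real (2 ^ l) / real (2 ^ w) = (1 / (256 * real N))\<^sup>2"
    proof -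
      have "(2 :: real) ^ w = 2 ^ l * (256 * real N)\<^sup>2"
      proof -
        have "(256 * real N)\<^sup>2 = 2 ^ (4 * e + 24)"
        proof -
          have "256 * real N = 2 ^ (2 * e + 12)" by (simp add: N_def power_add)
          then show ?thesis by (simp add: power_add flip: power_mult)
        qed
        then show ?thesis by (simp add: w_def l_def flip: power_add)
      qed
      then show ?thesis by (simp add: power_divide)
    qed
    then show "H.\<eta> \<le> 1 / (256 * real N)" by (simp add: H.\<eta>_def)
  next
    fix i j x assume "close i x" "close j x" and ij: "i < N" "j < N"
    show "i = j"
    proof (rule ccontr)
      assume "i \<noteq> j"
      then have "1 / 4 \<le> ndist k (c i) (c j)" using sep ij NK by auto
      also have "\<dots> \<le> ndist k (c i) (block k 0 x) + ndist k (block k 0 x) (c j)" by (rule ndist_triangle)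
      finally show False using \<open>close i x\<close> \<open>close j x\<close> ndist_sym[of k "c i"] by (simp add: close_def)
    qed
  qed
  let ?I = "{\<sigma>. \<sigma> permutes {..<N}} \<times> ({..<2 * N} \<rightarrow>\<^sub>E {..<2 ^ (2 * l + w)}) \<times> ({..<2 * N} \<rightarrow>\<^sub>E {..<2 ^ w})"
  \<comment> \<open>The protocol is found only after the weights have been fixed, so a dummy
    protocol stands in. The weights do not depend on it, hence agree with those of the later
    interpretation.\<close>
  interpret comm_instance G "2 ^ (2 * l + w)" "2 ^ w" "2 ^ l" N D "Output undefined" alice fb close
    by (rule inst)
  let ?w = "\<lambda>\<sigma>. weight \<sigma> {inv \<sigma> 0}"
  let ?sol = "\<lambda>P X Y. comp_solution p n (1 / 10 ^ 9) (alice X) (fb Y) (run P (alice X) (fb Y))"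
  have "\<exists>P\<in>space M. 2 / 3 * (\<Sum>(\<sigma>, X, Y)\<in>?I. ?w \<sigma> X Y)
      \<le> (\<Sum>(\<sigma>, X, Y)\<in>?I. ?w \<sigma> X Y * of_bool (?sol P X Y))"
    using ex_good_protocol[OF M, of ?I "\<lambda>(\<sigma>, X, Y). ?w \<sigma> X Y"
        "\<lambda>(\<sigma>, X, Y). alice X" "\<lambda>(\<sigma>, X, Y). fb Y"]
      finite_perms finite_inputs weight_nonneg alice_maps[OF p] bob_maps[OF p]
    unfolding fb_def by (auto simp: case_prod_unfold)
  then obtain P where P: "P \<in> space M" "2 / 3 * (\<Sum>(\<sigma>, X, Y)\<in>?I. ?w \<sigma> X Y)
      \<le> (\<Sum>(\<sigma>, X, Y)\<in>?I. ?w \<sigma> X Y * of_bool (?sol P X Y))" by blast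
  interpret F: comm_instance G "2 ^ (2 * l + w)" "2 ^ w" "2 ^ l" N D P alice fb close
    by (rule inst)
  have "2 / 3 * real (card perms) = 2 / 3 * (\<Sum>\<sigma>\<in>perms. \<Sum>X\<in>inputsA. \<Sum>Y\<in>inputsB. ?w \<sigma> X Y)"
    by (simp add: sum_weight)
  also have "\<dots> \<le> (\<Sum>\<sigma>\<in>perms. \<Sum>X\<in>inputsA. \<Sum>Y\<in>inputsB. ?w \<sigma> X Y * of_bool (?sol P X Y))"
    using P(2) by (simp add: sum.cartesian_product[symmetric])
  also have "\<dots> \<le> (\<Sum>\<sigma>\<in>perms. \<Sum>X\<in>inputsA. \<Sum>Y\<in>inputsB.
      ?w \<sigma> X Y * of_bool (close (inv \<sigma> 0) (run P (alice X) (fb Y))))"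
  proof (intro sum_mono)
    fix \<sigma> X Y assume \<sigma>: "\<sigma> \<in> perms" and X: "X \<in> inputsA"
    have "close (inv \<sigma> 0) (run P (alice X) (fb Y))" if sol: "?sol P X Y" and nz: "?w \<sigma> X Y \<noteq> 0"
      unfolding close_def
    proof (rule approx_fixpoint_near_end[where X = X and ho = "out_table G N Y" and hi = "in_table G N Y"])
      show "line_instance k (2 * N) c (\<lambda>a. out_table G N Y a (X a)) (\<lambda>a. in_table G N Y a (X a)) N (inv \<sigma> 0)"
        using line_instance_of_weight[OF \<sigma> nz, of c k] c01 sep NK by auto
      show "X a < K" if "a < 2 * N" for a using PiE_mem[OF X, of a] that XK by auto
      show "run P (alice X) (fb Y) \<in> cube n" using sol by (simp add: comp_solution_def)
      show "ndist n (bob (out_table G N Y) (in_table G N Y) (alice X (run P (alice X) (fb Y)))) (run P (alice X) (fb Y)) \<le> 1 / 10 ^ 9"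
        using sol ndist_le_pnorm[OF p pos(3)] unfolding comp_solution_def fb_def by (meson order_trans)
    qed
    then show "?w \<sigma> X Y * of_bool (?sol P X Y)
        \<le> ?w \<sigma> X Y * of_bool (close (inv \<sigma> 0) (run P (alice X) (fb Y)))"
      using weight_nonneg[of \<sigma> "{inv \<sigma> 0}" X Y] by (cases "?w \<sigma> X Y = 0") auto
  qed
  finally have "D \<le> cost P" by (intro F.cost_ge) (simp add: F.hit_def)
  also have "\<dots> \<le> cst" using M P(1) by (simp add: randomized_protocol_def)
  finally show ?thesis by (simp add: D_def)
qed

theorem theorem1p2:
  fixes p :: ereal
  assumes "p \<in> {2, \<infinity>}"
  shows "\<exists>(L\<^sub>A::real) (L\<^sub>B::real) (\<epsilon>::real) (m :: nat \<Rightarrow> nat).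
           L\<^sub>A \<ge> 0 \<and> L\<^sub>B \<ge> 0 \<and> \<epsilon> > 0 \<and>
           (\<forall>n. m n \<ge> 1) \<and> (\<lambda>n. real (m n)) \<in> O(\<lambda>n. real n) \<and>
           (\<exists>c::real. c > 0 \<and>
              (\<forall>\<^sub>F n in sequentially.
                 ereal_of_enat (comp_CC p n (m n) \<epsilon> L\<^sub>A L\<^sub>B) \<ge> ereal (2 powr (c * real n))))"
proof (intro exI conjI allI)
  show "(0::real) \<le> 1 + 256" "(0::real) \<le> 1 + 10 ^ 6" "(0::real) < 1 / 10 ^ 9" "(0::real) < 1 / 160"
    by simp_all
  show "1 \<le> 2 * n + 1" for n :: nat by simp
  show "(\<lambda>n. real (2 * n + 1)) \<in> O(\<lambda>n. real n)"
    by (rule bigoI[where c = 3]) (auto simp: eventually_sequentially intro!: exI[of _ 1])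
  show "\<forall>\<^sub>F n in sequentially. ereal (2 powr (1 / 160 * real n))
      \<le> ereal_of_enat (comp_CC p n (2 * n + 1) (1 / 10 ^ 9) (1 + 256) (1 + 10 ^ 6))"
    unfolding eventually_sequentially
  proof (intro exI[of _ 800] allI impI)
    fix n :: nat assume n: "800 \<le> n"
    \<comment> \<open>With \<open>k = 16 * (e + 4)\<close> this makes five blocks fit into
      \<open>n\<close>. Rounding and the shift by 4 lose at most 5, so \<open>e\<close> is at least
      \<open>n / 80 - 5\<close>, which reaches \<open>n / 160\<close> from \<open>n = 800\<close>
      on.\<close>
    define e where "e = n div 80 - 4"
    have d: "10 \<le> n div 80" "80 * (n div 80) \<le> n" "n < 80 * (n div 80) + 80"
      using n by (auto simp: dividend_less_times_div div_le_mono[of 800 n 80, simplified])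
    have e4: "e + 4 = n div 80" using d by (simp add: e_def)
    let ?CC = "comp_CC p n (2 * n + 1) (1 / 10 ^ 9) (1 + 256) (1 + 10 ^ 6)"
    have "2 ^ e \<le> cst" if "randomized_protocol (lipschitz_maps p n (2 * n + 1) (1 + 256))
        (lipschitz_maps p (2 * n + 1) n (1 + 10 ^ 6)) (comp_solution p n (1 / 10 ^ 9)) cst M"
      for cst and M :: "(_, _, _) protocol measure"
    proof (rule comp_cost_lower_bound[OF assms _ _ _ that])
      show "1 \<le> e" using d by (simp add: e_def)
      show "5 * (16 * (e + 4)) \<le> n" "2 * n + 1 \<le> 16 * (16 * (e + 4))" unfolding e4 using d by linarith+
    qed
    then have "enat (2 ^ e) \<le> ?CC"
      unfolding comp_CC_def randomized_CC_def by (intro Inf_greatest) auto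
    then have "ereal_of_enat (enat (2 ^ e)) \<le> ereal_of_enat (?CC)"
      by (simp only: ereal_of_enat_le_iff)
    moreover have "2 powr (1 / 160 * real n) \<le> 2 ^ e"
    proof -
      have "real n \<le> 80 * real (n div 80) + 80" using d(3) by linarith
      moreover have "real e = real (n div 80) - 4" using e4 by linarith
      ultimately have "1 / 160 * real n \<le> real e" using n by linarith
      then have "2 powr (1 / 160 * real n) \<le> 2 powr real e" by (intro powr_mono) auto
      then show ?thesis by (simp add: powr_realpow)
    qed
    then have "ereal (2 powr (1 / 160 * real n)) \<le> ereal_of_enat (enat (2 ^ e))" by simp
    ultimately show "ereal (2 powr (1 / 160 * real n))
        \<le> ereal_of_enat (?CC)"
      by (rule order_trans[rotated])
  qed
qed

end
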